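(* Let $d\ge 2$ be an integer, $T,s>0$ and $\varphi\in L^2(\mathbb R^d)$, and suppose that $(\varphi_{T,s}^k)_{k\in\mathbb Z^d}$ is a Riesz basis of $\mathcal V_{T,s,\varphi}$. Define $$\mathcal E_\varphi(s,T\xi) := 1-\frac{|\hat\varphi(T\xi)|^2}{\sum_{k\in\mathbb Z^d}|\hat\varphi(T\xi+2k\pi/s)|^2}\qquad\text{for } \xi\in\mathbb R^d .$$ Then, for every $f\in W_2^r(\mathbb R^d)$ with $r>d/2$, we have $$\|\mathbf P_{T,s}f-f\|_{L^2}=\left[\int_{[-\frac{\pi}{Ts},\frac{\pi}{Ts}]^d}|\hat f(\xi)|^2\,\mathcal E_\varphi(s,T\xi)\,d\xi\right]^{1/2}+\mathcal R_\varphi(f,Ts),$$ where the remainder $\mathcal R_\varphi(f,Ts)$ (defined by this equation) can be estimated as $$\mathcal R_\varphi(f,Ts)\le \|f\|_{W_2^r}\left(\frac{Ts}{\pi}\right)^r\sqrt{\sum_{n\in\mathbb Z^d\setminus\{0\}}\frac{1}{\|n\|^{2r}}}\,.$$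
   Context: For $\varphi\in L^2(\mathbb R^d)$, $T,s>0$ and $k\in\mathbb Z^d$ set $$\varphi_{T,s}^k(x) := T^{-d/2}\,\varphi\!\left(\tfrac{x}{T}-sk\right),$$ and let $\mathcal V_{T,s,\varphi}$ be the closure in $L^2(\mathbb R^d)$ of the linear span of $\{\varphi_{T,s}^k : k\in\mathbb Z^d\}$. The family $(\varphi_{T,s}^k)_{k\in\mathbb Z^d}$ is a Riesz basis of $\mathcal V_{T,s,\varphi}$ if there exist $A,B>0$ with $A\|c\|_{\ell^2}^2\le\|\sum_{k\in\mathbb Z^d}c_k\varphi_{T,s}^k\|_{L^2}^2\le B\|c\|_{\ell^2}^2$ for all $c\in\ell^2(\mathbb Z^d)$. $\mathbf P_{T,s}\colon L^2(\mathbb R^d)\to\mathcal V_{T,s,\varphi}$ is the orthogonal projection onto $\mathcal V_{T,s,\varphi}$. The Fourier transform is $\hat\varphi(\xi)=(2\pi)^{-d/2}\int_{\mathbb R^d}\varphi(x)e^{-i\xi\cdot x}\,dx$ for $\varphi\in L^1\cap L^2$, extended to $L^2(\mathbb R^d)$ by continuity. $W_2^r(\mathbb R^d)$ is the $L^2$-Sobolev space of order $r$ with norm $\|f\|_{W_2^r}^2=\int_{\mathbb R^d}(1+\|\xi\|^2)^r|\hat f(\xi)|^2\,d\xi$. $\|\cdot\|$ on $\mathbb R^d$ is the Euclidean norm. Functions in $L^2(\mathbb R^d)$ may be complex-valued. The quotient defining $\mathcal E_\varphi$ is understood for almost every $\xi$. *)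

theory Defs
  imports "HOL-Analysis.Analysis"
begin

text \<open>
  Elements of \<open>L\<^sup>2(\<real>\<^sup>d)\<close> are represented by Lebesgue measurable, square integrable functions
  on \<open>real ^ 'n\<close> with \<open>d = CARD('n)\<close>; functions that agree almost everywhere are not identified.
\<close>

definition L2 :: "(real ^ 'n \<Rightarrow> complex) set" where
  "L2 = {f. f \<in> borel_measurable lebesgue \<and> integrable lebesgue (\<lambda>x. (cmod (f x))\<^sup>2)}"

text \<open>The next two definitions are meaningful only for arguments in \<open>L2\<close>: a Bochner integral
  that does not exist has value 0.\<close>

definition L2_inner :: "(real ^ 'n \<Rightarrow> complex) \<Rightarrow> (real ^ 'n \<Rightarrow> complex) \<Rightarrow> complex" where
  "L2_inner f g = (LINT x|lebesgue. f x * cnj (g x))"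

definition L2_norm :: "(real ^ 'n \<Rightarrow> complex) \<Rightarrow> real" where
  "L2_norm f = sqrt (LINT x|lebesgue. (cmod (f x))\<^sup>2)"

definition fourier_integral :: "(real ^ 'n \<Rightarrow> complex) \<Rightarrow> real ^ 'n \<Rightarrow> complex" where
  "fourier_integral f \<xi> =
     complex_of_real ((2 * pi) powr (- real CARD('n) / 2)) *
       (LINT x|lebesgue. f x * exp (- \<i> * complex_of_real (\<xi> \<bullet> x)))"

text \<open>Extension by continuity from \<open>L\<^sup>1 \<inter> L\<^sup>2\<close> to \<open>L\<^sup>2\<close>. The conditions determine the result
  up to a null set.\<close>

definition fourier :: "(real ^ 'n \<Rightarrow> complex) \<Rightarrow> real ^ 'n \<Rightarrow> complex" where
  "fourier f = (SOME g. g \<in> L2 \<and>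
     (\<forall>u. (\<forall>n. integrable lebesgue (u n) \<and> u n \<in> L2) \<and>
          (\<lambda>n. L2_norm (\<lambda>x. u n x - f x)) \<longlonglongrightarrow> 0 \<longrightarrow>
          (\<lambda>n. L2_norm (\<lambda>\<xi>. fourier_integral (u n) \<xi> - g \<xi>)) \<longlonglongrightarrow> 0))"

definition lattice_vec :: "int ^ 'n \<Rightarrow> real ^ 'n" where
  "lattice_vec k = (\<chi> i. real_of_int (k $ i))"

definition shifted :: "real \<Rightarrow> real \<Rightarrow> (real ^ 'n \<Rightarrow> complex) \<Rightarrow> int ^ 'n \<Rightarrow> real ^ 'n \<Rightarrow> complex" where
  "shifted T s \<phi> k x =
     complex_of_real (T powr (- real CARD('n) / 2)) * \<phi> (x /\<^sub>R T - s *\<^sub>R lattice_vec k)"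

definition shift_span :: "real \<Rightarrow> real \<Rightarrow> (real ^ 'n \<Rightarrow> complex) \<Rightarrow> (real ^ 'n \<Rightarrow> complex) set" where
  "shift_span T s \<phi> = {(\<lambda>x. \<Sum>k\<in>K. c k * shifted T s \<phi> k x) | K c. finite K}"

definition shift_space :: "real \<Rightarrow> real \<Rightarrow> (real ^ 'n \<Rightarrow> complex) \<Rightarrow> (real ^ 'n \<Rightarrow> complex) set" where
  "shift_space T s \<phi> =
     {g \<in> L2. \<forall>\<epsilon>>0. \<exists>h\<in>shift_span T s \<phi>. L2_norm (\<lambda>x. g x - h x) < \<epsilon>}"

text \<open>Unconditional convergence in \<open>L\<^sup>2\<close> of a family of functions.\<close>

definition L2_has_sum ::
  "('k \<Rightarrow> real ^ 'n \<Rightarrow> complex) \<Rightarrow> (real ^ 'n \<Rightarrow> complex) \<Rightarrow> bool" where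
  "L2_has_sum F g \<longleftrightarrow> g \<in> L2 \<and>
     ((\<lambda>K. L2_norm (\<lambda>x. (\<Sum>k\<in>K. F k x) - g x)) \<longlongrightarrow> 0) (finite_subsets_at_top UNIV)"

text \<open>That the series converges for every square summable \<open>c\<close> is part of the condition.\<close>

definition riesz_basis_shifts :: "real \<Rightarrow> real \<Rightarrow> (real ^ 'n \<Rightarrow> complex) \<Rightarrow> bool" where
  "riesz_basis_shifts T s \<phi> \<longleftrightarrow>
     (\<exists>A>0. \<exists>B>0. \<forall>c :: int ^ 'n \<Rightarrow> complex.
        (\<lambda>k. (cmod (c k))\<^sup>2) summable_on UNIV \<longrightarrow>
        (\<exists>g. L2_has_sum (\<lambda>k x. c k * shifted T s \<phi> k x) g \<and>
             A * (\<Sum>\<^sub>\<infinity>k. (cmod (c k))\<^sup>2) \<le> (L2_norm g)\<^sup>2 \<and>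
             (L2_norm g)\<^sup>2 \<le> B * (\<Sum>\<^sub>\<infinity>k. (cmod (c k))\<^sup>2)))"

text \<open>A representative of the orthogonal projection, which is unique up to a null set.\<close>

definition shift_proj ::
  "real \<Rightarrow> real \<Rightarrow> (real ^ 'n \<Rightarrow> complex) \<Rightarrow> (real ^ 'n \<Rightarrow> complex) \<Rightarrow> real ^ 'n \<Rightarrow> complex" where
  "shift_proj T s \<phi> f = (SOME g. g \<in> shift_space T s \<phi> \<and>
     (\<forall>h\<in>shift_space T s \<phi>. L2_inner (\<lambda>x. f x - g x) h = 0))"

definition sobolev :: "real \<Rightarrow> (real ^ 'n \<Rightarrow> complex) set" where
  "sobolev r = {f \<in> L2. integrable lebesgue
     (\<lambda>\<xi>. (1 + (norm \<xi>)\<^sup>2) powr r * (cmod (fourier f \<xi>))\<^sup>2)}"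

definition sobolev_norm :: "real \<Rightarrow> (real ^ 'n \<Rightarrow> complex) \<Rightarrow> real" where
  "sobolev_norm r f =
     sqrt (LINT \<xi>|lebesgue. (1 + (norm \<xi>)\<^sup>2) powr r * (cmod (fourier f \<xi>))\<^sup>2)"

definition error_kernel :: "(real ^ 'n \<Rightarrow> complex) \<Rightarrow> real \<Rightarrow> real ^ 'n \<Rightarrow> real" where
  "error_kernel \<phi> s \<eta> =
     1 - (cmod (fourier \<phi> \<eta>))\<^sup>2 /
         (\<Sum>\<^sub>\<infinity>k. (cmod (fourier \<phi> (\<eta> + (2 * pi / s) *\<^sub>R lattice_vec k)))\<^sup>2)"

end

theory Submission
  imports Defs "HOL-Probability.Characteristic_Functions"
begin

text \<open>
  By Plancherel's theorem, the distance from \<open>f\<close> to an element of the span of the shifts is the norm of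
  \<open>fourier f - p * b\<close>, where \<open>b \<xi> = fourier \<phi> (T *\<^sub>R \<xi>)\<close> and \<open>p\<close> is a trigonometric polynomial with
  period \<open>2 * pi / (T * s)\<close> in every coordinate; the projection error is at most any such distance.
  Restrict \<open>fourier f\<close> to the cube with coordinates in \<open>[- pi / (T * s), pi / (T * s)]\<close>. The best
  periodic multiplier \<open>m\<close> for the restriction is found pointwise, its squared error is exactly the
  integral against the error kernel, and \<open>m * b\<close> is an \<open>L\<^sup>2\<close> limit of functions \<open>p * b\<close>
  by Stone-Weierstrass on the torus. The rest of \<open>fourier f\<close> lives where \<open>norm \<xi> \<ge> pi / (T * s)\<close>,
  so the Sobolev norm controls it; the lattice sum in the bound is at least 1.
\<close>

section \<open>Square integrable functions\<close>

text \<open>The remainder is bounded from above only, so one good competitor in the span suffices,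
  and its multiplier need not be optimal for all of \<open>fourier f\<close>. Truncation to the cube
  makes the optimum explicit: every coset of the dual lattice meets the cube exactly once, so the
  squared error on a coset is |h|^2 - |h|^2 |b|^2 / S, where S is the sum of |b|^2 over the coset;
  this is the error kernel. The price is one triangle inequality, and its extra term is the
  remainder. The obstacle is that the multiplier h cnj(b) / S may be unbounded and may jump across
  the faces of the cube, whereas Stone-Weierstrass reaches only continuous functions on the torus.
  Hence the approximation in L^2 with weight |b|^2, through truncation of values and cutoffs near
  the faces. Both \<open>fourier\<close> and \<open>shift_proj\<close> are choices by
  \<open>SOME\<close>, so all knowledge of them comes from existence proofs and L^2 limits. The
  condition r > d/2 makes the lattice sum converge; \<open>infsum\<close> of a divergent family
  would be 0 and could not dominate the tail.\<close>

lemma L2_measurable: "f \<in> L2 \<Longrightarrow> f \<in> borel_measurable lebesgue"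
  by (simp add: L2_def)

lemma L2_integrable: "f \<in> L2 \<Longrightarrow> integrable lebesgue (\<lambda>x. (cmod (f x))\<^sup>2)"
  by (simp add: L2_def)

lemma L2_norm_nonneg [simp]: "0 \<le> L2_norm f"
  by (simp add: L2_norm_def)

lemma L2_norm_sq: "(L2_norm f)\<^sup>2 = (LINT x|lebesgue. (cmod (f x))\<^sup>2)"
  by (simp add: L2_norm_def)

lemma L2_iff_nn:
  "f \<in> L2 \<longleftrightarrow> f \<in> borel_measurable lebesgue \<and> (\<integral>\<^sup>+x. ennreal ((cmod (f x))\<^sup>2) \<partial>lebesgue) < \<infinity>"
  unfolding L2_def by (auto simp: integrable_iff_bounded)

lemma L2_norm_sq_nn:
  "f \<in> L2 \<Longrightarrow> ennreal ((L2_norm f)\<^sup>2) = (\<integral>\<^sup>+x. ennreal ((cmod (f x))\<^sup>2) \<partial>lebesgue)"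
  unfolding L2_norm_sq by (rule nn_integral_eq_integral[symmetric]) (auto simp: L2_def)

lemma L2_bounded:
  assumes "f \<in> borel_measurable lebesgue" "integrable lebesgue W"
    and "AE x in lebesgue. (cmod (f x))\<^sup>2 \<le> W x"
  shows "f \<in> L2" "(L2_norm f)\<^sup>2 \<le> (LINT x|lebesgue. W x)"
proof -
  have i: "integrable lebesgue (\<lambda>x. (cmod (f x))\<^sup>2)"
    by (rule Bochner_Integration.integrable_bound[OF assms(2)]) (use assms in auto)
  then show "f \<in> L2" using assms by (simp add: L2_def)
  show "(L2_norm f)\<^sup>2 \<le> (LINT x|lebesgue. W x)"
    unfolding L2_norm_sq by (rule integral_mono_AE[OF i assms(2,3)])
qed

lemma L2_dominated:
  assumes "f \<in> borel_measurable lebesgue" "g \<in> L2" "AE x in lebesgue. cmod (f x) \<le> cmod (g x)"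
  shows "f \<in> L2" "L2_norm f \<le> L2_norm g"
proof -
  have ae: "AE x in lebesgue. (cmod (f x))\<^sup>2 \<le> (cmod (g x))\<^sup>2"
    using assms(3) by eventually_elim (simp add: power_mono)
  note * = L2_bounded[OF assms(1) L2_integrable[OF assms(2)] ae]
  show "f \<in> L2" by (rule *)
  show "L2_norm f \<le> L2_norm g" using *(2) unfolding L2_norm_sq[symmetric, of g]
    by (rule power2_le_imp_le) simp
qed

lemma L2_zero [simp]: "(\<lambda>x. 0) \<in> L2"
  by (simp add: L2_def)

lemma L2_norm_zero [simp]: "L2_norm (\<lambda>x. 0) = 0"
  by (simp add: L2_norm_def)

lemma L2_scale: "f \<in> L2 \<Longrightarrow> (\<lambda>x. c * f x) \<in> L2"
  by (auto simp: L2_def norm_mult power_mult_distrib)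

lemma L2_norm_scale: "L2_norm (\<lambda>x. c * f x) = cmod c * L2_norm f"
  by (simp add: L2_norm_def norm_mult power_mult_distrib real_sqrt_mult)

lemma L2_uminus: "f \<in> L2 \<Longrightarrow> (\<lambda>x. - f x) \<in> L2"
  using L2_scale[of f "-1"] by simp

lemma L2_norm_minus_commute: "L2_norm (\<lambda>x. f x - g x) = L2_norm (\<lambda>x. g x - f x)"
  by (simp add: L2_norm_def norm_minus_commute)

text \<open>A weighted Cauchy-Schwarz inequality whose defect is a square. With the weights tuned to
  the norms it integrates to Minkowski's inequality, so no Hoelder inequality is required.\<close>

lemma cmod_add_sq_weighted:
  assumes "\<alpha> > 0" "\<beta> > 0"
  shows "(cmod (u + v))\<^sup>2 \<le> (\<alpha> + \<beta>) * ((cmod u)\<^sup>2 / \<alpha> + (cmod v)\<^sup>2 / \<beta>)"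
proof -
  have "(cmod (u + v))\<^sup>2 \<le> (cmod u + cmod v)\<^sup>2"
    by (simp add: norm_triangle_ineq power_mono)
  also have "(cmod u + cmod v)\<^sup>2 + (\<beta> * cmod u - \<alpha> * cmod v)\<^sup>2 / (\<alpha> * \<beta>)
      = (\<alpha> + \<beta>) * ((cmod u)\<^sup>2 / \<alpha> + (cmod v)\<^sup>2 / \<beta>)"
    using assms by (simp add: field_simps power2_eq_square)
  then have "(cmod u + cmod v)\<^sup>2 \<le> (\<alpha> + \<beta>) * ((cmod u)\<^sup>2 / \<alpha> + (cmod v)\<^sup>2 / \<beta>)"
    using assms by (smt (verit) divide_nonneg_pos mult_pos_pos zero_le_power2)
  finally show ?thesis .
qed

lemma
  assumes f: "f \<in> L2" and g: "g \<in> L2"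
  shows L2_add: "(\<lambda>x. f x + g x) \<in> L2"
    and L2_norm_triangle: "L2_norm (\<lambda>x. f x + g x) \<le> L2_norm f + L2_norm g"
proof -
  have [measurable]: "f \<in> borel_measurable lebesgue" "g \<in> borel_measurable lebesgue"
    using f g by (auto simp: L2_def)
  have *: "(\<lambda>x. f x + g x) \<in> L2 \<and> (L2_norm (\<lambda>x. f x + g x))\<^sup>2
      \<le> (\<alpha> + \<beta>) * ((L2_norm f)\<^sup>2 / \<alpha> + (L2_norm g)\<^sup>2 / \<beta>)"
    if "\<alpha> > 0" "\<beta> > 0" for \<alpha> \<beta> :: real
  proof -
    let ?W = "\<lambda>x. (\<alpha> + \<beta>) * ((cmod (f x))\<^sup>2 / \<alpha> + (cmod (g x))\<^sup>2 / \<beta>)"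
    have "integrable lebesgue ?W" using f g by (auto simp: L2_def)
    moreover have "(LINT x|lebesgue. ?W x) = (\<alpha> + \<beta>) * ((L2_norm f)\<^sup>2 / \<alpha> + (L2_norm g)\<^sup>2 / \<beta>)"
      using f g by (simp add: L2_def L2_norm_sq)
    moreover have "(\<lambda>x. f x + g x) \<in> borel_measurable lebesgue" by measurable
    moreover have "AE x in lebesgue. (cmod (f x + g x))\<^sup>2 \<le> ?W x"
      using cmod_add_sq_weighted[OF that] by simp
    ultimately show ?thesis
      using L2_bounded[of "\<lambda>x. f x + g x" ?W] by metis
  qed
  show "(\<lambda>x. f x + g x) \<in> L2" using *[of 1 1] by simp
  show "L2_norm (\<lambda>x. f x + g x) \<le> L2_norm f + L2_norm g"
  proof (rule field_le_epsilon)
    fix e :: real assume e: "e > 0"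
    \<comment> \<open>The optimal weights are the two norms; the added e/2 keeps them positive when
      a norm is 0.\<close>
    let ?a = "L2_norm f + e/2" and ?b = "L2_norm g + e/2"
    have p: "?a > 0" "?b > 0" using e by (simp_all add: add_nonneg_pos)
    have "(L2_norm f)\<^sup>2 / ?a \<le> ?a" "(L2_norm g)\<^sup>2 / ?b \<le> ?b"
      using p e by (auto simp: divide_le_eq power2_eq_square intro!: mult_mono)
    then have "(?a + ?b) * ((L2_norm f)\<^sup>2 / ?a + (L2_norm g)\<^sup>2 / ?b) \<le> (?a + ?b) * (?a + ?b)"
      using p by (intro mult_left_mono) auto
    then have "(L2_norm (\<lambda>x. f x + g x))\<^sup>2 \<le> (?a + ?b)\<^sup>2"
      using *[OF p] by (simp add: power2_eq_square)
    then show "L2_norm (\<lambda>x. f x + g x) \<le> L2_norm f + L2_norm g + e"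
      using p by (auto dest!: power2_le_imp_le)
  qed
qed

lemma L2_diff: "f \<in> L2 \<Longrightarrow> g \<in> L2 \<Longrightarrow> (\<lambda>x. f x - g x) \<in> L2"
  using L2_add[of f "\<lambda>x. - g x"] L2_uminus by auto

lemma L2_sum: "(\<And>k. k \<in> K \<Longrightarrow> F k \<in> L2) \<Longrightarrow> (\<lambda>x. \<Sum>k\<in>K. F k x) \<in> L2"
  by (induction K rule: infinite_finite_induct) (auto intro: L2_add)

lemma L2_norm_triangle_diff:
  assumes "f \<in> L2" "g \<in> L2" "h \<in> L2"
  shows "L2_norm (\<lambda>x. f x - h x) \<le> L2_norm (\<lambda>x. f x - g x) + L2_norm (\<lambda>x. g x - h x)"
  using L2_norm_triangle[of "\<lambda>x. f x - g x" "\<lambda>x. g x - h x"] assms by (simp add: L2_diff)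

lemma L2_norm_sum:
  "(\<And>k. k \<in> K \<Longrightarrow> F k \<in> L2) \<Longrightarrow> L2_norm (\<lambda>x. \<Sum>k\<in>K. F k x) \<le> (\<Sum>k\<in>K. L2_norm (F k))"
proof (induction K rule: infinite_finite_induct)
  case (insert k K)
  then show ?case
    using L2_norm_triangle[of "F k" "\<lambda>x. \<Sum>k\<in>K. F k x"] by (fastforce simp: L2_sum)
qed auto

lemma L2_norm_diff_abs:
  assumes "f \<in> L2" "g \<in> L2"
  shows "\<bar>L2_norm f - L2_norm g\<bar> \<le> L2_norm (\<lambda>x. f x - g x)"
  using L2_norm_triangle_diff[of f g "\<lambda>x. 0"] L2_norm_triangle_diff[of g f "\<lambda>x. 0"] assms
    L2_norm_minus_commute[of f g]
  by (simp add: abs_le_iff)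

lemma L2_norm_tendsto:
  assumes "\<And>n. u n \<in> L2" "g \<in> L2" "(\<lambda>n. L2_norm (\<lambda>x. u n x - g x)) \<longlonglongrightarrow> 0"
  shows "(\<lambda>n. L2_norm (u n)) \<longlonglongrightarrow> L2_norm g"
proof -
  have "(\<lambda>n. L2_norm (u n) - L2_norm g) \<longlonglongrightarrow> 0"
    by (rule Lim_null_comparison[OF _ assms(3)])
       (use L2_norm_diff_abs[OF assms(1,2)] in auto)
  then show ?thesis by (simp add: LIM_zero_iff)
qed

lemma L2_dominated_convergence:
  fixes u :: "nat \<Rightarrow> real ^ 'n \<Rightarrow> complex"
  assumes "\<And>n. u n \<in> borel_measurable lebesgue" "integrable lebesgue W"
    and "AE x in lebesgue. (\<lambda>n. u n x) \<longlonglongrightarrow> 0"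
    and "\<And>n. AE x in lebesgue. (cmod (u n x))\<^sup>2 \<le> W x"
  shows "(\<lambda>n. L2_norm (u n)) \<longlonglongrightarrow> 0"
proof -
  have "(\<lambda>n. LINT x|lebesgue. (cmod (u n x))\<^sup>2) \<longlonglongrightarrow> integral\<^sup>L (lebesgue :: (real ^ 'n) measure) (\<lambda>x. 0)"
  proof (rule integral_dominated_convergence[where w=W])
    show "AE x in lebesgue. (\<lambda>n. (cmod (u n x))\<^sup>2) \<longlonglongrightarrow> 0"
      using assms(3) by eventually_elim (metis norm_zero tendsto_norm tendsto_null_power zero_less_numeral)
  qed (use assms in auto)
  from tendsto_real_sqrt[OF this] show ?thesis by (simp add: L2_norm_def)
qed

text \<open>Fatou's lemma for the squares. It supplies membership in \<open>L2\<close> together with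
  the bound, so the limit need not be known to be square integrable beforehand.\<close>

lemma L2_Fatou:
  assumes "\<And>n. u n \<in> L2" "AE x in lebesgue. (\<lambda>n. u n x) \<longlonglongrightarrow> g x" "g \<in> borel_measurable lebesgue"
    and "\<forall>\<^sub>F n in sequentially. L2_norm (u n) \<le> C"
  shows "g \<in> L2" "L2_norm g \<le> C"
proof -
  have [measurable]: "u n \<in> borel_measurable lebesgue" for n using assms(1) by (simp add: L2_def)
  have C: "C \<ge> 0" using eventually_happens'[OF sequentially_bot assms(4)] by (auto intro: order_trans[OF L2_norm_nonneg])
  have "(\<integral>\<^sup>+x. ennreal ((cmod (g x))\<^sup>2) \<partial>lebesgue)
      = (\<integral>\<^sup>+x. liminf (\<lambda>n. ennreal ((cmod (u n x))\<^sup>2)) \<partial>lebesgue)"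
  proof (rule nn_integral_cong_AE)
    show "AE x in lebesgue. ennreal ((cmod (g x))\<^sup>2) = liminf (\<lambda>n. ennreal ((cmod (u n x))\<^sup>2))"
      using assms(2)
    proof eventually_elim
      case (elim x)
      then have "(\<lambda>n. ennreal ((cmod (u n x))\<^sup>2)) \<longlonglongrightarrow> ennreal ((cmod (g x))\<^sup>2)"
        by (intro tendsto_intros)
      then show ?case by (metis lim_imp_Liminf trivial_limit_sequentially)
    qed
  qed
  also have "\<dots> \<le> liminf (\<lambda>n. \<integral>\<^sup>+x. ennreal ((cmod (u n x))\<^sup>2) \<partial>lebesgue)"
    by (rule nn_integral_liminf) measurable
  also have "\<dots> \<le> ennreal (C\<^sup>2)"
  proof (rule Liminf_le)
    show "\<forall>\<^sub>F n in sequentially. (\<integral>\<^sup>+x. ennreal ((cmod (u n x))\<^sup>2) \<partial>lebesgue) \<le> ennreal (C\<^sup>2)"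
      using assms(4)
      by eventually_elim (simp add: L2_norm_sq_nn[OF assms(1), symmetric] ennreal_leI power_mono)
  qed simp
  finally have *: "(\<integral>\<^sup>+x. ennreal ((cmod (g x))\<^sup>2) \<partial>lebesgue) \<le> ennreal (C\<^sup>2)" .
  then show g: "g \<in> L2" unfolding L2_iff_nn using assms(3) by (auto intro: le_less_trans)
  from * have "(L2_norm g)\<^sup>2 \<le> C\<^sup>2" unfolding L2_norm_sq_nn[OF g, symmetric] by simp
  then show "L2_norm g \<le> C" using C by (rule power2_le_imp_le)
qed

lemma Cauchy_real_fast_subseq:
  fixes D :: "nat \<Rightarrow> nat \<Rightarrow> real"
  assumes "\<And>e. e > 0 \<Longrightarrow> \<exists>N. \<forall>m\<ge>N. \<forall>n\<ge>N. D m n < e"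
  obtains r where "strict_mono r" "\<And>k m. m \<ge> r k \<Longrightarrow> D m (r k) < (1/2)^k"
proof -
  have "\<forall>k. \<exists>N. \<forall>m\<ge>N. \<forall>n\<ge>N. D m n < (1/2)^k" using assms by simp
  then obtain N where N: "\<And>k m n. m \<ge> N k \<Longrightarrow> n \<ge> N k \<Longrightarrow> D m n < (1/2)^k" by metis
  \<comment> \<open>The partial sums exceed every single \<open>N k\<close>, and the summand k makes
    r strictly increasing.\<close>
  define r where "r k = (\<Sum>j\<le>k. N j) + k" for k
  have "strict_mono r" by (rule strict_monoI_Suc) (simp add: r_def)
  moreover have "r k \<ge> N k" for k
    unfolding r_def by (simp add: member_le_sum trans_le_add1)
  ultimately show ?thesis using N that by (metis order_trans)
qed

text \<open>Riesz-Fischer: along a fast subsequence the increments are absolutely summable almost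
  everywhere, which produces a pointwise limit; Fatou then transfers the Cauchy estimate of the
  whole sequence to that limit.\<close>

theorem L2_complete:
  fixes u :: "nat \<Rightarrow> real ^ 'n \<Rightarrow> complex"
  assumes u: "\<And>n. u n \<in> L2"
    and cauchy: "\<And>e. e > 0 \<Longrightarrow> \<exists>N. \<forall>m\<ge>N. \<forall>n\<ge>N. L2_norm (\<lambda>x. u m x - u n x) < e"
  obtains g where "g \<in> L2" "(\<lambda>n. L2_norm (\<lambda>x. u n x - g x)) \<longlonglongrightarrow> 0"
proof -
  have [measurable]: "u n \<in> borel_measurable lebesgue" for n using u by (simp add: L2_def)
  obtain r where r: "strict_mono r"
    and rb: "\<And>k m. m \<ge> r k \<Longrightarrow> L2_norm (\<lambda>x. u m x - u (r k) x) < (1/2)^k"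
    using Cauchy_real_fast_subseq[of "\<lambda>m n. L2_norm (\<lambda>x. u m x - u n x)", OF cauchy] by blast
  \<comment> \<open>The absolute increments are embedded into the complex numbers so that the
    \<open>L2_norm\<close> lemmas apply to their partial sums.\<close>
  define d where "d k x = complex_of_real (cmod (u (r (Suc k)) x - u (r k) x))" for k x
  have dmeas[measurable]: "d k \<in> borel_measurable lebesgue" for k unfolding d_def by measurable
  have dL2: "d k \<in> L2" for k
    by (rule L2_dominated(1)[OF dmeas L2_diff[OF u u]]) (auto simp: d_def)
  have dn: "L2_norm (d k) \<le> (1/2)^k" for k
  proof -
    have "L2_norm (d k) = L2_norm (\<lambda>x. u (r (Suc k)) x - u (r k) x)"
      by (simp add: L2_norm_def d_def)
    also have "\<dots> \<le> (1/2)^k" by (rule less_imp_le[OF rb[OF less_imp_le[OF strict_monoD[OF r lessI]]]])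
    finally show ?thesis .
  qed
  have sumd: "L2_norm (\<lambda>x. \<Sum>k<K. d k x) \<le> 2" for K
  proof -
    have "L2_norm (\<lambda>x. \<Sum>k<K. d k x) \<le> (\<Sum>k<K. (1/2)^k)"
      by (rule order_trans[OF L2_norm_sum[OF dL2]]) (intro sum_mono dn)
    also have "(\<Sum>k<K. (1/2)^k) = 2 - 2 * (1/2::real)^K" by (induction K) auto
    also have "\<dots> \<le> 2" by simp
    finally show ?thesis .
  qed
  have "(\<integral>\<^sup>+x. (SUP K. ennreal ((cmod (\<Sum>k<K. d k x))\<^sup>2)) \<partial>lebesgue)
      = (SUP K. \<integral>\<^sup>+x. ennreal ((cmod (\<Sum>k<K. d k x))\<^sup>2) \<partial>lebesgue)"
  proof (rule nn_integral_monotone_convergence_SUP)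
    show "incseq (\<lambda>K x. ennreal ((cmod (\<Sum>k<K. d k x))\<^sup>2))"
      unfolding d_def of_real_sum[symmetric] norm_of_real
      by (intro incseq_SucI le_funI ennreal_leI power_mono) (auto simp: sum_nonneg)
  qed measurable
  also have "\<dots> \<le> ennreal 4"
  proof (rule SUP_least)
    fix K
    have "(\<lambda>x. \<Sum>k<K. d k x) \<in> L2" by (intro L2_sum dL2)
    then have "(\<integral>\<^sup>+x. ennreal ((cmod (\<Sum>k<K. d k x))\<^sup>2) \<partial>lebesgue) = ennreal ((L2_norm (\<lambda>x. \<Sum>k<K. d k x))\<^sup>2)"
      by (rule L2_norm_sq_nn[symmetric])
    also have "\<dots> \<le> ennreal (2\<^sup>2)" by (intro ennreal_leI power_mono sumd) auto
    finally show "(\<integral>\<^sup>+x. ennreal ((cmod (\<Sum>k<K. d k x))\<^sup>2) \<partial>lebesgue) \<le> ennreal 4" by simp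
  qed
  finally have "(\<integral>\<^sup>+x. (SUP K. ennreal ((cmod (\<Sum>k<K. d k x))\<^sup>2)) \<partial>lebesgue) \<noteq> \<infinity>"
    by (auto simp: top_unique)
  \<comment> \<open>A finite integral forces the supremum to be finite almost everywhere, which
    bounds the partial sums of the absolute increments.\<close>
  then have "AE x in lebesgue. (SUP K. ennreal ((cmod (\<Sum>k<K. d k x))\<^sup>2)) \<noteq> \<infinity>"
    by (intro nn_integral_PInf_AE) measurable
  then have "AE x in lebesgue. convergent (\<lambda>k. u (r k) x)"
  proof eventually_elim
    case (elim x)
    then obtain c where c: "c \<ge> 0" "(SUP K. ennreal ((cmod (\<Sum>k<K. d k x))\<^sup>2)) = ennreal c"
      by (metis ennreal_cases infinity_ennreal_def)
    have b1: "(cmod (\<Sum>k<K. d k x))\<^sup>2 \<le> c" for K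
      using SUP_upper[of K UNIV "\<lambda>K. ennreal ((cmod (\<Sum>k<K. d k x))\<^sup>2)"] c by simp
    have b2: "cmod (\<Sum>k<K. d k x) = (\<Sum>k<K. cmod (u (r (Suc k)) x - u (r k) x))" for K
      unfolding d_def of_real_sum[symmetric] norm_of_real by (auto simp: sum_nonneg)
    have "(\<Sum>k<K. cmod (u (r (Suc k)) x - u (r k) x)) \<le> sqrt c" for K
      using b1[of K] unfolding b2 by (rule real_le_rsqrt)
    then have "summable (\<lambda>k. u (r (Suc k)) x - u (r k) x)"
      by (rule summable_norm_cancel[OF summableI_nonneg_bounded, rotated]) auto
    then have "convergent (\<lambda>K. \<Sum>k<K. u (r (Suc k)) x - u (r k) x)"
      by (simp add: summable_iff_convergent)
    then have "convergent (\<lambda>K. u (r K) x - u (r 0) x)"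
      using sum_lessThan_telescope[of "\<lambda>k. u (r k) x"] by simp
    then show ?case
      using convergent_add[OF _ convergent_const[of "u (r 0) x"]] by fastforce
  qed
  then have lim: "AE x in lebesgue. (\<lambda>k. u (r k) x) \<longlonglongrightarrow> lim (\<lambda>k. u (r k) x)"
    by eventually_elim (simp add: convergent_LIMSEQ_iff)
  \<comment> \<open>\<open>lim\<close> is total and measurable, so its arbitrary values on the null
    set of divergence do no harm.\<close>
  define g where "g x = lim (\<lambda>k. u (r k) x)" for x
  have gm[measurable]: "g \<in> borel_measurable lebesgue" unfolding g_def by measurable
  \<comment> \<open>Here m stays fixed while the other index runs along the subsequence; Fatou
    applies to the differences \<open>u m x - u (r k) x\<close>.\<close>
  have close: "(\<lambda>x. u m x - g x) \<in> L2 \<and> L2_norm (\<lambda>x. u m x - g x) \<le> e"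
    if "e > 0" "\<And>n. n \<ge> N \<Longrightarrow> L2_norm (\<lambda>x. u m x - u n x) < e" for m e N
  proof -
    have ev: "\<forall>\<^sub>F k in sequentially. L2_norm (\<lambda>x. u m x - u (r k) x) \<le> e"
      using eventually_ge_at_top[of N]
      by eventually_elim (use that(2) seq_suble[OF r] in \<open>meson less_imp_le order_trans\<close>)
    have ae: "AE x in lebesgue. (\<lambda>k. u m x - u (r k) x) \<longlonglongrightarrow> u m x - g x"
      using lim unfolding g_def by eventually_elim (intro tendsto_intros)
    show ?thesis
      using L2_Fatou[OF L2_diff[OF u u] ae _ ev] by simp
  qed
  obtain N1 where "\<And>m n. m \<ge> N1 \<Longrightarrow> n \<ge> N1 \<Longrightarrow> L2_norm (\<lambda>x. u m x - u n x) < 1"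
    using cauchy[of 1] by auto
  \<comment> \<open>Membership of g follows by writing it as \<open>u N1\<close> minus this
    difference.\<close>
  then have "(\<lambda>x. u N1 x - g x) \<in> L2" using close[of 1 N1 N1] by simp
  then have gL2: "g \<in> L2" using L2_diff[OF u[of N1], of "\<lambda>x. u N1 x - g x"] by simp
  have "(\<lambda>n. L2_norm (\<lambda>x. u n x - g x)) \<longlonglongrightarrow> 0"
  proof (rule LIMSEQ_I)
    fix e :: real assume e: "e > 0"
    obtain N where N: "\<And>m n. m \<ge> N \<Longrightarrow> n \<ge> N \<Longrightarrow> L2_norm (\<lambda>x. u m x - u n x) < e/2"
      using cauchy[of "e/2"] e by auto
    have "L2_norm (\<lambda>x. u m x - g x) \<le> e/2" if "m \<ge> N" for m
      using close[of "e/2" N m] N that e by auto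
    then show "\<exists>N. \<forall>n\<ge>N. norm (L2_norm (\<lambda>x. u n x - g x) - 0) < e"
      using e by (intro exI[of _ N]) fastforce
  qed
  with gL2 show ?thesis by (rule that)
qed

section \<open>Dilations and translations\<close>

text \<open>The change of variables for diagonal affine maps, with all diagonal entries equal to
  c.\<close>

lemma lebesgue_affine:
  fixes t :: "'a::euclidean_space"
  assumes "c \<noteq> 0"
  shows "lebesgue = density (distr lebesgue lebesgue (\<lambda>x. t + c *\<^sub>R x)) (\<lambda>_. ennreal (\<bar>c\<bar>^DIM('a)))"
    and lebesgue_affine_meas: "(\<lambda>x. t + c *\<^sub>R x) \<in> lebesgue \<rightarrow>\<^sub>M lebesgue"
  using lebesgue_affine_euclidean[where c="\<lambda>_::'a. c" and t=t]
    lebesgue_affine_measurable[where c="\<lambda>_::'a. c" and t=t] assms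
  unfolding scaleR_scaleR[symmetric] scaleR_sum_right[symmetric] euclidean_representation prod_constant
  by auto

lemma measurable_lebesgue_affine:
  fixes t :: "'a::euclidean_space"
  assumes "c \<noteq> 0" "f \<in> borel_measurable lebesgue"
  shows "(\<lambda>x. f (t + c *\<^sub>R x)) \<in> borel_measurable lebesgue"
  using measurable_compose[OF lebesgue_affine_meas[OF assms(1)] assms(2)] .

lemma nn_integral_lebesgue_affine:
  fixes t :: "'a::euclidean_space"
  assumes c: "c \<noteq> 0" and [measurable]: "f \<in> borel_measurable lebesgue"
  shows "(\<integral>\<^sup>+x. f x \<partial>lebesgue) = ennreal (\<bar>c\<bar>^DIM('a)) * (\<integral>\<^sup>+x. f (t + c *\<^sub>R x) \<partial>lebesgue)"
proof -
  note m[measurable] = lebesgue_affine_meas[OF c, of t]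
  have "(\<integral>\<^sup>+x. f x \<partial>lebesgue)
      = (\<integral>\<^sup>+x. f x \<partial>density (distr lebesgue lebesgue (\<lambda>x. t + c *\<^sub>R x)) (\<lambda>_. ennreal (\<bar>c\<bar>^DIM('a))))"
    using lebesgue_affine[OF c, of t] by simp
  also have "\<dots> = ennreal (\<bar>c\<bar>^DIM('a)) * (\<integral>\<^sup>+x. f x \<partial>distr lebesgue lebesgue (\<lambda>x. t + c *\<^sub>R x))"
    by (subst nn_integral_density) (auto simp: nn_integral_cmult)
  also have "(\<integral>\<^sup>+x. f x \<partial>distr lebesgue lebesgue (\<lambda>x. t + c *\<^sub>R x))
      = (\<integral>\<^sup>+x. f (t + c *\<^sub>R x) \<partial>lebesgue)"
    by (rule nn_integral_distr) auto
  finally show ?thesis .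
qed

lemma
  fixes t :: "'a::euclidean_space" and f :: "'a \<Rightarrow> 'b::{banach, second_countable_topology}"
  assumes c: "c \<noteq> 0" and f[measurable]: "f \<in> borel_measurable lebesgue"
  shows integrable_lebesgue_affine_iff:
      "integrable lebesgue (\<lambda>x. f (t + c *\<^sub>R x)) \<longleftrightarrow> integrable lebesgue f" (is ?I)
    and integral_lebesgue_affine:
      "(LINT x|lebesgue. f x) = \<bar>c\<bar>^DIM('a) *\<^sub>R (LINT x|lebesgue. f (t + c *\<^sub>R x))"
proof -
  note m[measurable] = lebesgue_affine_meas[OF c, of t] 
  note l = lebesgue_affine[OF c, of t]
  have "integrable lebesgue f
      \<longleftrightarrow> integrable (density (distr lebesgue lebesgue (\<lambda>x. t + c *\<^sub>R x)) (\<lambda>_. ennreal (\<bar>c\<bar>^DIM('a)))) f"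
    using l by simp
  also have "\<dots> \<longleftrightarrow> integrable (distr lebesgue lebesgue (\<lambda>x. t + c *\<^sub>R x)) (\<lambda>x. \<bar>c\<bar>^DIM('a) *\<^sub>R f x)"
    by (rule integrable_density) auto
  also have "\<dots> \<longleftrightarrow> integrable (distr lebesgue lebesgue (\<lambda>x. t + c *\<^sub>R x)) f"
    using c integrable_scaleR_right[of "1 / \<bar>c\<bar>^DIM('a)" _ "\<lambda>x. \<bar>c\<bar>^DIM('a) *\<^sub>R f x"]
    by (auto intro: integrable_scaleR_right)
  also have "\<dots> \<longleftrightarrow> integrable lebesgue (\<lambda>x. f (t + c *\<^sub>R x))"
    by (rule integrable_distr_eq) auto
  finally show ?I by simp
  have "(LINT x|lebesgue. f x)
      = (LINT x|density (distr lebesgue lebesgue (\<lambda>x. t + c *\<^sub>R x)) (\<lambda>_. ennreal (\<bar>c\<bar>^DIM('a))). f x)"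
    using l by simp
  also have "\<dots> = (LINT x|distr lebesgue lebesgue (\<lambda>x. t + c *\<^sub>R x). \<bar>c\<bar>^DIM('a) *\<^sub>R f x)"
    by (rule integral_density) auto
  also have "\<dots> = \<bar>c\<bar>^DIM('a) *\<^sub>R (LINT x|distr lebesgue lebesgue (\<lambda>x. t + c *\<^sub>R x). f x)"
    by simp
  also have "(LINT x|distr lebesgue lebesgue (\<lambda>x. t + c *\<^sub>R x). f x)
      = (LINT x|lebesgue. f (t + c *\<^sub>R x))"
    by (rule integral_distr) auto
  finally show "(LINT x|lebesgue. f x) = \<bar>c\<bar>^DIM('a) *\<^sub>R (LINT x|lebesgue. f (t + c *\<^sub>R x))" .
qed

lemma
  fixes f :: "real ^ 'n \<Rightarrow> complex"
  assumes c: "c \<noteq> 0" and f: "f \<in> L2"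
  shows L2_affine: "(\<lambda>x. f (t + c *\<^sub>R x)) \<in> L2"
    and L2_norm_affine: "L2_norm (\<lambda>x. f (t + c *\<^sub>R x)) = \<bar>c\<bar> powr (- real CARD('n) / 2) * L2_norm f"
proof -
  have m: "f \<in> borel_measurable lebesgue" using f by (simp add: L2_def)
  have m2: "(\<lambda>x. (cmod (f x))\<^sup>2) \<in> borel_measurable lebesgue" using m by measurable
  show "(\<lambda>x. f (t + c *\<^sub>R x)) \<in> L2"
    using f integrable_lebesgue_affine_iff[OF c m2, of t] measurable_lebesgue_affine[OF c m]
    by (simp add: L2_def)
  have "(L2_norm f)\<^sup>2 = \<bar>c\<bar>^CARD('n) * (L2_norm (\<lambda>x. f (t + c *\<^sub>R x)))\<^sup>2"
    unfolding L2_norm_sq using integral_lebesgue_affine[OF c m2, of t] by simp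
  also have "\<bar>c\<bar>^CARD('n) = (\<bar>c\<bar> powr (real CARD('n) / 2))\<^sup>2"
    using c by (simp add: powr_realpow[symmetric] powr_powr powr_numeral[symmetric] del: powr_numeral)
  finally have "L2_norm f = \<bar>c\<bar> powr (real CARD('n) / 2) * L2_norm (\<lambda>x. f (t + c *\<^sub>R x))"
    by (simp add: power_mult_distrib[symmetric])
  then show "L2_norm (\<lambda>x. f (t + c *\<^sub>R x)) = \<bar>c\<bar> powr (- real CARD('n) / 2) * L2_norm f"
    using c by (simp add: powr_minus field_simps)
qed

text \<open>For N > 0 this is the radial retraction onto the disc of radius N. Unlike setting large
  values to 0, it is continuous, so it preserves continuity and pointwise limits.\<close>

definition clamp_norm :: "real \<Rightarrow> complex \<Rightarrow> complex" where
  "clamp_norm N z = complex_of_real (N / max N (cmod z)) * z"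

lemma clamp_norm_le: "N > 0 \<Longrightarrow> cmod (clamp_norm N z) \<le> N"
  by (auto simp: clamp_norm_def norm_mult norm_divide max_def)

lemma clamp_norm_id: "N > 0 \<Longrightarrow> cmod z \<le> N \<Longrightarrow> clamp_norm N z = z"
  by (auto simp: clamp_norm_def max_def)

lemma continuous_on_clamp_norm [continuous_intros]:
  "N > 0 \<Longrightarrow> continuous_on S f \<Longrightarrow> continuous_on S (\<lambda>x. clamp_norm N (f x))"
  unfolding clamp_norm_def by (intro continuous_intros) (auto simp: max_def)

lemma tendsto_clamp_norm:
  "N > 0 \<Longrightarrow> (f \<longlongrightarrow> l) F \<Longrightarrow> ((\<lambda>x. clamp_norm N (f x)) \<longlongrightarrow> clamp_norm N l) F"
  unfolding clamp_norm_def by (intro tendsto_intros) (auto simp: max_def)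

section \<open>Density of compactly supported continuous functions\<close>

lemma lebesgue_measurable_continuous_approx:
  fixes f :: "real ^ 'n \<Rightarrow> complex"
  assumes "f \<in> borel_measurable lebesgue"
  obtains g where "\<And>n. continuous_on UNIV (g n)" "AE x in lebesgue. (\<lambda>n. g n x) \<longlonglongrightarrow> f x"
proof -
  \<comment> \<open>\<open>measurable_on\<close> means precisely: limit of continuous functions off
    a negligible set.\<close>
  obtain N g where N: "negligible N" and g: "\<And>n. continuous_on UNIV (g n)"
    and l: "\<And>x. x \<notin> N \<Longrightarrow> (\<lambda>n. g n x) \<longlonglongrightarrow> f x"
    using lebesgue_measurable_imp_measurable_on[OF assms, of UNIV] unfolding measurable_on_def by auto
  have "N \<in> null_sets lebesgue" using N by (simp add: negligible_iff_null_sets)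
  then have "AE x in lebesgue. (\<lambda>n. g n x) \<longlonglongrightarrow> f x"
    by (rule AE_I') (use l in blast)
  with g show ?thesis by (rule that)
qed

lemma continuous_lebesgue_measurable:
  "continuous_on UNIV g \<Longrightarrow> g \<in> borel_measurable lebesgue"
  by (simp add: borel_measurable_continuous_onI measurable_completion)

text \<open>The dense class on which Plancherel is proved first. Its members are Borel measurable,
  so Fubini's theorem on products of \<open>lborel\<close> is available without passing to
  completions.\<close>

definition Cc :: "(real ^ 'n \<Rightarrow> complex) set" where
  "Cc = {g. continuous_on UNIV g \<and> (\<exists>R. \<forall>x. norm x > R \<longrightarrow> g x = 0)}"

lemma integrable_indicator_cball [simp]:
  "integrable lebesgue (indicator (cball (a::'a::euclidean_space) R) :: 'a \<Rightarrow> real)"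
  using emeasure_bounded_finite[of "cball a R"] by (simp add: integrable_indicator_iff)

lemma Cc_borel: "g \<in> Cc \<Longrightarrow> g \<in> borel_measurable borel"
  by (auto simp: Cc_def borel_measurable_continuous_onI)

lemma Cc_bounded:
  fixes g :: "real ^ 'n \<Rightarrow> complex"
  assumes "g \<in> Cc"
  obtains B R where "B \<ge> 0" "\<And>x. cmod (g x) \<le> B" "\<And>x. norm x > R \<Longrightarrow> g x = 0"
proof -
  obtain R where c: "continuous_on UNIV g" and R: "\<And>x. norm x > R \<Longrightarrow> g x = 0"
    using assms by (auto simp: Cc_def)
  have "bounded (g ` cball 0 R)"
    by (intro compact_imp_bounded compact_continuous_image continuous_on_subset[OF c]) auto
  then obtain B where B: "\<And>x. x \<in> cball 0 R \<Longrightarrow> cmod (g x) \<le> B"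
    unfolding bounded_iff by blast
  have "cmod (g x) \<le> max B 0" for x
    using B[of x] R[of x] by (cases "norm x \<le> R") auto
  then show ?thesis using R that[of "max B 0" R] by simp
qed

lemma
  fixes g :: "real ^ 'n \<Rightarrow> complex"
  assumes g: "g \<in> Cc"
  shows Cc_integrable: "integrable lborel g" and Cc_L2: "g \<in> L2"
proof -
  obtain B R where B: "B \<ge> 0" "\<And>x. cmod (g x) \<le> B" and R: "\<And>x. norm x > R \<Longrightarrow> g x = 0"
    using Cc_bounded[OF g] by blast
  have m: "g \<in> borel_measurable lebesgue"
    using Cc_borel[OF g] by (simp add: measurable_completion)
  have le: "cmod (g x) \<le> B * indicator (cball 0 R) x" for x
    using B R[of x] by (cases "x \<in> cball 0 R") auto
  have "integrable lebesgue g"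
    by (rule Bochner_Integration.integrable_bound[where f="\<lambda>x. B * indicator (cball 0 R) x"])
       (use m order_trans[OF le abs_ge_self] in auto)
  then show "integrable lborel g" using Cc_borel[OF g] by (simp add: integrable_completion)
  have "(cmod (g x))\<^sup>2 \<le> B\<^sup>2 * indicator (cball 0 R) x" for x
    using B R[of x] by (cases "x \<in> cball 0 R") (auto simp: power_mono)
  then show "g \<in> L2"
    by (intro L2_bounded(1)[where W="\<lambda>x. B\<^sup>2 * indicator (cball 0 R) x"] m) auto
qed

text \<open>One sequence must serve both norms: L^1 convergence gives pointwise convergence of the
  Fourier integrals, L^2 convergence gives convergence of the norms. A bounded, boundedly supported
  cut \<open>h N\<close> of f is approximated first in both norms, with error below 1/(N+1).\<close>

lemma Cc_dense:
  fixes f :: "real ^ 'n \<Rightarrow> complex"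
  assumes f: "f \<in> L2"
  obtains g where "\<And>n. g n \<in> Cc" "(\<lambda>n. L2_norm (\<lambda>x. g n x - f x)) \<longlonglongrightarrow> 0"
    "integrable lebesgue f \<Longrightarrow> (\<lambda>n. LINT x|lebesgue. cmod (g n x - f x)) \<longlonglongrightarrow> 0"
proof -
  have fm[measurable]: "f \<in> borel_measurable lebesgue" using f by (simp add: L2_def)
  define h where "h N x = (if norm x \<le> real N \<and> cmod (f x) \<le> real N then f x else 0)" for N :: nat and x
  have [measurable]: "(\<lambda>x. x :: real ^ 'n) \<in> borel_measurable lebesgue"
    by (rule measurable_completion) simp
  have hm[measurable]: "h N \<in> borel_measurable lebesgue" for N
    unfolding h_def[abs_def] by measurable
  have hle: "cmod (h N x) \<le> cmod (f x)" for N x by (simp add: h_def)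
  have hlim: "(\<lambda>N. h N x - f x) \<longlonglongrightarrow> 0" for x
  proof (rule tendsto_eventually)
    obtain N0 :: nat where "norm x + cmod (f x) \<le> real N0" using real_arch_simple by blast
    then have "norm x \<le> real N \<and> cmod (f x) \<le> real N" if "N \<ge> N0" for N
      using that by (smt (verit) norm_ge_zero of_nat_mono)
    then show "\<forall>\<^sub>F N in sequentially. h N x - f x = 0"
      unfolding eventually_sequentially h_def by force
  qed
  have le2: "cmod (h N x - f x) \<le> 2 * cmod (f x)" for N x
    using norm_triangle_ineq4[of "h N x" "f x"] hle[of N x] by simp
  have h2: "(\<lambda>N. L2_norm (\<lambda>x. h N x - f x)) \<longlonglongrightarrow> 0"
  proof (rule L2_dominated_convergence[where W="\<lambda>x. 4 * (cmod (f x))\<^sup>2"])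
    show "AE x in lebesgue. (cmod (h N x - f x))\<^sup>2 \<le> 4 * (cmod (f x))\<^sup>2" for N
      using power_mono[OF le2, of _ _ 2] by (simp add: power_mult_distrib)
  qed (use f hlim in \<open>auto simp: L2_def\<close>)
  have h1: "(\<lambda>N. LINT x|lebesgue. cmod (h N x - f x)) \<longlonglongrightarrow> 0" if "integrable lebesgue f"
  proof -
    have "(\<lambda>N. LINT x|lebesgue. cmod (h N x - f x)) \<longlonglongrightarrow> (LINT x|(lebesgue::(real^'n) measure). 0)"
    proof (rule integral_dominated_convergence[where w="\<lambda>x. 2 * cmod (f x)"])
      show "AE x in lebesgue. (\<lambda>N. cmod (h N x - f x)) \<longlonglongrightarrow> 0"
        using hlim by (simp add: tendsto_norm_zero)
      show "AE x in lebesgue. norm (cmod (h N x - f x)) \<le> 2 * cmod (f x)" for N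
        using le2 by simp
    qed (use that in auto)
    then show ?thesis by simp
  qed
  have ex: "\<exists>g. g \<in> Cc \<and> L2_norm (\<lambda>x. g x - h N x) < 1 / Suc N
      \<and> integrable lebesgue (\<lambda>x. g x - h N x) \<and> (LINT x|lebesgue. cmod (g x - h N x)) < 1 / Suc N" for N
  proof -
    obtain \<gamma> where gc: "\<And>n. continuous_on UNIV (\<gamma> n)" and gl: "AE x in lebesgue. (\<lambda>n. \<gamma> n x) \<longlonglongrightarrow> h N x"
      using lebesgue_measurable_continuous_approx[OF hm] by metis
    \<comment> \<open>The extra unit leaves room for a continuous cutoff that is 1 on the ball of
      radius N, where \<open>h N\<close> lives, and 0 outside radius N + 1.\<close>
    define M :: real where "M = real N + 1"
    have M: "M > 0" by (simp add: M_def)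
    \<comment> \<open>Clamping at M gives a uniform majorant and does not change the limit, since
      the values of \<open>h N\<close> are bounded by N.\<close>
    define g where "g n x = complex_of_real (max 0 (min 1 (M - norm x))) * clamp_norm M (\<gamma> n x)" for n x
    have gcont: "continuous_on UNIV (g n)" for n
      unfolding g_def by (intro continuous_intros M gc)
    then have gm[measurable]: "g n \<in> borel_measurable lebesgue" for n
      by (rule continuous_lebesgue_measurable)
    have gCc: "g n \<in> Cc" for n
      unfolding Cc_def using gcont by (auto simp: g_def intro!: exI[of _ M])
    have bd: "cmod (g n x - h N x) \<le> 2 * M * indicator (cball 0 M) x" for n x
    proof (cases "norm x \<le> M")
      case True
      have "cmod (g n x) \<le> 1 * M" unfolding g_def norm_mult
        by (intro mult_mono clamp_norm_le M) auto
      moreover have "cmod (h N x) \<le> M" by (auto simp: h_def M_def)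
      ultimately show ?thesis using norm_triangle_ineq4[of "g n x" "h N x"] True by simp
    next
      case False
      then have "g n x = 0" "h N x = 0" by (auto simp: g_def h_def M_def)
      then show ?thesis using M by simp
    qed
    have lim: "AE x in lebesgue. (\<lambda>n. g n x - h N x) \<longlonglongrightarrow> 0"
      using gl
    proof eventually_elim
      case (elim x)
      have "(\<lambda>n. g n x) \<longlonglongrightarrow> complex_of_real (max 0 (min 1 (M - norm x))) * clamp_norm M (h N x)"
        unfolding g_def by (intro tendsto_intros tendsto_clamp_norm M elim)
      also have "complex_of_real (max 0 (min 1 (M - norm x))) * clamp_norm M (h N x) = h N x"
      proof -
        have "clamp_norm M (h N x) = h N x"
          by (rule clamp_norm_id[OF M]) (auto simp: h_def M_def)
        then show ?thesis by (auto simp: h_def M_def)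
      qed
      finally show ?case by (simp add: LIM_zero)
    qed
    have "(\<lambda>n. L2_norm (\<lambda>x. g n x - h N x)) \<longlonglongrightarrow> 0"
    proof (rule L2_dominated_convergence[where W="\<lambda>x. (2*M)\<^sup>2 * indicator (cball 0 M) x", OF _ _ lim])
      show "AE x in lebesgue. (cmod (g n x - h N x))\<^sup>2 \<le> (2*M)\<^sup>2 * indicator (cball 0 M) x" for n
      proof (rule AE_I2)
        fix x
        have "(cmod (g n x - h N x))\<^sup>2 \<le> (2 * M * indicator (cball 0 M) x)\<^sup>2"
          by (intro power_mono bd) simp
        also have "\<dots> = (2*M)\<^sup>2 * indicator (cball 0 M) x"
          by (cases "x \<in> cball 0 M") auto
        finally show "(cmod (g n x - h N x))\<^sup>2 \<le> (2*M)\<^sup>2 * indicator (cball 0 M) x" .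
      qed
    qed auto
    then have "\<forall>\<^sub>F n in sequentially. L2_norm (\<lambda>x. g n x - h N x) < 1 / Suc N"
      by (rule order_tendstoD) simp
    moreover have "(\<lambda>n. LINT x|lebesgue. cmod (g n x - h N x)) \<longlonglongrightarrow> (LINT x|(lebesgue::(real^'n) measure). 0)"
    proof (rule integral_dominated_convergence[where w="\<lambda>x. 2 * M * indicator (cball 0 M) x"])
      show "AE x in lebesgue. (\<lambda>n. cmod (g n x - h N x)) \<longlonglongrightarrow> 0"
        using lim by eventually_elim (simp add: tendsto_norm_zero)
    qed (use bd in auto)
    then have "(\<lambda>n. LINT x|lebesgue. cmod (g n x - h N x)) \<longlonglongrightarrow> 0" by simp
    then have "\<forall>\<^sub>F n in sequentially. (LINT x|lebesgue. cmod (g n x - h N x)) < 1 / Suc N"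
      by (rule order_tendstoD) simp
    ultimately have "\<forall>\<^sub>F n in sequentially. L2_norm (\<lambda>x. g n x - h N x) < 1 / Suc N
       \<and> (LINT x|lebesgue. cmod (g n x - h N x)) < 1 / Suc N"
      by eventually_elim simp
    then obtain n where n: "L2_norm (\<lambda>x. g n x - h N x) < 1 / Suc N"
      "(LINT x|lebesgue. cmod (g n x - h N x)) < 1 / Suc N"
      using eventually_happens'[OF sequentially_bot] by blast
    moreover have "integrable lebesgue (\<lambda>x. g n x - h N x)"
      by (rule Bochner_Integration.integrable_bound[where f="\<lambda>x. 2 * M * indicator (cball 0 M) x"])
         (use order_trans[OF bd abs_ge_self] in auto)
    ultimately show ?thesis using gCc by blast
  qed
  from choice[OF allI[OF ex]] obtain g where
    g: "\<forall>N. g N \<in> Cc \<and> L2_norm (\<lambda>x. g N x - h N x) < 1 / Suc N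
      \<and> integrable lebesgue (\<lambda>x. g N x - h N x) \<and> (LINT x|lebesgue. cmod (g N x - h N x)) < 1 / Suc N" ..
  have gCc: "g N \<in> Cc" and g2: "L2_norm (\<lambda>x. g N x - h N x) < 1 / Suc N"
    and gi: "integrable lebesgue (\<lambda>x. g N x - h N x)"
    and g1: "(LINT x|lebesgue. cmod (g N x - h N x)) < 1 / Suc N" for N
    using g by blast+
  have gm[measurable]: "g N \<in> borel_measurable lebesgue" for N
    using gCc by (intro continuous_lebesgue_measurable) (auto simp: Cc_def)
  have hL2: "h N \<in> L2" for N by (rule L2_dominated(1)[OF hm f]) (simp add: hle)
  have gL2: "g N \<in> L2" for N by (rule Cc_L2[OF gCc])
  have z: "(\<lambda>N. 1 / real (Suc N)) \<longlonglongrightarrow> 0" by (rule LIMSEQ_Suc[OF lim_1_over_n])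
  have "(\<lambda>N. L2_norm (\<lambda>x. g N x - f x)) \<longlonglongrightarrow> 0"
  proof (rule tendsto_sandwich[OF _ _ tendsto_const])
    show "\<forall>\<^sub>F N in sequentially. L2_norm (\<lambda>x. g N x - f x) \<le> 1 / Suc N + L2_norm (\<lambda>x. h N x - f x)"
    proof (intro always_eventually allI)
      fix N
      show "L2_norm (\<lambda>x. g N x - f x) \<le> 1 / Suc N + L2_norm (\<lambda>x. h N x - f x)"
        using L2_norm_triangle_diff[OF gL2[of N] hL2[of N] f] g2[of N] by linarith
    qed
    show "(\<lambda>N. 1 / Suc N + L2_norm (\<lambda>x. h N x - f x)) \<longlonglongrightarrow> 0"
      using tendsto_add[OF z h2] by simp
  qed simp
  moreover have "(\<lambda>N. LINT x|lebesgue. cmod (g N x - f x)) \<longlonglongrightarrow> 0" if fi: "integrable lebesgue f"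
  proof (rule tendsto_sandwich[OF _ _ tendsto_const])
    have hi: "integrable lebesgue (h N)" for N
      by (rule Bochner_Integration.integrable_bound[OF fi]) (auto simp: hle)
    have "(LINT x|lebesgue. cmod (g N x - f x)) \<le> 1 / Suc N + (LINT x|lebesgue. cmod (h N x - f x))" for N
    proof -
      have "(LINT x|lebesgue. cmod (g N x - f x))
          \<le> (LINT x|lebesgue. cmod (g N x - h N x) + cmod (h N x - f x))"
      proof (rule integral_mono)
        have "integrable lebesgue (\<lambda>x. (g N x - h N x) + (h N x - f x))" 
          by (intro Bochner_Integration.integrable_add Bochner_Integration.integrable_diff gi hi fi)
        then show "integrable lebesgue (\<lambda>x. cmod (g N x - f x))" by simp
        show "integrable lebesgue (\<lambda>x. cmod (g N x - h N x) + cmod (h N x - f x))"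
          by (intro Bochner_Integration.integrable_add integrable_norm Bochner_Integration.integrable_diff gi hi fi)
        show "cmod (g N x - f x) \<le> cmod (g N x - h N x) + cmod (h N x - f x)" for x
          using norm_triangle_ineq[of "g N x - h N x" "h N x - f x"] by simp
      qed
      also have "\<dots> = (LINT x|lebesgue. cmod (g N x - h N x)) + (LINT x|lebesgue. cmod (h N x - f x))"
        by (intro Bochner_Integration.integral_add integrable_norm Bochner_Integration.integrable_diff gi hi fi)
      finally show ?thesis using g1[of N] by simp
    qed
    then show "\<forall>\<^sub>F N in sequentially. (LINT x|lebesgue. cmod (g N x - f x))
        \<le> 1 / Suc N + (LINT x|lebesgue. cmod (h N x - f x))" by simp
    show "(\<lambda>N. 1 / Suc N + (LINT x|lebesgue. cmod (h N x - f x))) \<longlonglongrightarrow> 0"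
      using tendsto_add[OF z h1[OF fi]] by simp
  qed simp
  ultimately show ?thesis by (rule that[OF gCc])
qed

section \<open>Gaussian integrals\<close>

lemma integral_lborel_affine:
  fixes t :: "'a::euclidean_space" and f :: "'a \<Rightarrow> 'b::{banach, second_countable_topology}"
  assumes "c \<noteq> 0" and [measurable]: "f \<in> borel_measurable borel"
  shows "(LINT x|lborel. f x) = \<bar>c\<bar>^DIM('a) *\<^sub>R (LINT x|lborel. f (t + c *\<^sub>R x))"
  using integral_lebesgue_affine[OF assms(1) measurable_completion, of f t]
  by (simp add: integral_completion)

lemma integrable_lborel_affine:
  fixes t :: "'a::euclidean_space" and f :: "'a \<Rightarrow> 'b::{banach, second_countable_topology}"
  assumes "c \<noteq> 0" and "integrable lborel f"
  shows "integrable lborel (\<lambda>x. f (t + c *\<^sub>R x))"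
proof -
  have [measurable]: "f \<in> borel_measurable borel" using assms(2) by auto
  show ?thesis
    using integrable_lebesgue_affine_iff[OF assms(1) measurable_completion, of f t] assms(2)
    by (simp add: integrable_completion)
qed

text \<open>\<open>lborel\<close> is the image of the product measure under assembling a vector from
  its coordinates, so Fubini for product functions carries over.\<close>

lemma
  fixes f :: "'a::euclidean_space \<Rightarrow> real \<Rightarrow> complex"
  assumes f: "\<And>b. b \<in> Basis \<Longrightarrow> integrable lborel (f b)"
  shows integral_lborel_prod_Basis:
      "(LINT x|lborel. (\<Prod>b\<in>Basis. f b (x \<bullet> b))) = (\<Prod>b\<in>Basis. (LINT t|lborel. f b t))"
    and integrable_lborel_prod_Basis: "integrable lborel (\<lambda>x. \<Prod>b\<in>Basis. f b (x \<bullet> b))"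
proof -
  interpret product_sigma_finite "\<lambda>_::'a. lborel :: real measure" by standard
  have [measurable]: "f b \<in> borel_measurable borel" if "b \<in> Basis" for b
    using f[OF that] by auto
  let ?P = "\<Pi>\<^sub>M b\<in>(Basis::'a set). lborel :: real measure"
  let ?T = "\<lambda>w. \<Sum>b\<in>Basis. w b *\<^sub>R b :: 'a"
  have T[measurable]: "?T \<in> ?P \<rightarrow>\<^sub>M borel" by measurable
  have m[measurable]: "(\<lambda>x::'a. \<Prod>b\<in>Basis. f b (x \<bullet> b)) \<in> borel_measurable borel"
    by measurable
  have e: "(\<Prod>b\<in>Basis. f b (?T w \<bullet> b)) = (\<Prod>b\<in>Basis. f b (w b))" for w :: "'a \<Rightarrow> real"
    by (intro prod.cong refl) simp
  have "(LINT x|lborel. (\<Prod>b\<in>Basis. f b (x \<bullet> b))) = (LINT x|distr ?P borel ?T. (\<Prod>b\<in>Basis. f b (x \<bullet> b)))"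
    using lborel_eq[where 'a='a] by simp
  also have "\<dots> = (LINT w|?P. (\<Prod>b\<in>Basis. f b (?T w \<bullet> b)))"
    by (rule integral_distr[OF T m])
  also have "\<dots> = (\<Prod>b\<in>Basis. (LINT t|lborel. f b t))"
    unfolding e by (rule product_integral_prod) (use f in auto)
  finally show "(LINT x|lborel. (\<Prod>b\<in>Basis. f b (x \<bullet> b))) = (\<Prod>b\<in>Basis. (LINT t|lborel. f b t))" .
  have "integrable ?P (\<lambda>w. \<Prod>b\<in>Basis. f b (w b))"
    by (rule product_integrable_prod) (use f in auto)
  then have "integrable ?P (\<lambda>w. \<Prod>b\<in>Basis. f b (?T w \<bullet> b))" unfolding e .
  then have "integrable (distr ?P borel ?T) (\<lambda>x. \<Prod>b\<in>Basis. f b (x \<bullet> b))"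
    using integrable_distr_eq[OF T m] by simp
  then show "integrable lborel (\<lambda>x. \<Prod>b\<in>Basis. f b (x \<bullet> b))"
    using lborel_eq[where 'a='a] by simp
qed

text \<open>Up to the factor sqrt(2 pi) this is the characteristic function of the standard normal
  distribution.\<close>

lemma
  shows integral_gauss_cis_real:
    "(LINT t|lborel. complex_of_real (exp (- t\<^sup>2 / 2)) * cis (t * z)) = complex_of_real (sqrt (2 * pi) * exp (- z\<^sup>2 / 2))"
    and integrable_gauss_cis_real:
    "integrable lborel (\<lambda>t. complex_of_real (exp (- t\<^sup>2 / 2)) * cis (t * z))"
proof -
  have e: "complex_of_real (exp (- t\<^sup>2 / 2)) * cis (t * z) = complex_of_real (sqrt (2 * pi)) * (std_normal_density t *\<^sub>R iexp (z * t))" for t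
    by (simp add: std_normal_density_def cis_conv_exp scaleR_conv_of_real mult.commute)
  have c: "char std_normal_distribution z = (LINT t|lborel. std_normal_density t *\<^sub>R iexp (z * t))"
    unfolding char_def by (rule integral_density) auto
  show "(LINT t|lborel. complex_of_real (exp (- t\<^sup>2 / 2)) * cis (t * z)) = complex_of_real (sqrt (2 * pi) * exp (- z\<^sup>2 / 2))"
    unfolding e integral_mult_right_zero c[symmetric] char_std_normal_distribution by simp
  have "integrable lborel (\<lambda>t. std_normal_density t *\<^sub>R iexp (z * t))"
    by (rule Bochner_Integration.integrable_bound[OF integrable_normal_density[of 1 0]]) auto
  then show "integrable lborel (\<lambda>t. complex_of_real (exp (- t\<^sup>2 / 2)) * cis (t * z))"
    unfolding e by (rule integrable_mult_right)
qed

text \<open>Left unnormalised: its values lie in ]0, 1], so its dilates increase to 1 as the scale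
  tends to 0, and it is its own Fourier transform up to a constant.\<close>

definition gauss :: "'a::euclidean_space \<Rightarrow> real" where
  "gauss x = exp (- (norm x)\<^sup>2 / 2)"

lemma gauss_prod: "gauss x = (\<Prod>b\<in>Basis. exp (- (x \<bullet> b)\<^sup>2 / 2))"
proof -
  have "(norm x)\<^sup>2 = (\<Sum>b\<in>Basis. (x \<bullet> b)\<^sup>2)"
    unfolding power2_norm_eq_inner by (subst euclidean_inner) (simp add: power2_eq_square)
  then show ?thesis
    by (simp add: gauss_def exp_sum[symmetric] sum_negf sum_divide_distrib)
qed

lemma cis_inner_prod: "cis (x \<bullet> z) = (\<Prod>b\<in>Basis. cis ((x \<bullet> b) * (z \<bullet> b)))"
  unfolding cis_conv_exp by (subst euclidean_inner) (simp add: exp_sum[symmetric] sum_distrib_left)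

lemma
  fixes z :: "'a::euclidean_space"
  shows integral_gauss_cis:
    "(LINT x|lborel. complex_of_real (gauss x) * cis (x \<bullet> z)) = complex_of_real (sqrt (2 * pi) ^ DIM('a) * gauss z)"
    and integrable_gauss_cis: "integrable lborel (\<lambda>x. complex_of_real (gauss x) * cis (x \<bullet> z))"
proof -
  have e: "complex_of_real (gauss x) * cis (x \<bullet> z)
      = (\<Prod>b\<in>Basis. complex_of_real (exp (- (x \<bullet> b)\<^sup>2 / 2)) * cis ((x \<bullet> b) * (z \<bullet> b)))" for x
    by (simp add: gauss_prod cis_inner_prod prod.distrib)
  have "(LINT x|lborel. complex_of_real (gauss x) * cis (x \<bullet> z))
      = (\<Prod>b\<in>Basis. complex_of_real (sqrt (2 * pi) * exp (- (z \<bullet> b)\<^sup>2 / 2)))"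
    unfolding e
    by (rule trans[OF integral_lborel_prod_Basis[OF integrable_gauss_cis_real]]) (simp only: integral_gauss_cis_real)
  also have "\<dots> = complex_of_real (sqrt (2 * pi) ^ DIM('a) * gauss z)"
    by (simp add: gauss_prod prod.distrib)
  finally show "(LINT x|lborel. complex_of_real (gauss x) * cis (x \<bullet> z)) = complex_of_real (sqrt (2 * pi) ^ DIM('a) * gauss z)" .
  show "integrable lborel (\<lambda>x. complex_of_real (gauss x) * cis (x \<bullet> z))"
    unfolding e by (rule integrable_lborel_prod_Basis[OF integrable_gauss_cis_real])
qed

lemma integrable_gauss: "integrable lborel (gauss :: 'a::euclidean_space \<Rightarrow> real)"
proof -
  have "integrable lborel (\<lambda>x::'a. Re (complex_of_real (gauss x) * cis (x \<bullet> 0)))"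
    by (rule integrable_Re[OF integrable_gauss_cis])
  then show ?thesis by simp
qed

lemma gauss_measurable [measurable]: "gauss \<in> borel_measurable borel"
  unfolding gauss_def[abs_def] by measurable

lemma gauss_bounds: "0 < gauss x" "gauss x \<le> 1"
  by (auto simp: gauss_def)

lemma integral_gauss: "(LINT x|lborel. complex_of_real (gauss (x::'a::euclidean_space))) = complex_of_real (sqrt (2 * pi) ^ DIM('a))"
  using integral_gauss_cis[of "0::'a"] by (simp add: gauss_def)

lemma cis_measurable [measurable]: "cis \<in> borel_measurable borel"
  unfolding cis_conv_exp[abs_def] by measurable

text \<open>The multiplication formula. The parameter \<sigma> covers both signs of the exponent;
  the explicit factors 1 and -1 in later integrands exist to match it.\<close>

lemma cis_fubini:
  fixes u v :: "'a::euclidean_space \<Rightarrow> complex"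
  assumes u: "integrable lborel u" and v: "integrable lborel v"
  shows "(LINT x|lborel. u x * (LINT y|lborel. v y * cis (\<sigma> * (x \<bullet> y))))
       = (LINT y|lborel. v y * (LINT x|lborel. u x * cis (\<sigma> * (x \<bullet> y))))"
proof -
  have [measurable]: "u \<in> borel_measurable borel" "v \<in> borel_measurable borel" using u v by auto
  have vi: "integrable lborel (\<lambda>y. v y * cis (\<sigma> * (x \<bullet> y)))" for x
    by (rule Bochner_Integration.integrable_bound[OF v]) (auto simp: norm_mult)
  have i: "integrable (lborel \<Otimes>\<^sub>M lborel) (case_prod (\<lambda>x y. u x * (v y * cis (\<sigma> * (x \<bullet> y)))))"
  proof (rule lborel_pair.Fubini_integrable)
    show "integrable lborel (\<lambda>x. LINT y|lborel. norm (case (x, y) of (x, y) \<Rightarrow> u x * (v y * cis (\<sigma> * (x \<bullet> y)))))"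
      using u v by (simp add: norm_mult)
    show "AE x in lborel. integrable lborel (\<lambda>y. case (x, y) of (x, y) \<Rightarrow> u x * (v y * cis (\<sigma> * (x \<bullet> y))))"
      using vi by simp
  qed measurable
  have "(LINT x|lborel. u x * (LINT y|lborel. v y * cis (\<sigma> * (x \<bullet> y))))
      = (LINT x|lborel. (LINT y|lborel. u x * (v y * cis (\<sigma> * (x \<bullet> y)))))"
    by simp
  also have "\<dots> = (LINT y|lborel. (LINT x|lborel. u x * (v y * cis (\<sigma> * (x \<bullet> y)))))"
    by (rule lborel_pair.Fubini_integral[OF i, symmetric])
  also have "\<dots> = (LINT y|lborel. (LINT x|lborel. v y * (u x * cis (\<sigma> * (x \<bullet> y)))))"
    by (simp add: ac_simps)
  finally show ?thesis by simp
qed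

lemma integral_gauss_scaled_cis:
  fixes w :: "'a::euclidean_space"
  assumes "\<epsilon> > 0"
  shows "(LINT \<xi>|lborel. complex_of_real (gauss (\<epsilon> *\<^sub>R \<xi>)) * cis (\<xi> \<bullet> w))
    = complex_of_real (sqrt (2 * pi) ^ DIM('a) / \<epsilon> ^ DIM('a) * gauss (w /\<^sub>R \<epsilon>))"
proof -
  have "(LINT \<xi>|lborel. complex_of_real (gauss (\<xi>::'a)) * cis (\<xi> \<bullet> (w /\<^sub>R \<epsilon>)))
    = \<bar>\<epsilon>\<bar> ^ DIM('a) *\<^sub>R (LINT \<xi>|lborel. complex_of_real (gauss (0 + \<epsilon> *\<^sub>R \<xi>)) * cis ((0 + \<epsilon> *\<^sub>R \<xi>) \<bullet> (w /\<^sub>R \<epsilon>)))"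
    by (rule integral_lborel_affine) (use assms in auto)
  then show ?thesis
    using assms unfolding integral_gauss_cis by (simp add: scaleR_conv_of_real field_simps)
qed

text \<open>With the Gaussian weight \<open>gauss (\<epsilon> *\<^sub>R \<xi>)\<close> Fubini's theorem applies, and the inner
  integral becomes an approximate identity applied to \<open>cnj g\<close>.\<close>

lemma Cc_plancherel_weighted:
  fixes g :: "real ^ 'n \<Rightarrow> complex"
  assumes g: "g \<in> Cc" and \<epsilon>: "\<epsilon> > 0"
  defines "F \<equiv> \<lambda>\<xi>. LINT x|lborel. g x * cis (- 1 * (\<xi> \<bullet> x))"
  shows "complex_of_real (LINT \<xi>|lborel. (cmod (F \<xi>))\<^sup>2 * gauss (\<epsilon> *\<^sub>R \<xi>))
    = complex_of_real (sqrt (2 * pi) ^ CARD('n)) *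
      (LINT x|lborel. g x * (LINT z|lborel. complex_of_real (gauss z) * cnj (g (x + \<epsilon> *\<^sub>R z))))"
    and "F \<in> borel_measurable borel" "\<And>\<xi>. cmod (F \<xi>) \<le> (LINT x|lborel. cmod (g x))"
    "integrable lborel (\<lambda>\<xi>. (cmod (F \<xi>))\<^sup>2 * gauss (\<epsilon> *\<^sub>R \<xi>))"
proof -
  let ?C = "sqrt (2 * pi) ^ CARD('n)"
  have gm[measurable]: "g \<in> borel_measurable borel" by (rule Cc_borel[OF g])
  have gi: "integrable lborel g" by (rule Cc_integrable[OF g])
  have Fx: "F \<xi> = (LINT x|lborel. g x * cis (- 1 * (\<xi> \<bullet> x)))" for \<xi>
    by (simp only: F_def)
  show Fm[measurable]: "F \<in> borel_measurable borel"
    unfolding F_def by measurable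
  have [measurable]: "(\<lambda>y. cnj (g y)) \<in> borel_measurable borel"
    by (rule measurable_compose[OF gm borel_measurable_continuous_onI]) (intro continuous_intros)
  show Fb: "cmod (F \<xi>) \<le> (LINT x|lborel. cmod (g x))" for \<xi>
    unfolding F_def by (rule order_trans[OF integral_norm_bound]) (simp add: norm_mult)
  let ?B = "LINT x|lborel. cmod (g x)"
  have Gi: "integrable lborel (\<lambda>\<xi>::real^'n. gauss (\<epsilon> *\<^sub>R \<xi>))"
    using integrable_lborel_affine[OF _ integrable_gauss, of \<epsilon> 0] \<epsilon> by simp
  have [measurable]: "(\<lambda>\<xi>. cnj (F \<xi>)) \<in> borel_measurable borel"
    by (rule measurable_compose[OF Fm borel_measurable_continuous_onI]) (intro continuous_intros)
  have hi: "integrable lborel (\<lambda>\<xi>. complex_of_real (gauss (\<epsilon> *\<^sub>R \<xi>)) * cnj (F \<xi>))"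
  proof (rule Bochner_Integration.integrable_bound)
    show "integrable lborel (\<lambda>\<xi>::real^'n. gauss (\<epsilon> *\<^sub>R \<xi>) * ?B)" by (rule integrable_mult_left[OF Gi])
    show "AE \<xi> in lborel. norm (complex_of_real (gauss (\<epsilon> *\<^sub>R \<xi>)) * cnj (F \<xi>)) \<le> norm (gauss (\<epsilon> *\<^sub>R \<xi>) * ?B)"
      using gauss_bounds(1) Fb by (auto simp: norm_mult abs_mult intro!: mult_left_mono order_trans[OF Fb])
  qed measurable
  show "integrable lborel (\<lambda>\<xi>. (cmod (F \<xi>))\<^sup>2 * gauss (\<epsilon> *\<^sub>R \<xi>))"
  proof (rule Bochner_Integration.integrable_bound)
    show "integrable lborel (\<lambda>\<xi>::real^'n. ?B\<^sup>2 * gauss (\<epsilon> *\<^sub>R \<xi>))" by (rule integrable_mult_right[OF Gi])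
    show "AE \<xi> in lborel. norm ((cmod (F \<xi>))\<^sup>2 * gauss (\<epsilon> *\<^sub>R \<xi>)) \<le> norm (?B\<^sup>2 * gauss (\<epsilon> *\<^sub>R \<xi>))"
      using gauss_bounds(1) by (auto simp: abs_mult intro!: mult_right_mono power_mono Fb)
  qed measurable
  \<comment> \<open>Conjugation flips the sign of the exponent, so \<open>cnj (F \<xi>)\<close> is
    again an integral of the shape that \<open>cis_fubini\<close> accepts.\<close>
  have cF: "cnj (F \<xi>) = (LINT y|lborel. cnj (g y) * cis (1 * (\<xi> \<bullet> y)))" for \<xi>
  proof -
    have "(LINT y|lborel. cnj (g y) * cis (1 * (\<xi> \<bullet> y))) = (LINT y|lborel. cnj (g y * cis (- 1 * (\<xi> \<bullet> y))))"
      by (intro Bochner_Integration.integral_cong refl) (simp add: cis_cnj)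
    also have "\<dots> = cnj (F \<xi>)" unfolding Fx by (rule Bochner_Integration.integral_cnj)
    finally show ?thesis ..
  qed
  have cgi: "integrable lborel (\<lambda>y. cnj (g y))" using gi by simp
  have inner: "(LINT \<xi>|lborel. complex_of_real (gauss (\<epsilon> *\<^sub>R \<xi>)) * cnj (F \<xi>) * cis (- 1 * (\<xi> \<bullet> x)))
      = complex_of_real ?C * (LINT z|lborel. complex_of_real (gauss z) * cnj (g (x + \<epsilon> *\<^sub>R z)))" for x
  proof -
    have i: "integrable lborel (\<lambda>\<xi>. complex_of_real (gauss (\<epsilon> *\<^sub>R \<xi>)) * cis (- (\<xi> \<bullet> x)))"
      by (rule Bochner_Integration.integrable_bound[OF Gi]) (auto simp: norm_mult)
    have "(LINT \<xi>|lborel. complex_of_real (gauss (\<epsilon> *\<^sub>R \<xi>)) * cnj (F \<xi>) * cis (- 1 * (\<xi> \<bullet> x)))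
      = (LINT \<xi>|lborel. complex_of_real (gauss (\<epsilon> *\<^sub>R \<xi>)) * cis (- (\<xi> \<bullet> x)) * (LINT y|lborel. cnj (g y) * cis (1 * (\<xi> \<bullet> y))))"
      unfolding cF by (simp add: ac_simps)
    also have "\<dots> = (LINT y|lborel. cnj (g y) * (LINT \<xi>|lborel. complex_of_real (gauss (\<epsilon> *\<^sub>R \<xi>)) * cis (- (\<xi> \<bullet> x)) * cis (1 * (\<xi> \<bullet> y))))"
      by (rule cis_fubini[OF i cgi])
    also have "\<dots> = (LINT y|lborel. cnj (g y) * complex_of_real (?C / \<epsilon> ^ CARD('n) * gauss ((y - x) /\<^sub>R \<epsilon>)))"
    proof (intro Bochner_Integration.integral_cong refl arg_cong2[where f="(*)"])
      fix y
      have "(LINT \<xi>|lborel. complex_of_real (gauss (\<epsilon> *\<^sub>R \<xi>)) * cis (- (\<xi> \<bullet> x)) * cis (1 * (\<xi> \<bullet> y)))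
        = (LINT \<xi>|lborel. complex_of_real (gauss (\<epsilon> *\<^sub>R \<xi>)) * cis (\<xi> \<bullet> (y - x)))"
        by (simp add: mult.assoc cis_mult inner_diff_right)
      then show "(LINT \<xi>|lborel. complex_of_real (gauss (\<epsilon> *\<^sub>R \<xi>)) * cis (- (\<xi> \<bullet> x)) * cis (1 * (\<xi> \<bullet> y)))
        = complex_of_real (?C / \<epsilon> ^ CARD('n) * gauss ((y - x) /\<^sub>R \<epsilon>))"
        using integral_gauss_scaled_cis[OF \<epsilon>, of "y - x"] by simp
    qed
    \<comment> \<open>The substitution y = x + \<epsilon> z moves the scale from the Gaussian into
      the argument of g; the Jacobian cancels the factor \<epsilon>^(-d).\<close>
    also have "\<dots> = \<bar>\<epsilon>\<bar> ^ DIM(real^'n) *\<^sub>R (LINT z|lborel. cnj (g (x + \<epsilon> *\<^sub>R z)) *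
        complex_of_real (?C / \<epsilon> ^ CARD('n) * gauss ((x + \<epsilon> *\<^sub>R z - x) /\<^sub>R \<epsilon>)))"
      by (rule integral_lborel_affine) (use \<epsilon> in auto)
    also have "\<dots> = (LINT z|lborel. complex_of_real ?C * (complex_of_real (gauss z) * cnj (g (x + \<epsilon> *\<^sub>R z))))"
      unfolding integral_scaleR_right[symmetric]
      by (intro Bochner_Integration.integral_cong refl) (use \<epsilon> in \<open>simp add: scaleR_conv_of_real[where 'a=complex] field_simps\<close>)
    finally show ?thesis by simp
  qed
  have "complex_of_real (LINT \<xi>|lborel. (cmod (F \<xi>))\<^sup>2 * gauss (\<epsilon> *\<^sub>R \<xi>))
      = (LINT \<xi>|lborel. complex_of_real ((cmod (F \<xi>))\<^sup>2 * gauss (\<epsilon> *\<^sub>R \<xi>)))"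
    by (rule integral_complex_of_real[symmetric])
  \<comment> \<open>Of the two factors in |F|^2 = F cnj(F), only F is expanded; the weighted factor
    \<open>cnj (F \<xi>)\<close> is integrable and can play the role of u in
    \<open>cis_fubini\<close>.\<close>
  also have "\<dots> = (LINT \<xi>|lborel. complex_of_real (gauss (\<epsilon> *\<^sub>R \<xi>)) * cnj (F \<xi>) * (LINT x|lborel. g x * cis (- 1 * (\<xi> \<bullet> x))))"
    unfolding Fx[symmetric]
    by (intro Bochner_Integration.integral_cong refl) (simp only: of_real_mult complex_norm_square ac_simps)
  also have "\<dots> = (LINT x|lborel. g x * (LINT \<xi>|lborel. complex_of_real (gauss (\<epsilon> *\<^sub>R \<xi>)) * cnj (F \<xi>) * cis (- 1 * (\<xi> \<bullet> x))))"
    by (rule cis_fubini[OF hi gi])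
  finally show "complex_of_real (LINT \<xi>|lborel. (cmod (F \<xi>))\<^sup>2 * gauss (\<epsilon> *\<^sub>R \<xi>))
    = complex_of_real ?C *
      (LINT x|lborel. g x * (LINT z|lborel. complex_of_real (gauss z) * cnj (g (x + \<epsilon> *\<^sub>R z))))"
    unfolding inner integral_mult_right_zero[symmetric] by (simp only: ac_simps)
qed

section \<open>The Fourier transform on L2\<close>

lemma exp_inner_cis: "exp (- \<i> * complex_of_real (\<xi> \<bullet> x)) = cis (- 1 * (\<xi> \<bullet> x))"
  by (simp add: cis_conv_exp)

lemma fourier_integral_borel:
  fixes g :: "real ^ 'n \<Rightarrow> complex"
  assumes [measurable]: "g \<in> borel_measurable borel"
  shows "fourier_integral g \<xi> =
     complex_of_real ((2 * pi) powr (- real CARD('n) / 2)) * (LINT x|lborel. g x * cis (- 1 * (\<xi> \<bullet> x)))"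
  unfolding fourier_integral_def exp_inner_cis by (subst integral_completion) auto

lemma fourier_const_sq:
  "((2 * pi) powr (- real d / 2))\<^sup>2 * (sqrt (2 * pi) ^ d)\<^sup>2 = 1"
proof -
  have "sqrt (2 * pi) ^ d = (2 * pi) powr (real d / 2)"
    by (simp add: powr_half_sqrt[symmetric] powr_realpow[symmetric] powr_powr)
  then show ?thesis
    by (simp add: power_mult_distrib[symmetric] powr_add[symmetric])
qed

text \<open>Let \<epsilon> tend to 0 in the weighted identity. On the space side dominated
  convergence evaluates the approximate identity; on the frequency side the weights increase to 1,
  so monotone convergence yields integrability of |F|^2 as well as its integral.\<close>

lemma Cc_plancherel:
  fixes g :: "real ^ 'n \<Rightarrow> complex"
  assumes g: "g \<in> Cc"
  shows "fourier_integral g \<in> L2" "L2_norm (fourier_integral g) = L2_norm g"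
proof -
  define C where "C = sqrt (2 * pi) ^ CARD('n)"
  define F where "F = (\<lambda>\<xi>. LINT x|lborel. g x * cis (- 1 * (\<xi> \<bullet> x)))"
  define \<epsilon> where "\<epsilon> n = 1 / real (Suc n)" for n
  have \<epsilon>: "\<epsilon> n > 0" for n by (simp add: \<epsilon>_def)
  have \<epsilon>0: "\<epsilon> \<longlonglongrightarrow> 0" unfolding \<epsilon>_def by (rule LIMSEQ_Suc[OF lim_1_over_n])
  define A where "A n x = (LINT z|lborel. complex_of_real (gauss z) * cnj (g (x + \<epsilon> n *\<^sub>R z)))" for n x
  define J where "J n = (LINT \<xi>|lborel. (cmod (F \<xi>))\<^sup>2 * gauss (\<epsilon> n *\<^sub>R \<xi>))" for n
  have J: "complex_of_real (J n) = complex_of_real C * (LINT x|lborel. g x * A n x)" for n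
    unfolding J_def A_def F_def C_def by (rule Cc_plancherel_weighted(1)[OF g \<epsilon>])
  have gm[measurable]: "g \<in> borel_measurable borel" by (rule Cc_borel[OF g])
  have cgm[measurable]: "(\<lambda>y. cnj (g y)) \<in> borel_measurable borel"
    by (rule measurable_compose[OF gm borel_measurable_continuous_onI]) (intro continuous_intros)
  obtain B R where B: "B \<ge> 0" "\<And>x. cmod (g x) \<le> B" and "\<And>x. norm x > R \<Longrightarrow> g x = 0"
    using Cc_bounded[OF g] by blast
  have Gi: "integrable lborel (\<lambda>z::real^'n. B * gauss z)" by (rule integrable_mult_right[OF integrable_gauss])
  have le: "cmod (complex_of_real (gauss z) * cnj (g y)) \<le> B * gauss z" for z :: "real^'n" and y
    using B(2)[of y] gauss_bounds(1)[of z] by (simp add: norm_mult mult.commute mult_right_mono)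
  have Alim: "(\<lambda>n. A n x) \<longlonglongrightarrow> complex_of_real C * cnj (g x)" for x
  proof -
    have "(\<lambda>n. A n x) \<longlonglongrightarrow> (LINT z|lborel. complex_of_real (gauss (z::real^'n)) * cnj (g x))"
      unfolding A_def
    proof (rule integral_dominated_convergence[OF _ _ Gi])
      show "AE z in lborel. (\<lambda>n. complex_of_real (gauss z) * cnj (g (x + \<epsilon> n *\<^sub>R z))) \<longlonglongrightarrow> complex_of_real (gauss z) * cnj (g x)"
      proof (rule AE_I2)
        fix z
        have "isCont g x" using g by (simp add: Cc_def continuous_on_eq_continuous_at)
        moreover have "(\<lambda>n. x + \<epsilon> n *\<^sub>R z) \<longlonglongrightarrow> x + 0 *\<^sub>R z" by (intro tendsto_intros \<epsilon>0)
        ultimately have "(\<lambda>n. g (x + \<epsilon> n *\<^sub>R z)) \<longlonglongrightarrow> g x"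
          by (auto intro: isCont_tendsto_compose)
        then show "(\<lambda>n. complex_of_real (gauss z) * cnj (g (x + \<epsilon> n *\<^sub>R z))) \<longlonglongrightarrow> complex_of_real (gauss z) * cnj (g x)"
          by (intro tendsto_intros)
      qed
      show "AE z in lborel. norm (complex_of_real (gauss z) * cnj (g (x + \<epsilon> n *\<^sub>R z))) \<le> B * gauss z" for n
        using le by simp
    qed measurable
    also have "(LINT z|lborel. complex_of_real (gauss (z::real^'n)) * cnj (g x)) = complex_of_real C * cnj (g x)"
      unfolding integral_mult_left_zero integral_gauss C_def by simp
    finally show ?thesis .
  qed
  define K where "K = (LINT z|lborel. B * gauss (z::real^'n))"
  have gp: "0 \<le> gauss x" for x :: "real^'n" using gauss_bounds(1)[of x] by simp
  have Ale: "cmod (A n x) \<le> K" for n x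
    unfolding A_def K_def
    by (rule order_trans[OF integral_norm_bound]) (rule integral_mono'[OF Gi], use le B gp in auto)
  have [measurable]: "A n \<in> borel_measurable borel" for n
    unfolding A_def by measurable
  have gi: "integrable lborel g" by (rule Cc_integrable[OF g])
  have "(\<lambda>n. LINT x|lborel. g x * A n x) \<longlonglongrightarrow> (LINT x|lborel. g x * (complex_of_real C * cnj (g x)))"
  proof (rule integral_dominated_convergence[where w="\<lambda>x. cmod (g x) * K"])
    show "AE x in lborel. (\<lambda>n. g x * A n x) \<longlonglongrightarrow> g x * (complex_of_real C * cnj (g x))"
      by (intro AE_I2 tendsto_intros Alim)
    show "AE x in lborel. norm (g x * A n x) \<le> cmod (g x) * K" for n
      by (intro AE_I2) (simp add: norm_mult mult_left_mono Ale)
    show "integrable lborel (\<lambda>x. cmod (g x) * K)" using gi by simp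
  qed measurable
  also have "(LINT x|lborel. g x * (complex_of_real C * cnj (g x))) = (LINT x|lborel. complex_of_real C * complex_of_real ((cmod (g x))\<^sup>2))"
    by (intro Bochner_Integration.integral_cong refl) (simp only: complex_norm_square ac_simps)
  also have "\<dots> = complex_of_real (C * (LINT x|lborel. (cmod (g x))\<^sup>2))"
    unfolding integral_mult_right_zero integral_complex_of_real of_real_mult ..
  finally have "(\<lambda>n. complex_of_real C * (LINT x|lborel. g x * A n x)) \<longlonglongrightarrow>
      complex_of_real C * complex_of_real (C * (LINT x|lborel. (cmod (g x))\<^sup>2))"
    by (intro tendsto_intros)
  \<comment> \<open>One factor C comes from the weighted identity, the other from the total mass of
    the Gaussian.\<close>
  then have "(\<lambda>n. complex_of_real (J n)) \<longlonglongrightarrow> complex_of_real (C\<^sup>2 * (LINT x|lborel. (cmod (g x))\<^sup>2))"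
    unfolding J by (simp add: power2_eq_square mult.assoc)
  then have Jlim: "J \<longlonglongrightarrow> C\<^sup>2 * (LINT x|lborel. (cmod (g x))\<^sup>2)"
    by (simp only: tendsto_of_real_iff)
  have Fm[measurable]: "F \<in> borel_measurable borel"
    unfolding F_def by (rule Cc_plancherel_weighted(2)[OF g \<epsilon>])
  have W: "integrable lborel (\<lambda>\<xi>. (cmod (F \<xi>))\<^sup>2 * gauss (\<epsilon> n *\<^sub>R \<xi>))" for n
    unfolding F_def by (rule Cc_plancherel_weighted(4)[OF g \<epsilon>])
  have mono: "mono (\<lambda>n. (cmod (F \<xi>))\<^sup>2 * gauss (\<epsilon> n *\<^sub>R \<xi>))" for \<xi>
  proof (rule monoI)
    fix m n :: nat assume "m \<le> n"
    then have "\<epsilon> n \<le> \<epsilon> m" by (simp add: \<epsilon>_def frac_le)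
    then have "norm (\<epsilon> n *\<^sub>R \<xi>) \<le> norm (\<epsilon> m *\<^sub>R \<xi>)" using \<epsilon>[of n] \<epsilon>[of m] by (simp add: mult_right_mono)
    then have "gauss (\<epsilon> m *\<^sub>R \<xi>) \<le> gauss (\<epsilon> n *\<^sub>R \<xi>)"
      unfolding gauss_def by (simp only: exp_le_cancel_iff) (simp add: power_mono del: norm_scaleR)
    then show "(cmod (F \<xi>))\<^sup>2 * gauss (\<epsilon> m *\<^sub>R \<xi>) \<le> (cmod (F \<xi>))\<^sup>2 * gauss (\<epsilon> n *\<^sub>R \<xi>)"
      by (intro mult_left_mono) auto
  qed
  have lim: "(\<lambda>n. (cmod (F \<xi>))\<^sup>2 * gauss (\<epsilon> n *\<^sub>R \<xi>)) \<longlonglongrightarrow> (cmod (F \<xi>))\<^sup>2" for \<xi>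
  proof -
    have "(\<lambda>n. (cmod (F \<xi>))\<^sup>2 * gauss (\<epsilon> n *\<^sub>R \<xi>)) \<longlonglongrightarrow> (cmod (F \<xi>))\<^sup>2 * exp (- (norm (0 *\<^sub>R \<xi>))\<^sup>2 / 2)"
      unfolding gauss_def by (intro tendsto_intros \<epsilon>0) auto
    then show ?thesis by simp
  qed
  have Fi: "integrable lborel (\<lambda>\<xi>. (cmod (F \<xi>))\<^sup>2)"
    by (rule integrable_monotone_convergence[OF W _ _ Jlim[unfolded J_def]]) (use mono lim in auto)
  have FI: "(LINT \<xi>|lborel. (cmod (F \<xi>))\<^sup>2) = C\<^sup>2 * (LINT x|lborel. (cmod (g x))\<^sup>2)"
    by (rule integral_monotone_convergence[OF W _ _ Jlim[unfolded J_def]]) (use mono lim in auto)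
  define c where "c = (2 * pi) powr (- real CARD('n) / 2)"
  have e: "fourier_integral g = (\<lambda>\<xi>. complex_of_real c * F \<xi>)"
    unfolding F_def c_def by (rule ext fourier_integral_borel[OF gm])+
  have FL2: "F \<in> L2" using Fi by (simp add: L2_def integrable_completion measurable_completion)
  then show "fourier_integral g \<in> L2" unfolding e by (rule L2_scale)
  have "(L2_norm (fourier_integral g))\<^sup>2 = c\<^sup>2 * (LINT \<xi>|lebesgue. (cmod (F \<xi>))\<^sup>2)"
    unfolding e L2_norm_scale by (simp add: power_mult_distrib L2_norm_sq)
  also have "(LINT \<xi>|lebesgue. (cmod (F \<xi>))\<^sup>2) = (LINT \<xi>|lborel. (cmod (F \<xi>))\<^sup>2)"
    by (rule integral_completion) measurable
  also have "c\<^sup>2 * \<dots> = (LINT x|lborel. (cmod (g x))\<^sup>2)"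
    unfolding FI using fourier_const_sq[of "CARD('n)"] by (simp add: c_def C_def mult.assoc[symmetric])
  also have "\<dots> = (L2_norm g)\<^sup>2"
    unfolding L2_norm_sq by (rule integral_completion[symmetric]) measurable
  finally show "L2_norm (fourier_integral g) = L2_norm g" by simp
qed

lemma fourier_integral_integrable:
  fixes u :: "real ^ 'n \<Rightarrow> complex"
  assumes "integrable lebesgue u"
  shows "integrable lebesgue (\<lambda>x. u x * exp (- \<i> * complex_of_real (\<xi> \<bullet> x)))"
proof (rule Bochner_Integration.integrable_bound[OF assms])
  have [measurable]: "u \<in> borel_measurable lebesgue" using assms by auto
  have [measurable]: "(\<lambda>x. exp (- \<i> * complex_of_real (\<xi> \<bullet> x))) \<in> borel_measurable lebesgue"
    by (rule measurable_completion) measurable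
  show "(\<lambda>x. u x * exp (- \<i> * complex_of_real (\<xi> \<bullet> x))) \<in> borel_measurable lebesgue" by measurable
  show "AE x in lebesgue. norm (u x * exp (- \<i> * complex_of_real (\<xi> \<bullet> x))) \<le> norm (u x)"
    by (simp add: norm_mult)
qed

lemma fourier_integral_diff:
  assumes "integrable lebesgue u" "integrable lebesgue v"
  shows "fourier_integral (\<lambda>x. u x - v x) = (\<lambda>\<xi>. fourier_integral u \<xi> - fourier_integral v \<xi>)"
  unfolding fourier_integral_def left_diff_distrib
    Bochner_Integration.integral_diff[OF fourier_integral_integrable[OF assms(1)] fourier_integral_integrable[OF assms(2)]]
  by (auto simp: right_diff_distrib)

lemma fourier_integral_cmult: "fourier_integral (\<lambda>x. c * u x) \<xi> = c * fourier_integral u \<xi>"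
  unfolding fourier_integral_def mult.assoc[of c] integral_mult_right_zero by simp

lemma fourier_integral_sum:
  assumes "\<And>k. k \<in> K \<Longrightarrow> integrable lebesgue (F k)"
  shows "fourier_integral (\<lambda>x. \<Sum>k\<in>K. F k x) \<xi> = (\<Sum>k\<in>K. fourier_integral (F k) \<xi>)"
  unfolding fourier_integral_def sum_distrib_right sum_distrib_left[symmetric]
  by (subst Bochner_Integration.integral_sum) (rule fourier_integral_integrable assms refl | assumption)+

lemma fourier_integral_bound:
  fixes u :: "real ^ 'n \<Rightarrow> complex"
  shows "cmod (fourier_integral u \<xi>) \<le> (2 * pi) powr (- real CARD('n) / 2) * (LINT x|lebesgue. cmod (u x))"
  unfolding fourier_integral_def norm_mult
  using integral_norm_bound[of lebesgue "\<lambda>x. u x * exp (- \<i> * complex_of_real (\<xi> \<bullet> x))"]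
  by (simp add: norm_mult mult_left_mono)

text \<open>L^1 convergence of functions in \<open>Cc\<close> makes their Fourier integrals converge
  pointwise; Fatou turns the isometry on \<open>Cc\<close> into this inequality.\<close>

lemma fourier_integral_le:
  fixes u :: "real ^ 'n \<Rightarrow> complex"
  assumes u: "integrable lebesgue u" "u \<in> L2"
  shows "fourier_integral u \<in> L2" "L2_norm (fourier_integral u) \<le> L2_norm u"
proof -
  obtain g where g: "\<And>n. g n \<in> Cc" "(\<lambda>n. L2_norm (\<lambda>x. g n x - u x)) \<longlonglongrightarrow> 0"
      "integrable lebesgue u \<Longrightarrow> (\<lambda>n. LINT x|lebesgue. cmod (g n x - u x)) \<longlonglongrightarrow> 0"
    using Cc_dense[OF u(2)] by blast
  have gi: "integrable lebesgue (g n)" for n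
    using Cc_integrable[OF g(1)] Cc_borel[OF g(1)] by (simp add: integrable_completion)
  have lim: "(\<lambda>n. fourier_integral (g n) \<xi>) \<longlonglongrightarrow> fourier_integral u \<xi>" for \<xi>
  proof (rule LIM_zero_cancel, rule Lim_null_comparison)
    show "\<forall>\<^sub>F n in sequentially. norm (fourier_integral (g n) \<xi> - fourier_integral u \<xi>)
        \<le> (2 * pi) powr (- real CARD('n) / 2) * (LINT x|lebesgue. cmod (g n x - u x))"
      using fourier_integral_bound[of "\<lambda>x. g _ x - u x" \<xi>] by (simp add: fourier_integral_diff[OF gi u(1)])
    show "(\<lambda>n. (2 * pi) powr (- real CARD('n) / 2) * (LINT x|lebesgue. cmod (g n x - u x))) \<longlonglongrightarrow> 0"
      using tendsto_mult_right_zero[OF g(3)[OF u(1)]] .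
  qed
  have L: "fourier_integral (g n) \<in> L2" for n by (rule Cc_plancherel(1)[OF g(1)])
  have m: "fourier_integral u \<in> borel_measurable lebesgue"
    by (rule borel_measurable_LIMSEQ_metric[OF L2_measurable[OF L] lim])
  have n: "(\<lambda>n. L2_norm (g n)) \<longlonglongrightarrow> L2_norm u"
    by (rule L2_norm_tendsto[OF Cc_L2[OF g(1)] u(2) g(2)])
  have ev: "\<forall>\<^sub>F n in sequentially. L2_norm (fourier_integral (g n)) \<le> L2_norm u + e" if "e > 0" for e
  proof -
    have "\<forall>\<^sub>F n in sequentially. L2_norm (g n) < L2_norm u + e"
      by (rule order_tendstoD[OF n]) (use that in simp)
    then show ?thesis by eventually_elim (simp add: Cc_plancherel(2)[OF g(1)])
  qed
  note F = L2_Fatou[OF L AE_I2[OF lim] m ev]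
  show "fourier_integral u \<in> L2" by (rule F(1)[of 1]) simp
  show "L2_norm (fourier_integral u) \<le> L2_norm u"
    by (rule field_le_epsilon) (rule F(2))
qed

text \<open>The inequality, applied to \<open>g n - u\<close>, shows that the transforms converge in
  L^2, so the equality of norms on \<open>Cc\<close> survives the limit.\<close>

lemma fourier_integral_norm:
  fixes u :: "real ^ 'n \<Rightarrow> complex"
  assumes u: "integrable lebesgue u" "u \<in> L2"
  shows "L2_norm (fourier_integral u) = L2_norm u"
proof -
  obtain g where g: "\<And>n. g n \<in> Cc" "(\<lambda>n. L2_norm (\<lambda>x. g n x - u x)) \<longlonglongrightarrow> 0"
    using Cc_dense[OF u(2)] by blast
  have gi: "integrable lebesgue (g n)" for n
    using Cc_integrable[OF g(1)] Cc_borel[OF g(1)] by (simp add: integrable_completion)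
  have "L2_norm (\<lambda>\<xi>. fourier_integral (g n) \<xi> - fourier_integral u \<xi>) \<le> L2_norm (\<lambda>x. g n x - u x)" for n
    using fourier_integral_le(2)[of "\<lambda>x. g n x - u x"] gi u
    by (simp add: fourier_integral_diff L2_diff Cc_L2[OF g(1)])
  then have "(\<lambda>n. L2_norm (\<lambda>\<xi>. fourier_integral (g n) \<xi> - fourier_integral u \<xi>)) \<longlonglongrightarrow> 0"
    by (intro tendsto_sandwich[OF _ _ tendsto_const g(2)]) auto
  then have "(\<lambda>n. L2_norm (fourier_integral (g n))) \<longlonglongrightarrow> L2_norm (fourier_integral u)"
    by (intro L2_norm_tendsto Cc_plancherel(1)[OF g(1)] fourier_integral_le(1) u)
  moreover have "(\<lambda>n. L2_norm (fourier_integral (g n))) \<longlonglongrightarrow> L2_norm u"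
    unfolding Cc_plancherel(2)[OF g(1)] by (rule L2_norm_tendsto[OF Cc_L2[OF g(1)] u(2) g(2)])
  ultimately show ?thesis by (rule LIMSEQ_unique)
qed

lemma L2_L1_approx:
  fixes f :: "real ^ 'n \<Rightarrow> complex"
  assumes "f \<in> L2"
  obtains u where "\<And>n::nat. integrable lebesgue (u n)" "\<And>n. u n \<in> L2" "(\<lambda>n. L2_norm (\<lambda>x. u n x - f x)) \<longlonglongrightarrow> 0"
proof -
  obtain g where g: "\<And>n. g n \<in> Cc" "(\<lambda>n. L2_norm (\<lambda>x. g n x - f x)) \<longlonglongrightarrow> 0"
    using Cc_dense[OF assms] by blast
  have "integrable lebesgue (g n)" for n
    using Cc_integrable[OF g(1)] Cc_borel[OF g(1)] by (simp add: integrable_completion)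
  then show ?thesis using Cc_L2[OF g(1)] g(2) by (rule that)
qed

lemma L2_convergent_Cauchy:
  assumes "\<And>n. u n \<in> L2" "f \<in> L2" "(\<lambda>n. L2_norm (\<lambda>x. u n x - f x)) \<longlonglongrightarrow> 0" "e > 0"
  shows "\<exists>N. \<forall>m\<ge>N. \<forall>n\<ge>N. L2_norm (\<lambda>x. u m x - u n x) < e"
proof -
  obtain N where N: "\<And>n. n \<ge> N \<Longrightarrow> L2_norm (\<lambda>x. u n x - f x) < e / 2"
    using order_tendstoD(2)[OF assms(3), of "e/2"] assms(4) by (auto simp: eventually_sequentially)
  have "L2_norm (\<lambda>x. u m x - u n x) < e" if "m \<ge> N" "n \<ge> N" for m n
    using L2_norm_triangle_diff[OF assms(1)[of m] assms(2) assms(1)[of n]] N[OF that(1)] N[OF that(2)]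
      L2_norm_minus_commute[of f "u n"] by linarith
  then show ?thesis by blast
qed

text \<open>The description behind \<open>SOME\<close> in \<open>fourier\<close> is satisfiable:
  completeness gives a limit along one approximating sequence, and the isometry forces every other
  sequence to the same limit.\<close>

lemma
  fixes f :: "real ^ 'n \<Rightarrow> complex"
  assumes f: "f \<in> L2"
  shows fourier_L2: "fourier f \<in> L2"
    and fourier_tendsto: "(\<And>n. integrable lebesgue (u n)) \<Longrightarrow> (\<And>n. u n \<in> L2) \<Longrightarrow>
      (\<lambda>n. L2_norm (\<lambda>x. u n x - f x)) \<longlonglongrightarrow> 0 \<Longrightarrow>
      (\<lambda>n. L2_norm (\<lambda>\<xi>. fourier_integral (u n) \<xi> - fourier f \<xi>)) \<longlonglongrightarrow> 0"
proof -
  obtain v where v: "\<And>n::nat. integrable lebesgue (v n)" "\<And>n. v n \<in> L2"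
      and vf: "(\<lambda>n. L2_norm (\<lambda>x. v n x - f x)) \<longlonglongrightarrow> 0"
    using L2_L1_approx[OF f] by blast
  have iso: "L2_norm (\<lambda>\<xi>. fourier_integral a \<xi> - fourier_integral b \<xi>) = L2_norm (\<lambda>x. a x - b x)"
    if "integrable lebesgue a" "a \<in> L2" "integrable lebesgue b" "b \<in> L2" for a b :: "real ^ 'n \<Rightarrow> complex"
    using fourier_integral_norm[of "\<lambda>x. a x - b x"] that by (simp add: fourier_integral_diff L2_diff)
  have vL: "fourier_integral (v n) \<in> L2" for n by (intro fourier_integral_le v)
  obtain g where g: "g \<in> L2" "(\<lambda>n. L2_norm (\<lambda>\<xi>. fourier_integral (v n) \<xi> - g \<xi>)) \<longlonglongrightarrow> 0"
  proof (rule L2_complete[of "\<lambda>n. fourier_integral (v n)"])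
    show "\<exists>N. \<forall>m\<ge>N. \<forall>n\<ge>N. L2_norm (\<lambda>x. fourier_integral (v m) x - fourier_integral (v n) x) < e"
      if "e > 0" for e
      using L2_convergent_Cauchy[OF v(2) f vf that] by (simp add: iso v)
  qed (use vL in auto)
  have "(\<lambda>n. L2_norm (\<lambda>\<xi>. fourier_integral (u n) \<xi> - g \<xi>)) \<longlonglongrightarrow> 0"
    if u: "\<And>n. integrable lebesgue (u n)" "\<And>n. u n \<in> L2" and uf: "(\<lambda>n. L2_norm (\<lambda>x. u n x - f x)) \<longlonglongrightarrow> 0" for u
  proof (rule tendsto_sandwich[OF _ _ tendsto_const])
    show "\<forall>\<^sub>F n in sequentially. L2_norm (\<lambda>\<xi>. fourier_integral (u n) \<xi> - g \<xi>)
      \<le> (L2_norm (\<lambda>x. u n x - f x) + L2_norm (\<lambda>x. v n x - f x)) + L2_norm (\<lambda>\<xi>. fourier_integral (v n) \<xi> - g \<xi>)"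
    proof (intro always_eventually allI)
      fix n
      have "fourier_integral (u n) \<in> L2" by (intro fourier_integral_le u)
      from L2_norm_triangle_diff[OF this vL[of n] g(1)] L2_norm_triangle_diff[OF u(2)[of n] f v(2)[of n]]
      show "L2_norm (\<lambda>\<xi>. fourier_integral (u n) \<xi> - g \<xi>)
        \<le> (L2_norm (\<lambda>x. u n x - f x) + L2_norm (\<lambda>x. v n x - f x)) + L2_norm (\<lambda>\<xi>. fourier_integral (v n) \<xi> - g \<xi>)"
        unfolding iso[OF u(1) u(2) v(1) v(2)] L2_norm_minus_commute[of f "v n"] by linarith
    qed
    show "(\<lambda>n. (L2_norm (\<lambda>x. u n x - f x) + L2_norm (\<lambda>x. v n x - f x)) + L2_norm (\<lambda>\<xi>. fourier_integral (v n) \<xi> - g \<xi>)) \<longlonglongrightarrow> 0"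
      using tendsto_add[OF tendsto_add[OF uf vf] g(2)] by simp
  qed simp
  then have "\<exists>g. g \<in> L2 \<and>
     (\<forall>u. (\<forall>n. integrable lebesgue (u n) \<and> u n \<in> L2) \<and>
          (\<lambda>n. L2_norm (\<lambda>x. u n x - f x)) \<longlonglongrightarrow> 0 \<longrightarrow>
          (\<lambda>n. L2_norm (\<lambda>\<xi>. fourier_integral (u n) \<xi> - g \<xi>)) \<longlonglongrightarrow> 0)"
    using g(1) by blast
  from someI_ex[OF this, folded fourier_def]
  show "fourier f \<in> L2"
    and "(\<And>n. integrable lebesgue (u n)) \<Longrightarrow> (\<And>n. u n \<in> L2) \<Longrightarrow>
      (\<lambda>n. L2_norm (\<lambda>x. u n x - f x)) \<longlonglongrightarrow> 0 \<Longrightarrow>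
      (\<lambda>n. L2_norm (\<lambda>\<xi>. fourier_integral (u n) \<xi> - fourier f \<xi>)) \<longlonglongrightarrow> 0"
    by blast+
qed

section \<open>Shifts and the orthogonal projection\<close>

lemma shifted_eq:
  "shifted T s \<phi> k = (\<lambda>x. complex_of_real (T powr (- real CARD('n) / 2)) *
     \<phi> (- (s *\<^sub>R lattice_vec k) + inverse T *\<^sub>R x))" for \<phi> :: "real ^ 'n \<Rightarrow> complex"
  by (simp add: shifted_def fun_eq_iff)

lemma
  fixes \<phi> :: "real ^ 'n \<Rightarrow> complex"
  assumes T: "T > 0" and \<phi>: "\<phi> \<in> L2"
  shows shifted_L2: "shifted T s \<phi> k \<in> L2" and L2_norm_shifted: "L2_norm (shifted T s \<phi> k) = L2_norm \<phi>"
proof -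
  show "shifted T s \<phi> k \<in> L2"
    unfolding shifted_eq by (intro L2_scale L2_affine \<phi>) (use T in simp)
  have "L2_norm (shifted T s \<phi> k)
      = T powr (- real CARD('n) / 2) * (inverse T powr (- real CARD('n) / 2) * L2_norm \<phi>)"
    unfolding shifted_eq L2_norm_scale using L2_norm_affine[OF _ \<phi>, of "inverse T" "- (s *\<^sub>R lattice_vec k)"] T by simp
  also have "T powr (- real CARD('n) / 2) * (inverse T powr (- real CARD('n) / 2) * L2_norm \<phi>) = L2_norm \<phi>"
    using T by (simp add: mult.assoc[symmetric] powr_mult[symmetric])
  finally show "L2_norm (shifted T s \<phi> k) = L2_norm \<phi>" .
qed

lemma integrable_shifted:
  fixes v :: "real ^ 'n \<Rightarrow> complex"
  assumes "T > 0" "integrable lebesgue v"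
  shows "integrable lebesgue (shifted T s v k)"
  unfolding shifted_eq using assms by (intro integrable_mult_right) (subst integrable_lebesgue_affine_iff, auto)

lemma shifted_diff: "shifted T s u k x - shifted T s v k x = shifted T s (\<lambda>y. u y - v y) k x"
  by (simp add: shifted_def right_diff_distrib)

text \<open>Substitute x = T s k + T y: translation becomes a phase, and the Jacobian T^d meets the
  normalisation T^(-d/2). The phase is a character with period 2 pi / (T s) in every
  coordinate.\<close>

lemma fourier_integral_shifted:
  fixes v :: "real ^ 'n \<Rightarrow> complex"
  assumes T: "T > 0" and v: "integrable lebesgue v"
  shows "fourier_integral (shifted T s v k) \<xi> = complex_of_real (T powr (real CARD('n) / 2)) *
    (cis (- (T * s * (\<xi> \<bullet> lattice_vec k))) * fourier_integral v (T *\<^sub>R \<xi>))"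
proof -
  let ?h = "\<lambda>x. shifted T s v k x * exp (- \<i> * complex_of_real (\<xi> \<bullet> x))"
  let ?t = "(T * s) *\<^sub>R lattice_vec k :: real ^ 'n"
  have "?h \<in> borel_measurable lebesgue"
    by (rule borel_measurable_integrable[OF fourier_integral_integrable[OF integrable_shifted[OF T v]]])
  then have "(LINT x|lebesgue. ?h x) = \<bar>T\<bar> ^ DIM(real^'n) *\<^sub>R (LINT y|lebesgue. ?h (?t + T *\<^sub>R y))"
    by (intro integral_lebesgue_affine) (use T in auto)
  also have "(LINT y|lebesgue. ?h (?t + T *\<^sub>R y)) = (LINT y|lebesgue.
     complex_of_real (T powr (- real CARD('n) / 2)) * cis (- (T * s * (\<xi> \<bullet> lattice_vec k))) *
       (v y * exp (- \<i> * complex_of_real ((T *\<^sub>R \<xi>) \<bullet> y))))"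
  proof (intro Bochner_Integration.integral_cong refl)
    fix y
    have "shifted T s v k (?t + T *\<^sub>R y) = complex_of_real (T powr (- real CARD('n) / 2)) * v y"
      using T by (simp add: shifted_def scaleR_add_right mult.assoc[symmetric])
    moreover have "exp (- \<i> * complex_of_real (\<xi> \<bullet> (?t + T *\<^sub>R y)))
        = cis (- (T * s * (\<xi> \<bullet> lattice_vec k))) * exp (- \<i> * complex_of_real ((T *\<^sub>R \<xi>) \<bullet> y))"
      unfolding exp_inner_cis cis_mult by (simp add: inner_add_right)
    ultimately show "?h (?t + T *\<^sub>R y) =
       complex_of_real (T powr (- real CARD('n) / 2)) * cis (- (T * s * (\<xi> \<bullet> lattice_vec k))) *
       (v y * exp (- \<i> * complex_of_real ((T *\<^sub>R \<xi>) \<bullet> y)))"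
      by (simp only: ac_simps)
  qed
  also have "\<dots> = complex_of_real (T powr (- real CARD('n) / 2)) * cis (- (T * s * (\<xi> \<bullet> lattice_vec k))) *
       (LINT y|lebesgue. v y * exp (- \<i> * complex_of_real ((T *\<^sub>R \<xi>) \<bullet> y)))"
    by (rule integral_mult_right_zero)
  finally have h: "(LINT x|lebesgue. ?h x) = complex_of_real (T ^ CARD('n) * T powr (- real CARD('n) / 2)) *
      (cis (- (T * s * (\<xi> \<bullet> lattice_vec k))) *
       (LINT y|lebesgue. v y * exp (- \<i> * complex_of_real ((T *\<^sub>R \<xi>) \<bullet> y))))"
    using T by (simp only: scaleR_conv_of_real of_real_mult ac_simps DIM_cart DIM_real mult_1_right mult_1_left abs_of_pos)
  have "T ^ CARD('n) * T powr (- real CARD('n) / 2) = T powr (real CARD('n) / 2)"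
    using T by (simp add: powr_realpow[symmetric] powr_add[symmetric])
  with h show ?thesis unfolding fourier_integral_def by (simp only: ac_simps)
qed

text \<open>Needed on both sides of the transform: once for the functions and their shifts, once for
  their Fourier integrals.\<close>

lemma L2_combination_tendsto:
  fixes f :: "real ^ 'n \<Rightarrow> complex"
  assumes u: "\<And>n. u n \<in> L2" and f: "f \<in> L2" and uf: "(\<lambda>n. L2_norm (\<lambda>x. u n x - f x)) \<longlonglongrightarrow> 0"
    and v: "\<And>n k. k \<in> K \<Longrightarrow> v n k \<in> L2" and g: "\<And>k. k \<in> K \<Longrightarrow> g k \<in> L2"
    and vg: "\<And>k. k \<in> K \<Longrightarrow> (\<lambda>n. L2_norm (\<lambda>x. v n k x - g k x)) \<longlonglongrightarrow> 0"
  shows "(\<lambda>n. L2_norm (\<lambda>x. u n x - (\<Sum>k\<in>K. a k * v n k x))) \<longlonglongrightarrow> L2_norm (\<lambda>x. f x - (\<Sum>k\<in>K. a k * g k x))"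
proof (rule L2_norm_tendsto)
  show "(\<lambda>x. u n x - (\<Sum>k\<in>K. a k * v n k x)) \<in> L2" for n
    by (intro L2_diff L2_sum L2_scale u v)
  show "(\<lambda>x. f x - (\<Sum>k\<in>K. a k * g k x)) \<in> L2"
    by (intro L2_diff L2_sum L2_scale f g)
  have le: "L2_norm (\<lambda>x. (u n x - (\<Sum>k\<in>K. a k * v n k x)) - (f x - (\<Sum>k\<in>K. a k * g k x)))
     \<le> L2_norm (\<lambda>x. u n x - f x) + (\<Sum>k\<in>K. cmod (a k) * L2_norm (\<lambda>x. v n k x - g k x))" for n
  proof -
    have e: "(u n x - (\<Sum>k\<in>K. a k * v n k x)) - (f x - (\<Sum>k\<in>K. a k * g k x))
        = (u n x - f x) + (\<Sum>k\<in>K. (- a k) * (v n k x - g k x))" for x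
      by (simp add: sum_subtractf sum_negf right_diff_distrib)
    have "L2_norm (\<lambda>x. (u n x - f x) + (\<Sum>k\<in>K. (- a k) * (v n k x - g k x)))
        \<le> L2_norm (\<lambda>x. u n x - f x) + L2_norm (\<lambda>x. \<Sum>k\<in>K. (- a k) * (v n k x - g k x))"
      by (intro L2_norm_triangle L2_diff L2_sum L2_scale u f v g)
    also have "L2_norm (\<lambda>x. \<Sum>k\<in>K. (- a k) * (v n k x - g k x))
        \<le> (\<Sum>k\<in>K. L2_norm (\<lambda>x. (- a k) * (v n k x - g k x)))"
      by (intro L2_norm_sum L2_scale L2_diff v g)
    finally show ?thesis unfolding e L2_norm_scale by simp
  qed
  show "(\<lambda>n. L2_norm (\<lambda>x. (u n x - (\<Sum>k\<in>K. a k * v n k x)) - (f x - (\<Sum>k\<in>K. a k * g k x)))) \<longlonglongrightarrow> 0"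
  proof (rule tendsto_sandwich[OF _ _ tendsto_const])
    have "(\<lambda>n. L2_norm (\<lambda>x. u n x - f x) + (\<Sum>k\<in>K. cmod (a k) * L2_norm (\<lambda>x. v n k x - g k x)))
        \<longlonglongrightarrow> 0 + (\<Sum>k\<in>K. cmod (a k) * 0)"
      by (intro tendsto_intros uf vg)
    then show "(\<lambda>n. L2_norm (\<lambda>x. u n x - f x) + (\<Sum>k\<in>K. cmod (a k) * L2_norm (\<lambda>x. v n k x - g k x))) \<longlonglongrightarrow> 0"
      by simp
  qed (use le in auto)
qed

lemma cis_inner_measurable [measurable]:
  "(\<lambda>\<xi>::real ^ 'n. cis (c * (\<xi> \<bullet> k))) \<in> borel_measurable lebesgue"
  by (rule measurable_completion) measurable

lemma L2_modulate:
  assumes g: "g \<in> L2"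
  shows "(\<lambda>\<xi>. cis (c * (\<xi> \<bullet> k)) * g \<xi>) \<in> L2" "L2_norm (\<lambda>\<xi>. cis (c * (\<xi> \<bullet> k)) * g \<xi>) = L2_norm g"
proof -
  have [measurable]: "g \<in> borel_measurable lebesgue" using g by (simp add: L2_def)
  show "(\<lambda>\<xi>. cis (c * (\<xi> \<bullet> k)) * g \<xi>) \<in> L2"
    by (rule L2_dominated(1)[OF _ g]) (auto simp: norm_mult)
  show "L2_norm (\<lambda>\<xi>. cis (c * (\<xi> \<bullet> k)) * g \<xi>) = L2_norm g"
    by (simp add: L2_norm_def norm_mult)
qed

text \<open>Linearity and the shift formula hold pointwise for \<open>fourier_integral\<close> on
  integrable functions. The identity is proved there and both sides pass to the L^2 limit, so no
  pointwise law for the chosen representative \<open>fourier\<close> is required.\<close>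

theorem L2_norm_diff_shifts:
  fixes f \<phi> :: "real ^ 'n \<Rightarrow> complex"
  assumes T: "T > 0" and f: "f \<in> L2" and \<phi>: "\<phi> \<in> L2"
  shows "L2_norm (\<lambda>x. f x - (\<Sum>k\<in>K. (complex_of_real (T powr (- real CARD('n) / 2)) * c k) * shifted T s \<phi> k x))
    = L2_norm (\<lambda>\<xi>. fourier f \<xi> - (\<Sum>k\<in>K. c k * (cis (- (T * s) * (\<xi> \<bullet> lattice_vec k)) * fourier \<phi> (T *\<^sub>R \<xi>))))"
proof -
  define a where "a k = complex_of_real (T powr (- real CARD('n) / 2)) * c k" for k
  obtain u where u: "\<And>n::nat. integrable lebesgue (u n)" "\<And>n. u n \<in> L2"
      and uf: "(\<lambda>n. L2_norm (\<lambda>x. u n x - f x)) \<longlonglongrightarrow> 0"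
    using L2_L1_approx[OF f] by blast
  obtain v where v: "\<And>n::nat. integrable lebesgue (v n)" "\<And>n. v n \<in> L2"
      and vf: "(\<lambda>n. L2_norm (\<lambda>x. v n x - \<phi> x)) \<longlonglongrightarrow> 0"
    using L2_L1_approx[OF \<phi>] by blast
  let ?w = "\<lambda>n x. u n x - (\<Sum>k\<in>K. a k * shifted T s (v n) k x)"
  have 1: "(\<lambda>n. L2_norm (?w n)) \<longlonglongrightarrow> L2_norm (\<lambda>x. f x - (\<Sum>k\<in>K. a k * shifted T s \<phi> k x))"
  proof (rule L2_combination_tendsto[OF u(2) f uf])
    show "(\<lambda>n. L2_norm (\<lambda>x. shifted T s (v n) k x - shifted T s \<phi> k x)) \<longlonglongrightarrow> 0" for k
      unfolding shifted_diff using vf L2_norm_shifted[OF T L2_diff[OF v(2) \<phi>]] by simp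
  qed (intro shifted_L2 T v \<phi>)+
  have "integrable lebesgue (?w n)" "?w n \<in> L2" for n
    by (intro Bochner_Integration.integrable_diff Bochner_Integration.integrable_sum integrable_mult_right integrable_shifted T u v)
       (intro L2_diff L2_sum L2_scale shifted_L2 T u v)
  then have iso: "L2_norm (?w n) = L2_norm (fourier_integral (?w n))" for n
    by (rule fourier_integral_norm[symmetric])
  \<comment> \<open>The prefactor in the coefficients is chosen to cancel the T^(d/2) of the shift
    formula.\<close>
  have ac: "a k * complex_of_real (T powr (real CARD('n) / 2)) = c k" for k
  proof -
    have "T powr (- real CARD('n) / 2) * T powr (real CARD('n) / 2) = 1"
      using T by (simp add: powr_add[symmetric])
    then show ?thesis
      unfolding a_def by (metis (no_types, lifting) mult.commute mult.left_commute mult_1_right of_real_1 of_real_mult)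
  qed
  have fw: "fourier_integral (?w n) = (\<lambda>\<xi>. fourier_integral (u n) \<xi> -
      (\<Sum>k\<in>K. c k * (cis (- (T * s) * (\<xi> \<bullet> lattice_vec k)) * fourier_integral (v n) (T *\<^sub>R \<xi>))))" for n
  proof
    fix \<xi>
    have "fourier_integral (?w n) \<xi> = fourier_integral (u n) \<xi> - fourier_integral (\<lambda>x. \<Sum>k\<in>K. a k * shifted T s (v n) k x) \<xi>"
      by (subst fourier_integral_diff)
         (intro Bochner_Integration.integrable_sum integrable_mult_right integrable_shifted T u v refl)+
    also have "fourier_integral (\<lambda>x. \<Sum>k\<in>K. a k * shifted T s (v n) k x) \<xi>
        = (\<Sum>k\<in>K. a k * fourier_integral (shifted T s (v n) k) \<xi>)"
      by (subst fourier_integral_sum) (auto intro!: integrable_mult_right integrable_shifted T v simp: fourier_integral_cmult)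
    also have "\<dots> = (\<Sum>k\<in>K. c k * (cis (- (T * s) * (\<xi> \<bullet> lattice_vec k)) * fourier_integral (v n) (T *\<^sub>R \<xi>)))"
      unfolding fourier_integral_shifted[OF T v(1)] mult.assoc[symmetric] ac by simp
    finally show "fourier_integral (?w n) \<xi> = fourier_integral (u n) \<xi> -
      (\<Sum>k\<in>K. c k * (cis (- (T * s) * (\<xi> \<bullet> lattice_vec k)) * fourier_integral (v n) (T *\<^sub>R \<xi>)))" .
  qed
  have T0: "T \<noteq> 0" using T by simp
  have dil: "(\<lambda>\<xi>. g (T *\<^sub>R \<xi>)) \<in> L2" if "g \<in> L2" for g :: "real ^ 'n \<Rightarrow> complex"
    using L2_affine[OF T0 that, of 0] by simp
  have 2: "(\<lambda>n. L2_norm (fourier_integral (?w n))) \<longlonglongrightarrow>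
     L2_norm (\<lambda>\<xi>. fourier f \<xi> - (\<Sum>k\<in>K. c k * (cis (- (T * s) * (\<xi> \<bullet> lattice_vec k)) * fourier \<phi> (T *\<^sub>R \<xi>))))"
    unfolding fw
  proof (rule L2_combination_tendsto[OF _ fourier_L2[OF f] fourier_tendsto[OF f u uf]])
    fix k
    have "L2_norm (\<lambda>\<xi>. cis (- (T * s) * (\<xi> \<bullet> lattice_vec k)) * fourier_integral (v n) (T *\<^sub>R \<xi>) -
         cis (- (T * s) * (\<xi> \<bullet> lattice_vec k)) * fourier \<phi> (T *\<^sub>R \<xi>))
       = \<bar>T\<bar> powr (- real CARD('n) / 2) * L2_norm (\<lambda>\<xi>. fourier_integral (v n) \<xi> - fourier \<phi> \<xi>)" for n
    proof -
      have d: "(\<lambda>\<xi>. fourier_integral (v n) \<xi> - fourier \<phi> \<xi>) \<in> L2"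
        by (intro L2_diff fourier_integral_le fourier_L2 v \<phi>)
      show ?thesis
        unfolding right_diff_distrib[symmetric] L2_modulate(2)[OF dil[OF d]]
        using L2_norm_affine[OF T0 d, of 0] by simp
    qed
    then show "(\<lambda>n. L2_norm (\<lambda>\<xi>. cis (- (T * s) * (\<xi> \<bullet> lattice_vec k)) * fourier_integral (v n) (T *\<^sub>R \<xi>) -
         cis (- (T * s) * (\<xi> \<bullet> lattice_vec k)) * fourier \<phi> (T *\<^sub>R \<xi>))) \<longlonglongrightarrow> 0"
      using tendsto_mult_right_zero[OF fourier_tendsto[OF \<phi> v vf]] by simp
  qed (intro fourier_integral_le L2_modulate dil fourier_L2 u v \<phi>)+
  show ?thesis using LIMSEQ_unique[OF 1 2[folded iso]] unfolding a_def .
qed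

section \<open>Inner products and the projection theorem\<close>

lemma L2_inner_integrable:
  assumes "f \<in> L2" "g \<in> L2"
  shows "integrable lebesgue (\<lambda>x. f x * cnj (g x))"
proof (rule Bochner_Integration.integrable_bound)
  have [measurable]: "f \<in> borel_measurable lebesgue" and g: "g \<in> borel_measurable lebesgue"
    using assms by (auto simp: L2_def)
  have [measurable]: "(\<lambda>x. cnj (g x)) \<in> borel_measurable lebesgue"
    by (rule measurable_compose[OF g borel_measurable_continuous_onI]) (intro continuous_intros)
  show "(\<lambda>x. f x * cnj (g x)) \<in> borel_measurable lebesgue" by measurable
  show "integrable lebesgue (\<lambda>x. (cmod (f x))\<^sup>2 + (cmod (g x))\<^sup>2)" using assms by (auto simp: L2_def)
  show "AE x in lebesgue. norm (f x * cnj (g x)) \<le> norm ((cmod (f x))\<^sup>2 + (cmod (g x))\<^sup>2)"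
  proof (rule AE_I2)
    fix x
    have "cmod (f x) * cmod (g x) \<le> (cmod (f x))\<^sup>2 + (cmod (g x))\<^sup>2"
      using sum_squares_bound[of "cmod (f x)" "cmod (g x)"]
        mult_nonneg_nonneg[OF norm_ge_zero norm_ge_zero, of "f x" "g x"] by linarith
    then show "norm (f x * cnj (g x)) \<le> norm ((cmod (f x))\<^sup>2 + (cmod (g x))\<^sup>2)"
      by (simp add: norm_mult)
  qed
qed

lemma cmod_diff_sq: "(cmod (a - b))\<^sup>2 = (cmod a)\<^sup>2 + (cmod b)\<^sup>2 - 2 * Re (a * cnj b)"
  unfolding cmod_power2 by (simp add: power2_eq_square algebra_simps)

lemma L2_norm_diff_sq:
  assumes f: "f \<in> L2" and g: "g \<in> L2"
  shows "(L2_norm (\<lambda>x. f x - g x))\<^sup>2 = (L2_norm f)\<^sup>2 + (L2_norm g)\<^sup>2 - 2 * Re (L2_inner f g)"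
proof -
  define c where "c x = Re (f x * cnj (g x))" for x
  have "integrable lebesgue c"
    unfolding c_def by (rule integrable_Re[OF L2_inner_integrable[OF f g]])
  moreover have "Re (L2_inner f g) = (LINT x|lebesgue. c x)"
    unfolding L2_inner_def c_def by (rule integral_Re[OF L2_inner_integrable[OF f g], symmetric])
  ultimately show ?thesis
    unfolding L2_norm_sq cmod_diff_sq c_def[symmetric] using L2_integrable[OF f] L2_integrable[OF g] by simp
qed

lemma L2_inner_scale_right: "L2_inner f (\<lambda>x. c * g x) = cnj c * L2_inner f g"
  unfolding L2_inner_def by (simp add: mult.left_commute)

lemma L2_parallelogram:
  assumes f: "f \<in> L2" and g: "g \<in> L2"
  shows "(L2_norm (\<lambda>x. f x - g x))\<^sup>2 = 2 * (L2_norm f)\<^sup>2 + 2 * (L2_norm g)\<^sup>2 - (L2_norm (\<lambda>x. f x + g x))\<^sup>2"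
proof -
  have "L2_inner f (\<lambda>x. - g x) = - L2_inner f g" using L2_inner_scale_right[of f "-1" g] by simp
  moreover have "L2_norm (\<lambda>x. - g x) = L2_norm g" by (simp add: L2_norm_def)
  ultimately show ?thesis
    using L2_norm_diff_sq[OF f g] L2_norm_diff_sq[OF f L2_uminus[OF g]] by simp
qed

text \<open>The classical Hilbert space argument: a minimizing sequence is Cauchy by the
  parallelogram law, and a variation in the direction k shows that the minimizer is orthogonal to k.
  The closedness assumption is sequential and up to null sets, since functions are not
  identified.\<close>

theorem L2_projection_exists:
  assumes V: "V \<subseteq> L2" "(\<lambda>x. 0) \<in> V"
    and add: "\<And>g h. g \<in> V \<Longrightarrow> h \<in> V \<Longrightarrow> (\<lambda>x. g x + h x) \<in> V"
    and scale: "\<And>c g. g \<in> V \<Longrightarrow> (\<lambda>x. c * g x) \<in> V"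
    and closed: "\<And>u g. (\<And>n::nat. u n \<in> V) \<Longrightarrow> g \<in> L2 \<Longrightarrow> (\<lambda>n. L2_norm (\<lambda>x. u n x - g x)) \<longlonglongrightarrow> 0 \<Longrightarrow> g \<in> V"
    and f: "f \<in> L2"
  shows "\<exists>g\<in>V. \<forall>h\<in>V. L2_inner (\<lambda>x. f x - g x) h = 0"
proof -
  define D where "D = (INF h\<in>V. (L2_norm (\<lambda>x. f x - h x))\<^sup>2)"
  have bdd: "bdd_below ((\<lambda>h. (L2_norm (\<lambda>x. f x - h x))\<^sup>2) ` V)" by (rule bdd_belowI2[of _ 0]) simp
  have Dle: "D \<le> (L2_norm (\<lambda>x. f x - h x))\<^sup>2" if "h \<in> V" for h
    unfolding D_def by (rule cINF_lower[OF bdd that])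
  have ex: "\<exists>h. h \<in> V \<and> (L2_norm (\<lambda>x. f x - h x))\<^sup>2 < D + 1 / Suc n" for n
  proof (rule ccontr)
    assume "\<not> ?thesis"
    then have "D + 1 / Suc n \<le> D"
      unfolding D_def using V(2) by (intro cINF_greatest) (auto simp: D_def[symmetric] not_less)
    then show False by simp
  qed
  from choice[OF allI[OF ex]] obtain h where
    h: "\<forall>n. h n \<in> V \<and> (L2_norm (\<lambda>x. f x - h n x))\<^sup>2 < D + 1 / Suc n" ..
  have hV: "h n \<in> V" and hD: "(L2_norm (\<lambda>x. f x - h n x))\<^sup>2 < D + 1 / Suc n" for n using h by blast+
  have hL: "h n \<in> L2" for n using hV V(1) by blast
  have z: "(\<lambda>N. 1 / real (Suc N)) \<longlonglongrightarrow> 0" by (rule LIMSEQ_Suc[OF lim_1_over_n])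
  have diff: "(L2_norm (\<lambda>x. h m x - h n x))\<^sup>2 \<le> 2 / Suc m + 2 / Suc n" for m n
  proof -
    \<comment> \<open>The midpoint lies in V, so its distance to f is at least the infimum; this
      makes the parallelogram law bound the difference.\<close>
    have half: "(\<lambda>x. 1/2 * (h m x + h n x)) \<in> V" by (intro scale add hV)
    have e: "(\<lambda>x. (f x - h n x) + (f x - h m x)) = (\<lambda>x. 2 * (f x - 1/2 * (h m x + h n x)))"
      by (rule ext) (simp add: field_simps)
    have "(L2_norm (\<lambda>x. (f x - h n x) + (f x - h m x)))\<^sup>2 = 4 * (L2_norm (\<lambda>x. f x - 1/2 * (h m x + h n x)))\<^sup>2"
      unfolding e L2_norm_scale power_mult_distrib by simp
    moreover have "(\<lambda>x. (f x - h n x) - (f x - h m x)) = (\<lambda>x. h m x - h n x)" by simp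
    ultimately have "(L2_norm (\<lambda>x. h m x - h n x))\<^sup>2 = 2 * (L2_norm (\<lambda>x. f x - h n x))\<^sup>2
        + 2 * (L2_norm (\<lambda>x. f x - h m x))\<^sup>2 - 4 * (L2_norm (\<lambda>x. f x - 1/2 * (h m x + h n x)))\<^sup>2"
      using L2_parallelogram[OF L2_diff[OF f hL[of n]] L2_diff[OF f hL[of m]]] by simp
    then show ?thesis using Dle[OF half] hD[of n] hD[of m] by linarith
  qed
  obtain g where g: "g \<in> L2" and hg: "(\<lambda>n. L2_norm (\<lambda>x. h n x - g x)) \<longlonglongrightarrow> 0"
  proof (rule L2_complete[OF hL])
    fix e :: real assume "e > 0"
    then obtain N where N: "\<And>n. n \<ge> N \<Longrightarrow> 1 / real (Suc n) < e\<^sup>2 / 4"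
      using order_tendstoD(2)[OF z, of "e\<^sup>2/4"] by (auto simp: eventually_sequentially)
    have "L2_norm (\<lambda>x. h m x - h n x) < e" if "m \<ge> N" "n \<ge> N" for m n
    proof -
      have "(L2_norm (\<lambda>x. h m x - h n x))\<^sup>2 < e\<^sup>2"
        using diff[of m n] N[OF that(1)] N[OF that(2)] by simp
      then show ?thesis using \<open>e > 0\<close> by (auto dest: power2_less_imp_less)
    qed
    then show "\<exists>N. \<forall>m\<ge>N. \<forall>n\<ge>N. L2_norm (\<lambda>x. h m x - h n x) < e" by blast
  qed auto
  have gV: "g \<in> V" by (rule closed[OF hV g hg])
  have gD: "(L2_norm (\<lambda>x. f x - g x))\<^sup>2 \<le> D"
  proof -
    have "(\<lambda>n. L2_norm (\<lambda>x. f x - h n x)) \<longlonglongrightarrow> L2_norm (\<lambda>x. f x - g x)"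
    proof (rule L2_norm_tendsto[OF L2_diff[OF f hL] L2_diff[OF f g]])
      have "(\<lambda>x. (f x - h n x) - (f x - g x)) = (\<lambda>x. g x - h n x)" for n by simp
      then show "(\<lambda>n. L2_norm (\<lambda>x. (f x - h n x) - (f x - g x))) \<longlonglongrightarrow> 0"
        using hg by (simp add: L2_norm_minus_commute[of g])
    qed
    then have "(\<lambda>n. (L2_norm (\<lambda>x. f x - h n x))\<^sup>2) \<longlonglongrightarrow> (L2_norm (\<lambda>x. f x - g x))\<^sup>2"
      by (intro tendsto_intros)
    moreover have "(\<lambda>n. D + 1 / real (Suc n)) \<longlonglongrightarrow> D" using tendsto_add[OF tendsto_const z] by simp
    ultimately show ?thesis
      by (rule LIMSEQ_le) (use hD in \<open>auto intro: less_imp_le\<close>)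
  qed
  have "L2_inner (\<lambda>x. f x - g x) k = 0" if k: "k \<in> V" for k
  proof (rule ccontr)
    let ?c = "L2_inner (\<lambda>x. f x - g x) k"
    assume c: "?c \<noteq> 0"
    \<comment> \<open>The step size is small enough that \<delta> times the squared norm of k is
      below 1. Then the quadratic term of the variation cannot compensate the linear one; the
      summand 1 covers norm 0.\<close>
    define \<delta> where "\<delta> = 1 / ((L2_norm k)\<^sup>2 + 1)"
    have \<delta>: "\<delta> > 0" by (simp add: \<delta>_def add_nonneg_pos)
    define t where "t = complex_of_real \<delta> * ?c"
    have kL: "k \<in> L2" using k V(1) by blast
    have "(\<lambda>x. f x - (g x + t * k x)) = (\<lambda>x. (f x - g x) - t * k x)" by (simp add: algebra_simps)
    moreover have "D \<le> (L2_norm (\<lambda>x. f x - (g x + t * k x)))\<^sup>2"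
      by (rule Dle) (intro add scale gV k)
    ultimately have "D \<le> (L2_norm (\<lambda>x. f x - g x))\<^sup>2 + (cmod t * L2_norm k)\<^sup>2 - 2 * Re (cnj t * ?c)"
      using L2_norm_diff_sq[OF L2_diff[OF f g] L2_scale[OF kL, of t]]
      by (simp add: L2_norm_scale L2_inner_scale_right)
    then have "2 * Re (cnj t * ?c) \<le> (cmod t * L2_norm k)\<^sup>2" using gD by linarith
    moreover have "cnj t * ?c = complex_of_real (\<delta> * (cmod ?c)\<^sup>2)"
      unfolding t_def of_real_mult complex_norm_square by (simp add: mult.commute)
    moreover have "(cmod t * L2_norm k)\<^sup>2 = \<delta> * (cmod ?c)\<^sup>2 * (\<delta> * (L2_norm k)\<^sup>2)"
      using \<delta> by (simp add: t_def norm_mult power2_eq_square)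
    ultimately have "2 * (\<delta> * (cmod ?c)\<^sup>2) \<le> \<delta> * (cmod ?c)\<^sup>2 * (\<delta> * (L2_norm k)\<^sup>2)" by simp
    moreover have "\<delta> * (cmod ?c)\<^sup>2 * (\<delta> * (L2_norm k)\<^sup>2) \<le> \<delta> * (cmod ?c)\<^sup>2 * 1"
      by (intro mult_left_mono) (use \<delta> in \<open>auto simp: \<delta>_def divide_le_eq add_nonneg_pos\<close>)
    moreover have "0 < \<delta> * (cmod ?c)\<^sup>2" using \<delta> c by simp
    ultimately show False by linarith
  qed
  then show ?thesis using gV by blast
qed

lemma shift_span_L2: "T > 0 \<Longrightarrow> \<phi> \<in> L2 \<Longrightarrow> h \<in> shift_span T s \<phi> \<Longrightarrow> h \<in> L2"
  by (auto simp: shift_span_def intro!: L2_sum L2_scale shifted_L2)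

text \<open>Coefficients are extended by 0 to the union of the supports. The abstract family F lets
  it serve both shifts and characters.\<close>

lemma linear_combination_add:
  fixes F :: "'k \<Rightarrow> 'a \<Rightarrow> complex"
  assumes K: "finite K" and L: "finite L"
  obtains M e where "finite M"
    "\<And>x. (\<Sum>k\<in>K. c k * F k x) + (\<Sum>k\<in>L. d k * F k x) = (\<Sum>k\<in>M. e k * F k x)"
proof
  show "finite (K \<union> L)" using K L by simp
  fix x
  let ?e = "\<lambda>k. (if k \<in> K then c k else 0) + (if k \<in> L then d k else 0)"
  have "(\<Sum>k\<in>K. c k * F k x) = (\<Sum>k\<in>K \<union> L. (if k \<in> K then c k else 0) * F k x)"
    by (rule sum.mono_neutral_cong_left) (use K L in auto)
  moreover have "(\<Sum>k\<in>L. d k * F k x) = (\<Sum>k\<in>K \<union> L. (if k \<in> L then d k else 0) * F k x)"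
    by (rule sum.mono_neutral_cong_left) (use K L in auto)
  ultimately show "(\<Sum>k\<in>K. c k * F k x) + (\<Sum>k\<in>L. d k * F k x) = (\<Sum>k\<in>K \<union> L. ?e k * F k x)"
    by (simp only: sum.distrib distrib_right)
qed

lemma shift_span_add:
  assumes "g \<in> shift_span T s \<phi>" "h \<in> shift_span T s \<phi>"
  shows "(\<lambda>x. g x + h x) \<in> shift_span T s \<phi>"
proof -
  obtain K c where K: "finite K" and g: "g = (\<lambda>x. \<Sum>k\<in>K. c k * shifted T s \<phi> k x)"
    using assms(1) by (auto simp: shift_span_def)
  obtain L d where L: "finite L" and h: "h = (\<lambda>x. \<Sum>k\<in>L. d k * shifted T s \<phi> k x)"
    using assms(2) by (auto simp: shift_span_def)
  show ?thesis
    by (rule linear_combination_add[OF K L, of c "shifted T s \<phi>" d]) (auto simp: shift_span_def g h)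
qed

lemma shift_span_scale:
  assumes "g \<in> shift_span T s \<phi>"
  shows "(\<lambda>x. a * g x) \<in> shift_span T s \<phi>"
proof -
  obtain K c where K: "finite K" and g: "g = (\<lambda>x. \<Sum>k\<in>K. c k * shifted T s \<phi> k x)"
    using assms by (auto simp: shift_span_def)
  have "(\<lambda>x. a * g x) = (\<lambda>x. \<Sum>k\<in>K. (a * c k) * shifted T s \<phi> k x)"
    unfolding g by (simp only: sum_distrib_left mult.assoc)
  then show ?thesis using K unfolding shift_span_def by (intro CollectI exI conjI) auto
qed

lemma shift_span_zero: "(\<lambda>x. 0) \<in> shift_span T s \<phi>"
  unfolding shift_span_def by (intro CollectI exI[of _ "{}"]) simp

lemma shift_span_subset_space:
  assumes "T > 0" "\<phi> \<in> L2" "h \<in> shift_span T s \<phi>"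
  shows "h \<in> shift_space T s \<phi>"
proof -
  have "L2_norm (\<lambda>x. h x - h x) < \<epsilon>" if "\<epsilon> > 0" for \<epsilon> using that by simp
  then show ?thesis unfolding shift_space_def using shift_span_L2[OF assms] assms(3) by blast
qed

text \<open>\<open>shift_space\<close> is shown to be a closed subspace, so the choice in
  \<open>shift_proj\<close> has a witness; the bound is then Pythagoras.\<close>

lemma shift_proj_best_approx:
  fixes f \<phi> :: "real ^ 'n \<Rightarrow> complex"
  assumes T: "T > 0" and \<phi>: "\<phi> \<in> L2" and f: "f \<in> L2" and h: "h \<in> shift_span T s \<phi>"
  shows "L2_norm (\<lambda>x. shift_proj T s \<phi> f x - f x) \<le> L2_norm (\<lambda>x. f x - h x)"
proof -
  let ?V = "shift_space T s \<phi>"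
  note SL = shift_span_L2[OF T \<phi>]
  have V: "?V \<subseteq> L2" by (auto simp: shift_space_def)
  have Vadd: "(\<lambda>x. g x + h x) \<in> ?V" if g: "g \<in> ?V" and h: "h \<in> ?V" for g h
  proof -
    have gL: "g \<in> L2" and hL: "h \<in> L2" using g h by (auto simp: shift_space_def)
    have "\<exists>p\<in>shift_span T s \<phi>. L2_norm (\<lambda>x. (g x + h x) - p x) < e" if e: "e > 0" for e
    proof -
      obtain p where p: "p \<in> shift_span T s \<phi>" "L2_norm (\<lambda>x. g x - p x) < e/2"
        using g e half_gt_zero[OF e] unfolding shift_space_def by blast
      obtain q where q: "q \<in> shift_span T s \<phi>" "L2_norm (\<lambda>x. h x - q x) < e/2"
        using h e half_gt_zero[OF e] unfolding shift_space_def by blast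
      have "(\<lambda>x. (g x + h x) - (p x + q x)) = (\<lambda>x. (g x - p x) + (h x - q x))" by (simp add: algebra_simps)
      then have "L2_norm (\<lambda>x. (g x + h x) - (p x + q x)) < e"
        using L2_norm_triangle[OF L2_diff[OF gL SL[OF p(1)]] L2_diff[OF hL SL[OF q(1)]]] p(2) q(2) by simp
      then show ?thesis using shift_span_add[OF p(1) q(1)] by (intro bexI)
    qed
    then show ?thesis unfolding shift_space_def using L2_add[OF gL hL] by blast
  qed
  have Vscale: "(\<lambda>x. c * g x) \<in> ?V" if g: "g \<in> ?V" for c g
  proof -
    have gL: "g \<in> L2" using g by (auto simp: shift_space_def)
    have "\<exists>p\<in>shift_span T s \<phi>. L2_norm (\<lambda>x. c * g x - p x) < e" if e: "e > 0" for e
    proof -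
      \<comment> \<open>The summand 1 avoids a separate case c = 0.\<close>
      have c1: "cmod c + 1 > 0" by (simp add: add_nonneg_pos)
      then have "e / (cmod c + 1) > 0" using e by simp
      then obtain p where p: "p \<in> shift_span T s \<phi>" "L2_norm (\<lambda>x. g x - p x) < e / (cmod c + 1)"
        using g unfolding shift_space_def by blast
      have "L2_norm (\<lambda>x. c * g x - c * p x) = cmod c * L2_norm (\<lambda>x. g x - p x)"
        unfolding right_diff_distrib[symmetric] by (rule L2_norm_scale)
      also have "\<dots> \<le> (cmod c + 1) * L2_norm (\<lambda>x. g x - p x)" by (intro mult_right_mono) auto
      also have "\<dots> < e" using p(2) c1 by (simp add: pos_less_divide_eq mult.commute)
      finally show ?thesis using shift_span_scale[OF p(1)] by (intro bexI)
    qed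
    then show ?thesis unfolding shift_space_def using L2_scale[OF gL] by blast
  qed
  have Vclosed: "g \<in> ?V" if u: "\<And>n::nat. u n \<in> ?V" and g: "g \<in> L2" and l: "(\<lambda>n. L2_norm (\<lambda>x. u n x - g x)) \<longlonglongrightarrow> 0" for u g
  proof -
    have "\<exists>p\<in>shift_span T s \<phi>. L2_norm (\<lambda>x. g x - p x) < e" if e: "e > 0" for e
    proof -
      have "\<forall>\<^sub>F n in sequentially. L2_norm (\<lambda>x. u n x - g x) < e/2"
        by (rule order_tendstoD(2)[OF l]) (use e in simp)
      then obtain n where n: "L2_norm (\<lambda>x. u n x - g x) < e/2"
        using eventually_happens'[OF sequentially_bot] by blast
      obtain p where p: "p \<in> shift_span T s \<phi>" "L2_norm (\<lambda>x. u n x - p x) < e/2"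
        using u[of n] half_gt_zero[OF e] unfolding shift_space_def by blast
      have "u n \<in> L2" using u V by blast
      then have "L2_norm (\<lambda>x. g x - p x) < e"
        using L2_norm_triangle_diff[OF g _ SL[OF p(1)], of "u n"] n p(2) L2_norm_minus_commute[of g "u n"] by simp
      then show ?thesis using p(1) by blast
    qed
    then show ?thesis unfolding shift_space_def using g by blast
  qed
  have "\<exists>g\<in>?V. \<forall>h\<in>?V. L2_inner (\<lambda>x. f x - g x) h = 0"
    by (rule L2_projection_exists[OF V shift_span_subset_space[OF T \<phi> shift_span_zero] Vadd Vscale Vclosed f])
  then have "\<exists>g. g \<in> ?V \<and> (\<forall>h\<in>?V. L2_inner (\<lambda>x. f x - g x) h = 0)" by blast
  from someI_ex[OF this, folded shift_proj_def]
  have pV: "shift_proj T s \<phi> f \<in> ?V" and orth: "\<And>h. h \<in> ?V \<Longrightarrow> L2_inner (\<lambda>x. f x - shift_proj T s \<phi> f x) h = 0"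
    by blast+
  let ?p = "shift_proj T s \<phi> f"
  have pL: "?p \<in> L2" using pV V by blast
  have hV: "h \<in> ?V" by (rule shift_span_subset_space[OF T \<phi> h])
  have hL: "h \<in> L2" using hV V by blast
  \<comment> \<open>The difference of h and the projection stays in the space, hence is orthogonal
    to the residual of f.\<close>
  have "(\<lambda>x. h x + (-1) * ?p x) \<in> ?V" by (intro Vadd Vscale hV pV)
  then have "L2_inner (\<lambda>x. f x - ?p x) (\<lambda>x. h x - ?p x) = 0" using orth by simp
  moreover have "(\<lambda>x. (f x - ?p x) - (h x - ?p x)) = (\<lambda>x. f x - h x)" by simp
  ultimately have "(L2_norm (\<lambda>x. f x - h x))\<^sup>2 = (L2_norm (\<lambda>x. f x - ?p x))\<^sup>2 + (L2_norm (\<lambda>x. h x - ?p x))\<^sup>2"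
    using L2_norm_diff_sq[OF L2_diff[OF f pL] L2_diff[OF hL pL]] by simp
  then have "(L2_norm (\<lambda>x. f x - ?p x))\<^sup>2 \<le> (L2_norm (\<lambda>x. f x - h x))\<^sup>2" by simp
  then have "L2_norm (\<lambda>x. f x - ?p x) \<le> L2_norm (\<lambda>x. f x - h x)" by (rule power2_le_imp_le) simp
  then show ?thesis by (simp add: L2_norm_minus_commute[of ?p])
qed

section \<open>Lattice sums and trigonometric polynomials\<close>

text \<open>Nonnegative and negative integers each embed into the naturals under the absolute value,
  so twice the one-sided series is a bound. A bound uniform in finite sets is the form in which the
  lattice sum uses it.\<close>

lemma sum_int_powr_bounded:
  fixes p :: real
  assumes p: "p > 1"
  obtains C where "C \<ge> 0" "\<And>J :: int set. finite J \<Longrightarrow> (\<Sum>k\<in>J. (1 + real_of_int \<bar>k\<bar>) powr (- p)) \<le> C"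
proof -
  define g where "g n = (1 + real n) powr (- p)" for n :: nat
  have "summable (\<lambda>n. real n powr (- p))" using p by (simp add: summable_real_powr_iff)
  then have "summable (\<lambda>n. real (Suc n) powr (- p))" by (rule summable_ignore_initial_segment[where k=1, simplified])
  then have g: "summable g" by (simp add: g_def[abs_def] add.commute)
  have g0: "g n \<ge> 0" for n by (simp add: g_def)
  have half: "(\<Sum>k\<in>J. g (nat \<bar>k\<bar>)) \<le> suminf g" if J: "finite J" and inj: "inj_on (\<lambda>k. nat \<bar>k\<bar>) J" for J :: "int set"
  proof -
    have "(\<Sum>k\<in>J. g (nat \<bar>k\<bar>)) = sum g ((\<lambda>k. nat \<bar>k\<bar>) ` J)"
      by (simp add: sum.reindex[OF inj])
    also have "\<dots> \<le> suminf g" by (rule sum_le_suminf[OF g]) (use J g0 in auto)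
    finally show ?thesis .
  qed
  have "(\<Sum>k\<in>J. (1 + real_of_int \<bar>k\<bar>) powr (- p)) \<le> 2 * suminf g" if J: "finite J" for J :: "int set"
  proof -
    have "(\<Sum>k\<in>J. (1 + real_of_int \<bar>k\<bar>) powr (- p)) = (\<Sum>k\<in>J. g (nat \<bar>k\<bar>))"
      by (intro sum.cong refl) (simp add: g_def)
    also have "\<dots> = (\<Sum>k\<in>{k\<in>J. k \<ge> 0} \<union> {k\<in>J. k < 0}. g (nat \<bar>k\<bar>))"
      by (intro sum.cong) auto
    also have "\<dots> = (\<Sum>k\<in>{k\<in>J. k \<ge> 0}. g (nat \<bar>k\<bar>)) + (\<Sum>k\<in>{k\<in>J. k < 0}. g (nat \<bar>k\<bar>))"
      by (rule sum.union_disjoint) (use J in auto)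
    also have "\<dots> \<le> suminf g + suminf g"
      by (intro add_mono half) (use J in \<open>auto simp: inj_on_def\<close>)
    finally show ?thesis by simp
  qed
  moreover have "2 * suminf g \<ge> 0" using suminf_nonneg[OF g g0] by simp
  ultimately show ?thesis using that by blast
qed

lemma norm_lattice_vec_ge_component: "\<bar>real_of_int (k $ i)\<bar> \<le> norm (lattice_vec k)"
  using component_le_norm_cart[of "lattice_vec k" i] by (simp add: lattice_vec_def)

lemma norm_lattice_vec_ge_1:
  assumes "k \<noteq> 0"
  shows "1 \<le> norm (lattice_vec k)"
proof -
  obtain i where i: "k $ i \<noteq> 0" using assms by (auto simp: vec_eq_iff)
  have "1 \<le> \<bar>real_of_int (k $ i)\<bar>" using i by linarith
  then show ?thesis using norm_lattice_vec_ge_component[of k i] by linarith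
qed

text \<open>For k \<noteq> 0 every 1 + |k_i| is at most 2 |k|, so |k|^(-2r) is dominated by a
  constant times a product of one-dimensional terms, whose sum over a box factorises.\<close>

lemma lattice_norm_powr_summable:
  assumes r: "r > real CARD('n) / 2"
  shows "(\<lambda>k::int ^ 'n. 1 / norm (lattice_vec k :: real ^ 'n) powr (2 * r)) summable_on (UNIV - {0})"
proof (rule nonneg_bdd_above_summable_on)
  \<comment> \<open>The exponent 2r is shared equally among the d coordinates; p > 1 is exactly r >
    d/2.\<close>
  define p where "p = 2 * r / CARD('n)"
  have p: "p > 1" using r by (simp add: p_def field_simps)
  obtain C where C: "C \<ge> 0" "\<And>J :: int set. finite J \<Longrightarrow> (\<Sum>k\<in>J. (1 + real_of_int \<bar>k\<bar>) powr (- p)) \<le> C"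
    using sum_int_powr_bounded[OF p] by blast
  define a where "a k = (1 + real_of_int \<bar>k\<bar>) powr (- p)" for k :: int
  have a0: "a k \<ge> 0" for k by (simp add: a_def)
  let ?N = "\<lambda>k::int^'n. norm (lattice_vec k :: real ^ 'n)"
  have tm: "1 / ?N k powr (2 * r) \<le> 2 powr (2 * r) * (\<Prod>i\<in>UNIV. a (k $ i))" if "k \<noteq> 0" for k
  proof -
    have N: "?N k \<ge> 1" by (rule norm_lattice_vec_ge_1[OF that])
    have "(\<Prod>i\<in>(UNIV::'n set). (2 * ?N k) powr (- p)) \<le> (\<Prod>i\<in>UNIV. a (k $ i))"
    proof (rule prod_mono, intro conjI)
      fix i
      have "1 + real_of_int \<bar>k $ i\<bar> \<le> 2 * ?N k"
        using norm_lattice_vec_ge_component[of k i] N by simp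
      then show "(2 * ?N k) powr (- p) \<le> a (k $ i)"
        unfolding a_def using p by (intro powr_mono2') auto
    qed simp
    moreover have "(\<Prod>i\<in>(UNIV::'n set). (2 * ?N k) powr (- p)) = (2 * ?N k) powr (- (2 * r))"
    proof -
      have "0 < ?N k" using N by linarith
      then have "0 < (2 * ?N k) powr (- p)" by simp
      then have "((2 * ?N k) powr (- p)) ^ CARD('n) = (2 * ?N k) powr (- p * real CARD('n))"
        by (simp only: powr_realpow[symmetric] powr_powr)
      moreover have "- p * real CARD('n) = - (2 * r)" by (simp add: p_def)
      ultimately show ?thesis by (simp only: prod_constant)
    qed
    ultimately have "2 powr (2 * r) * (2 * ?N k) powr (- (2 * r)) \<le> 2 powr (2 * r) * (\<Prod>i\<in>UNIV. a (k $ i))"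
      by (intro mult_left_mono) auto
    moreover have "2 powr (2 * r) * (2 * ?N k) powr (- (2 * r)) = 1 / ?N k powr (2 * r)"
      using N by (simp add: powr_mult powr_minus field_simps)
    ultimately show ?thesis by simp
  qed
  show "bdd_above (sum (\<lambda>k. 1 / ?N k powr (2 * r)) ` {F. F \<subseteq> UNIV - {0} \<and> finite F})"
  proof (rule bdd_aboveI2)
    fix F assume F: "F \<in> {F. F \<subseteq> UNIV - {0 :: int ^ 'n} \<and> finite F}"
    define J where "J = (\<Union>i\<in>UNIV. (\<lambda>k. k $ i) ` F)"
    have J: "finite J" using F by (simp add: J_def)
    have "(\<Sum>k\<in>F. 1 / ?N k powr (2 * r)) \<le> (\<Sum>k\<in>F. 2 powr (2 * r) * (\<Prod>i\<in>UNIV. a (k $ i)))"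
      by (intro sum_mono tm) (use F in auto)
    also have "\<dots> = 2 powr (2 * r) * (\<Sum>k\<in>F. \<Prod>i\<in>UNIV. a (k $ i))"
      by (simp add: sum_distrib_left)
    also have "(\<Sum>k\<in>F. \<Prod>i\<in>UNIV. a (k $ i)) = (\<Sum>g\<in>(\<lambda>k. ($) k) ` F. \<Prod>i\<in>UNIV. a (g i))"
      by (subst sum.reindex) (auto simp: inj_on_def vec_nth_inject)
    \<comment> \<open>F is enlarged to the box J^d, with J the set of all coordinates that occur in
      F.\<close>
    also have "\<dots> \<le> (\<Sum>g\<in>PiE (UNIV::'n set) (\<lambda>_. J). \<Prod>i\<in>UNIV. a (g i))"
      by (rule sum_mono2) (use J a0 in \<open>auto simp: J_def intro!: finite_PiE prod_nonneg\<close>)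
    also have "\<dots> = (\<Prod>i\<in>(UNIV::'n set). \<Sum>k\<in>J. a k)"
      by (rule prod_sum_PiE[symmetric]) (use J in auto)
    also have "\<dots> \<le> C ^ CARD('n)"
      using C(2)[OF J] by (simp add: a_def power_mono sum_nonneg)
    finally show "(\<Sum>k\<in>F. 1 / ?N k powr (2 * r)) \<le> 2 powr (2 * r) * C ^ CARD('n)"
      by (simp add: mult_left_mono)
  qed
qed simp

text \<open>A single unit vector already contributes 1. Summability is essential here, because a
  divergent \<open>infsum\<close> is 0.\<close>

lemma lattice_norm_powr_infsum_ge_1:
  assumes r: "r > real CARD('n) / 2"
  shows "1 \<le> (\<Sum>\<^sub>\<infinity>k\<in>UNIV - {0}. 1 / norm (lattice_vec k :: real ^ 'n) powr (2 * r))"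
proof -
  obtain i :: 'n where True by simp
  have l: "lattice_vec (axis i 1) = (axis i 1 :: real ^ 'n)"
    by (simp add: lattice_vec_def vec_eq_iff axis_def)
  have "sum (\<lambda>k. 1 / norm (lattice_vec k :: real ^ 'n) powr (2 * r)) {axis i 1}
      \<le> (\<Sum>\<^sub>\<infinity>k\<in>UNIV - {0}. 1 / norm (lattice_vec k :: real ^ 'n) powr (2 * r))"
    by (rule finite_sum_le_infsum[OF lattice_norm_powr_summable[OF r]]) (auto simp: axis_eq_0_iff)
  then show ?thesis by (simp add: l)
qed

section \<open>Trigonometric polynomials and the torus\<close>

inductive trig :: "real \<Rightarrow> (real ^ 'n \<Rightarrow> complex) \<Rightarrow> bool" for w where
  monom: "trig w (\<lambda>\<xi>. c * cis (- w * (\<xi> \<bullet> lattice_vec k)))"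
| add: "trig w p \<Longrightarrow> trig w q \<Longrightarrow> trig w (\<lambda>\<xi>. p \<xi> + q \<xi>)"

lemma lattice_vec_add: "lattice_vec (k + l) = lattice_vec k + lattice_vec l"
  by (simp add: lattice_vec_def vec_eq_iff)

lemma lattice_vec_0 [simp]: "lattice_vec 0 = 0"
  by (simp add: lattice_vec_def vec_eq_iff)

lemma inner_lattice_vec_axis: "\<xi> \<bullet> lattice_vec (axis i m) = \<xi> $ i * real_of_int m"
proof -
  have "lattice_vec (axis i m) = axis i (real_of_int m)"
    by (simp add: lattice_vec_def vec_eq_iff axis_def)
  then show ?thesis by (simp add: inner_axis)
qed

lemma trig_const: "trig w (\<lambda>\<xi>. c)"
  using trig.monom[of w c 0] by simp

lemma trig_mult:
  assumes "trig w p" "trig w q"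
  shows "trig w (\<lambda>\<xi>. p \<xi> * q \<xi>)"
  using assms
proof (induction p)
  case (monom c k)
  from monom show ?case
  proof (induction q)
    case (monom d l)
    have "(\<lambda>\<xi>. c * cis (- w * (\<xi> \<bullet> lattice_vec k)) * (d * cis (- w * (\<xi> \<bullet> lattice_vec l))))
       = (\<lambda>\<xi>. (c * d) * cis (- w * (\<xi> \<bullet> lattice_vec (k + l))))"
    proof
      fix \<xi>
      have "cis (- w * (\<xi> \<bullet> lattice_vec (k + l))) = cis (- w * (\<xi> \<bullet> lattice_vec k)) * cis (- w * (\<xi> \<bullet> lattice_vec l))"
        unfolding cis_mult by (simp add: lattice_vec_add inner_add_right algebra_simps)
      then show "c * cis (- w * (\<xi> \<bullet> lattice_vec k)) * (d * cis (- w * (\<xi> \<bullet> lattice_vec l)))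
       = (c * d) * cis (- w * (\<xi> \<bullet> lattice_vec (k + l)))" by (simp only: ac_simps)
    qed
    then show ?case using trig.monom[of w "c * d" "k + l"] by simp
  next
    case (add p q)
    then show ?case unfolding distrib_left by (intro trig.add)
  qed
next
  case (add p1 p2)
  then show ?case unfolding distrib_right by (intro trig.add)
qed

text \<open>The inductive form of \<open>trig\<close> makes closure under products an easy
  induction; this lemma recovers the explicit coefficients from which an element of
  \<open>shift_span\<close> is built.\<close>

lemma trig_finite_sum:
  assumes "trig w p"
  obtains K c where "finite K" "\<And>\<xi>. p \<xi> = (\<Sum>k\<in>K. c k * cis (- w * (\<xi> \<bullet> lattice_vec k)))"
proof -
  have "\<exists>K c. finite K \<and> (\<forall>\<xi>. p \<xi> = (\<Sum>k\<in>K. c k * cis (- w * (\<xi> \<bullet> lattice_vec k))))"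
    using assms
  proof (induction p)
    case (monom c k)
    show ?case by (intro exI[of _ "{k}"] exI[of _ "\<lambda>_. c"]) simp
  next
    case (add p q)
    then obtain K c L d where K: "finite K" "\<And>\<xi>. p \<xi> = (\<Sum>k\<in>K. c k * cis (- w * (\<xi> \<bullet> lattice_vec k)))"
      and L: "finite L" "\<And>\<xi>. q \<xi> = (\<Sum>k\<in>L. d k * cis (- w * (\<xi> \<bullet> lattice_vec k)))" by blast
    show ?case
      by (rule linear_combination_add[OF K(1) L(1), of c "\<lambda>k \<xi>. cis (- w * (\<xi> \<bullet> lattice_vec k))" d])
         (auto simp: K(2) L(2) simp del: mult_minus_left)
  qed
  then show ?thesis using that by blast
qed

lemma trig_mult_L2:
  assumes "trig w p" "b \<in> L2"
  shows "(\<lambda>\<xi>. p \<xi> * b \<xi>) \<in> L2"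
  using assms(1)
proof (induction p)
  case (monom c k)
  show ?case unfolding mult.assoc[of c] by (intro L2_scale L2_modulate assms(2))
next
  case (add p q)
  then show ?case unfolding distrib_right by (intro L2_add)
qed

text \<open>Periodic functions become functions on a compact set, where Stone-Weierstrass
  applies.\<close>

definition torus_map :: "real \<Rightarrow> real ^ 'n \<Rightarrow> complex ^ 'n" where
  "torus_map w \<xi> = (\<chi> i. cis (w * \<xi> $ i))"

text \<open>A right inverse of \<open>torus_map w\<close> on the torus for w > 0; it jumps where a
  coordinate equals -1.\<close>

definition torus_section :: "real \<Rightarrow> complex ^ 'n \<Rightarrow> real ^ 'n" where
  "torus_section w z = (\<chi> i. Arg (z $ i) / w)"

text \<open>The representative of \<open>\<xi>\<close> modulo \<open>(2 * pi / w)\<close> times the integer lattice in the half-open cube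
  with coordinates in \<open>]- pi / w, pi / w]\<close>.\<close>

definition cube_rep :: "real \<Rightarrow> real ^ 'n \<Rightarrow> real ^ 'n" where
  "cube_rep w \<xi> = torus_section w (torus_map w \<xi>)"

lemma torus_map_cube_rep: "w > 0 \<Longrightarrow> torus_map w (cube_rep w \<xi>) = torus_map w \<xi>"
  by (simp add: torus_map_def cube_rep_def torus_section_def vec_eq_iff cis_Arg sgn_eq)

definition torus :: "real \<Rightarrow> (complex ^ 'n) set" where
  "torus w = torus_map w ` cbox (\<chi> i. - pi / w) (\<chi> i. pi / w)"

lemma continuous_on_torus_map: "continuous_on S (torus_map w)"
  unfolding torus_map_def by (intro continuous_intros)

lemma compact_torus: "compact (torus w)"
  unfolding torus_def by (intro compact_continuous_image continuous_on_torus_map compact_cbox)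

lemma cube_rep_bounds: "w > 0 \<Longrightarrow> - (pi / w) < cube_rep w \<xi> $ i" "w > 0 \<Longrightarrow> cube_rep w \<xi> $ i \<le> pi / w"
  using Arg_bounded[of "cis (w * \<xi> $ i)"]
  by (auto simp: cube_rep_def torus_section_def torus_map_def field_simps)

lemma torus_map_in_torus: "w > 0 \<Longrightarrow> torus_map w \<xi> \<in> torus w"
  unfolding torus_def
  by (rule image_eqI[of _ _ "cube_rep w \<xi>"])
     (auto simp: torus_map_cube_rep mem_box_cart less_imp_le[OF cube_rep_bounds(1)] cube_rep_bounds(2))

lemma torus_component: "z \<in> torus w \<Longrightarrow> cmod (z $ i) = 1"
  by (auto simp: torus_def torus_map_def)

text \<open>Stone-Weierstrass on the torus. The real and imaginary parts of the coordinates separate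
  points, and each is a combination of two characters with opposite exponents.\<close>

lemma trig_dense_continuous_real:
  fixes h :: "complex ^ 'n \<Rightarrow> real"
  assumes w: "w > 0" and h: "continuous_on (torus w) h" and e: "e > 0"
  obtains p where "trig w p" "\<And>\<xi>. cmod (complex_of_real (h (torus_map w \<xi>)) - p \<xi>) < e"
proof -
  let ?P = "\<lambda>g :: complex ^ 'n \<Rightarrow> real. continuous_on (torus w) g \<and>
      (\<exists>p. trig w p \<and> (\<forall>\<xi>. complex_of_real (g (torus_map w \<xi>)) = p \<xi>))"
  have cs: "trig w (\<lambda>\<xi>. cis (w * \<xi> $ i))" "trig w (\<lambda>\<xi>. cis (- (w * \<xi> $ i)))" for i :: 'n
    using trig.monom[of w 1 "axis i (-1)"] trig.monom[of w 1 "axis i 1"]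
    by (simp_all add: inner_lattice_vec_axis)
  have "\<exists>g. ?P g \<and> (\<forall>x\<in>torus w. \<bar>h x - g x\<bar> < e)"
  proof (rule Stone_Weierstrass_HOL[OF compact_torus _ _ _ _ _ h e])
    show "?P (\<lambda>x. c)" for c using trig_const[of w "complex_of_real c"] by auto
    show "continuous_on (torus w) f" if "?P f" for f using that by blast
    show "?P (\<lambda>x. f x + g x)" if "?P f \<and> ?P g" for f g
      using that by (auto intro!: continuous_intros) (metis trig.add)
    show "?P (\<lambda>x. f x * g x)" if "?P f \<and> ?P g" for f g
      using that by (auto intro!: continuous_intros) (metis trig_mult)
    fix x y :: "complex ^ 'n" assume "x \<in> torus w \<and> y \<in> torus w \<and> x \<noteq> y"
    then obtain i where i: "x $ i \<noteq> y $ i" by (auto simp: vec_eq_iff)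
    have "?P (\<lambda>z. Re (z $ i))"
    proof (intro conjI exI allI)
      show "trig w (\<lambda>\<xi>. 1/2 * (cis (w * \<xi> $ i) + cis (- (w * \<xi> $ i))))"
        by (intro trig_mult trig_const trig.add cs)
      show "complex_of_real (Re (torus_map w \<xi> $ i)) = 1/2 * (cis (w * \<xi> $ i) + cis (- (w * \<xi> $ i)))" for \<xi> :: "real^'n"
        by (simp add: torus_map_def complex_eq_iff)
    qed (intro continuous_intros)
    moreover have "?P (\<lambda>z. Im (z $ i))"
    proof (intro conjI exI allI)
      show "trig w (\<lambda>\<xi>. - \<i> / 2 * (cis (w * \<xi> $ i) + (- 1) * cis (- (w * \<xi> $ i))))"
        by (intro trig_mult trig_const trig.add cs)
      show "complex_of_real (Im (torus_map w \<xi> $ i)) = - \<i> / 2 * (cis (w * \<xi> $ i) + (- 1) * cis (- (w * \<xi> $ i)))" for \<xi> :: "real^'n"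
        by (simp add: torus_map_def complex_eq_iff)
    qed (intro continuous_intros)
    moreover have "Re (x $ i) \<noteq> Re (y $ i) \<or> Im (x $ i) \<noteq> Im (y $ i)"
      using i by (auto simp: complex_eq_iff)
    ultimately show "\<exists>f. ?P f \<and> f x \<noteq> f y" by blast
  qed
  then obtain g p where g: "\<forall>x\<in>torus w. \<bar>h x - g x\<bar> < e" and p: "trig w p"
    and gp: "\<And>\<xi>. complex_of_real (g (torus_map w \<xi>)) = p \<xi>" by blast
  have "cmod (complex_of_real (h (torus_map w \<xi>)) - p \<xi>) < e" for \<xi>
    using g torus_map_in_torus[OF w, of \<xi>] unfolding gp[symmetric] of_real_diff[symmetric] norm_of_real by blast
  with p show ?thesis by (rule that)
qed

text \<open>Membership of h in the closure of the trigonometric polynomials in L^2 with weight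
  |b|^2; the weight is kept as a factor so that no further measure is introduced.\<close>

definition trig_approximable :: "real \<Rightarrow> (real ^ 'n \<Rightarrow> complex) \<Rightarrow> (real ^ 'n \<Rightarrow> complex) \<Rightarrow> bool" where
  "trig_approximable w b h \<longleftrightarrow> (\<lambda>\<xi>. h \<xi> * b \<xi>) \<in> L2 \<and>
     (\<forall>e>0. \<exists>p. trig w p \<and> L2_norm (\<lambda>\<xi>. h \<xi> * b \<xi> - p \<xi> * b \<xi>) < e)"

lemma continuous_torus_measurable:
  fixes H :: "complex ^ 'n \<Rightarrow> complex"
  assumes w: "w > 0" and H: "continuous_on (torus w) H"
  shows "(\<lambda>\<xi>. H (torus_map w \<xi>)) \<in> borel_measurable lebesgue"
  by (intro continuous_lebesgue_measurable continuous_on_compose2[OF H continuous_on_torus_map])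
     (use torus_map_in_torus[OF w] in auto)

lemma trig_approximable_continuous:
  fixes H :: "complex ^ 'n \<Rightarrow> complex"
  assumes w: "w > 0" and H: "continuous_on (torus w) H" and b: "b \<in> L2"
  shows "trig_approximable w b (\<lambda>\<xi>. H (torus_map w \<xi>))"
  unfolding trig_approximable_def
proof (intro conjI allI impI)
  have [measurable]: "b \<in> borel_measurable lebesgue" using b by (simp add: L2_def)
  have Hm[measurable]: "(\<lambda>\<xi>. H (torus_map w \<xi>)) \<in> borel_measurable lebesgue"
    by (rule continuous_torus_measurable[OF w H])
  have "bounded (H ` torus w)" by (intro compact_imp_bounded compact_continuous_image H compact_torus)
  then obtain B where B: "\<And>z. z \<in> torus w \<Longrightarrow> cmod (H z) \<le> B" unfolding bounded_iff by blast
  show "(\<lambda>\<xi>. H (torus_map w \<xi>) * b \<xi>) \<in> L2"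
  proof (rule L2_dominated(1)[OF _ L2_scale[OF b, of "complex_of_real B"]])
    have "cmod (H (torus_map w \<xi>)) \<le> \<bar>B\<bar>" for \<xi>
      using B[OF torus_map_in_torus[OF w, of \<xi>]] by linarith
    then show "AE \<xi> in lebesgue. cmod (H (torus_map w \<xi>) * b \<xi>) \<le> cmod (complex_of_real B * b \<xi>)"
      by (auto simp: norm_mult intro!: mult_right_mono)
  qed measurable
  fix e :: real assume e: "e > 0"
  \<comment> \<open>The 2 pays for approximating real and imaginary parts separately; the summand 1
    covers norm 0 and makes the final inequality strict.\<close>
  define \<delta> where "\<delta> = e / (2 * (L2_norm b + 1))"
  have b1: "L2_norm b + 1 > 0" by (simp add: add_nonneg_pos)
  have \<delta>: "\<delta> > 0" using e b1 by (simp add: \<delta>_def)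
  obtain p1 where p1: "trig w p1" "\<And>\<xi>. cmod (complex_of_real (Re (H (torus_map w \<xi>))) - p1 \<xi>) < \<delta>"
    using trig_dense_continuous_real[OF w _ \<delta>, of "\<lambda>z. Re (H z)"] H continuous_on_Re by blast
  obtain p2 where p2: "trig w p2" "\<And>\<xi>. cmod (complex_of_real (Im (H (torus_map w \<xi>))) - p2 \<xi>) < \<delta>"
    using trig_dense_continuous_real[OF w _ \<delta>, of "\<lambda>z. Im (H z)"] H continuous_on_Im by blast
  let ?p = "\<lambda>\<xi>. p1 \<xi> + \<i> * p2 \<xi>"
  have p: "trig w ?p" by (intro trig.add trig_mult trig_const p1 p2)
  have le: "cmod (H (torus_map w \<xi>) - ?p \<xi>) \<le> 2 * \<delta>" for \<xi>
  proof -
    let ?z = "H (torus_map w \<xi>)"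
    have "?z - ?p \<xi> = (complex_of_real (Re ?z) - p1 \<xi>) + \<i> * (complex_of_real (Im ?z) - p2 \<xi>)"
      by (subst complex_eq[of ?z]) (simp add: algebra_simps)
    also have "cmod \<dots> \<le> cmod (complex_of_real (Re ?z) - p1 \<xi>) + cmod (\<i> * (complex_of_real (Im ?z) - p2 \<xi>))"
      by (rule norm_triangle_ineq)
    finally show ?thesis using p1(2)[of \<xi>] p2(2)[of \<xi>] by (simp add: norm_mult)
  qed
  have pb: "(\<lambda>\<xi>. ?p \<xi> * b \<xi>) \<in> L2" by (rule trig_mult_L2[OF p b])
  have "L2_norm (\<lambda>\<xi>. H (torus_map w \<xi>) * b \<xi> - ?p \<xi> * b \<xi>) \<le> L2_norm (\<lambda>\<xi>. complex_of_real (2 * \<delta>) * b \<xi>)"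
  proof (rule L2_dominated(2)[OF _ L2_scale[OF b]])
    have [measurable]: "(\<lambda>\<xi>. ?p \<xi> * b \<xi>) \<in> borel_measurable lebesgue" using pb by (simp add: L2_def)
    show "(\<lambda>\<xi>. H (torus_map w \<xi>) * b \<xi> - ?p \<xi> * b \<xi>) \<in> borel_measurable lebesgue" by measurable
    show "AE \<xi> in lebesgue. cmod (H (torus_map w \<xi>) * b \<xi> - ?p \<xi> * b \<xi>) \<le> cmod (complex_of_real (2 * \<delta>) * b \<xi>)"
      unfolding left_diff_distrib[symmetric] norm_mult norm_of_real
      using le \<delta> by (intro AE_I2 mult_right_mono) auto
  qed
  also have "\<dots> = 2 * \<delta> * L2_norm b" using \<delta> by (simp add: L2_norm_scale)
  also have "\<dots> < e" using e b1 by (simp add: \<delta>_def field_simps)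
  finally show "\<exists>p. trig w p \<and> L2_norm (\<lambda>\<xi>. H (torus_map w \<xi>) * b \<xi> - p \<xi> * b \<xi>) < e"
    using p by blast
qed

text \<open>Closure under dominated limits almost everywhere, used once to pass from continuous to
  bounded multipliers and once from bounded to unbounded ones.\<close>

lemma trig_approximable_limit:
  fixes h :: "nat \<Rightarrow> real ^ 'n \<Rightarrow> complex"
  assumes b: "b \<in> L2" and h: "\<And>n. trig_approximable w b (h n)" and gL: "(\<lambda>\<xi>. g \<xi> * b \<xi>) \<in> L2"
    and lim: "AE \<xi> in lebesgue. (\<lambda>n. h n \<xi>) \<longlonglongrightarrow> g \<xi>"
    and W: "integrable lebesgue W" "\<And>n. AE \<xi> in lebesgue. (cmod (h n \<xi> * b \<xi> - g \<xi> * b \<xi>))\<^sup>2 \<le> W \<xi>"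
  shows "trig_approximable w b g"
  unfolding trig_approximable_def
proof (intro conjI gL allI impI)
  fix e :: real assume e: "e > 0"
  have hL: "(\<lambda>\<xi>. h n \<xi> * b \<xi>) \<in> L2" for n using h by (simp add: trig_approximable_def)
  have "(\<lambda>n. L2_norm (\<lambda>\<xi>. h n \<xi> * b \<xi> - g \<xi> * b \<xi>)) \<longlonglongrightarrow> 0"
  proof (rule L2_dominated_convergence[OF _ W(1) _ W(2)])
    show "(\<lambda>\<xi>. h n \<xi> * b \<xi> - g \<xi> * b \<xi>) \<in> borel_measurable lebesgue" for n
      by (intro L2_measurable L2_diff hL gL)
    show "AE \<xi> in lebesgue. (\<lambda>n. h n \<xi> * b \<xi> - g \<xi> * b \<xi>) \<longlonglongrightarrow> 0"
      using lim
    proof eventually_elim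
      case (elim \<xi>)
      have "(\<lambda>n. h n \<xi> * b \<xi> - g \<xi> * b \<xi>) \<longlonglongrightarrow> g \<xi> * b \<xi> - g \<xi> * b \<xi>"
        by (intro tendsto_intros elim)
      then show ?case by simp
    qed
  qed
  then have "\<forall>\<^sub>F n in sequentially. L2_norm (\<lambda>\<xi>. h n \<xi> * b \<xi> - g \<xi> * b \<xi>) < e/2"
    by (rule order_tendstoD) (use e in simp)
  then obtain n where n: "L2_norm (\<lambda>\<xi>. h n \<xi> * b \<xi> - g \<xi> * b \<xi>) < e/2"
    using eventually_happens'[OF sequentially_bot] by blast
  obtain p where p: "trig w p" "L2_norm (\<lambda>\<xi>. h n \<xi> * b \<xi> - p \<xi> * b \<xi>) < e/2"
    using h[of n] half_gt_zero[OF e] unfolding trig_approximable_def by blast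
  have "L2_norm (\<lambda>\<xi>. g \<xi> * b \<xi> - p \<xi> * b \<xi>) < e"
    using L2_norm_triangle_diff[OF gL hL[of n] trig_mult_L2[OF p(1) b]] n p(2)
      L2_norm_minus_commute[of "\<lambda>\<xi>. g \<xi> * b \<xi>" "\<lambda>\<xi>. h n \<xi> * b \<xi>"] by linarith
  then show "\<exists>p. trig w p \<and> L2_norm (\<lambda>\<xi>. g \<xi> * b \<xi> - p \<xi> * b \<xi>) < e" using p(1) by blast
qed

section \<open>Density of trigonometric polynomials\<close>

lemma AE_lebesgue_translate:
  fixes t :: "'a::euclidean_space"
  assumes "AE x in lebesgue. P x"
  shows "AE x in lebesgue. P (x + t)"
proof -
  obtain N where N: "N \<in> null_sets lebesgue" "\<And>x. \<not> P x \<Longrightarrow> x \<in> N"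
    using assms by (auto simp: eventually_ae_filter)
  have [measurable]: "(indicator N :: 'a \<Rightarrow> ennreal) \<in> borel_measurable lebesgue"
    using N(1) by (intro borel_measurable_indicator) auto
  have "(\<integral>\<^sup>+x. indicator N x \<partial>lebesgue) = 0" using N(1) by (simp add: null_setsD1 null_setsD2)
  then have "(\<integral>\<^sup>+x. indicator N (t + 1 *\<^sub>R x) \<partial>lebesgue) = 0"
    using nn_integral_lebesgue_affine[of 1 "indicator N" t] by simp
  then have "AE x in lebesgue. indicator N (t + 1 *\<^sub>R x) = (0::ennreal)"
    using measurable_lebesgue_affine[of 1 "indicator N :: 'a \<Rightarrow> ennreal" t]
    by (subst (asm) nn_integral_0_iff_AE) auto
  then show ?thesis
    by eventually_elim (use N(2) in \<open>auto simp: indicator_eq_0_iff add.commute\<close>)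
qed

lemma cube_rep_translate:
  assumes w: "w > 0"
  shows "\<exists>k. cube_rep w \<xi> = \<xi> + (2 * pi / w) *\<^sub>R lattice_vec k"
proof -
  have "\<exists>m::int. Arg (cis (w * \<xi> $ i)) = w * \<xi> $ i + 2 * pi * m" for i
  proof -
    have "cis (Arg (cis (w * \<xi> $ i))) = cis (w * \<xi> $ i)" by (simp add: cis_Arg sgn_eq)
    then have "sin (Arg (cis (w * \<xi> $ i))) = sin (w * \<xi> $ i) \<and> cos (Arg (cis (w * \<xi> $ i))) = cos (w * \<xi> $ i)"
      by (simp add: complex_eq_iff)
    then show ?thesis by (auto simp: sin_cos_eq_iff)
  qed
  then obtain m :: "'a \<Rightarrow> int" where m: "\<And>i. Arg (cis (w * \<xi> $ i)) = w * \<xi> $ i + 2 * pi * m i" by metis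
  have "cube_rep w \<xi> = \<xi> + (2 * pi / w) *\<^sub>R lattice_vec (\<chi> i. m i)"
    using w by (simp add: cube_rep_def torus_section_def torus_map_def vec_eq_iff m lattice_vec_def field_simps)
  then show ?thesis ..
qed

lemma torus_map_periodic:
  assumes w: "w > 0"
  shows "torus_map w (\<xi> + (2 * pi / w) *\<^sub>R lattice_vec k) = torus_map w \<xi>"
proof -
  have "cis (w * (\<xi> + (2 * pi / w) *\<^sub>R lattice_vec k) $ i) = cis (w * \<xi> $ i)" for i
  proof -
    have "w * (\<xi> + (2 * pi / w) *\<^sub>R lattice_vec k) $ i = w * \<xi> $ i + 2 * pi * real_of_int (k $ i)"
      using w by (simp add: lattice_vec_def field_simps)
    then show ?thesis by (simp add: cis_mult[symmetric] cis_multiple_2pi)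
  qed
  then show ?thesis by (simp add: torus_map_def vec_eq_iff)
qed

lemma cube_rep_periodic:
  "w > 0 \<Longrightarrow> cube_rep w (\<xi> + (2 * pi / w) *\<^sub>R lattice_vec k) = cube_rep w \<xi>"
  unfolding cube_rep_def by (simp add: torus_map_periodic)

text \<open>Half-open, so that its lattice translates tile the space without overlap; it differs
  from the closed cube by a null set.\<close>

definition cube :: "real \<Rightarrow> (real ^ 'n) set" where
  "cube w = {\<xi>. \<forall>i. - (pi / w) < \<xi> $ i \<and> \<xi> $ i \<le> pi / w}"

lemma cube_rep_in_cube: "w > 0 \<Longrightarrow> cube_rep w \<xi> \<in> cube w"
  by (simp add: cube_def cube_rep_bounds)

lemma cube_rep_id:
  assumes w: "w > 0" and \<xi>: "\<xi> \<in> cube w"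
  shows "cube_rep w \<xi> = \<xi>"
proof -
  have "Arg (cis (w * \<xi> $ i)) = w * \<xi> $ i" for i
  proof (rule Arg_cis)
    show "w * \<xi> $ i \<in> {-pi<..pi}"
      using \<xi> w by (auto simp: cube_def field_simps)
  qed
  then show ?thesis using w by (simp add: cube_rep_def torus_section_def torus_map_def vec_eq_iff)
qed

lemma cube_translate_unique:
  assumes w: "w > 0"
  shows "\<exists>!k. \<xi> + (2 * pi / w) *\<^sub>R lattice_vec k \<in> cube w"
proof -
  obtain k where k: "cube_rep w \<xi> = \<xi> + (2 * pi / w) *\<^sub>R lattice_vec k" using cube_rep_translate[OF w] by blast
  show ?thesis
  proof (rule ex1I)
    show "\<xi> + (2 * pi / w) *\<^sub>R lattice_vec k \<in> cube w" using cube_rep_in_cube[OF w, of \<xi>] k by simp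
    fix l assume "\<xi> + (2 * pi / w) *\<^sub>R lattice_vec l \<in> cube w"
    then have "\<xi> + (2 * pi / w) *\<^sub>R lattice_vec l = cube_rep w \<xi>"
      using cube_rep_id[OF w] cube_rep_periodic[OF w] by metis
    then show "l = k" unfolding k using w by (simp add: lattice_vec_def vec_eq_iff)
  qed
qed

text \<open>At every point \<open>cube_rep w\<close> is one of countably many translations, so the
  preimage of a null set lies in a countable union of null sets.\<close>

lemma AE_cube_rep:
  fixes P :: "real ^ 'n \<Rightarrow> bool"
  assumes w: "w > 0" and P: "AE x in lebesgue. P x"
  shows "AE \<xi> in lebesgue. P (cube_rep w \<xi>)"
proof -
  have "AE \<xi> in lebesgue. \<forall>k::int^'n. P (\<xi> + (2 * pi / w) *\<^sub>R lattice_vec k)"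
    unfolding AE_all_countable by (intro allI AE_lebesgue_translate P)
  then show ?thesis
  proof eventually_elim
    case (elim \<xi>)
    obtain k where "cube_rep w \<xi> = \<xi> + (2 * pi / w) *\<^sub>R lattice_vec k"
      using cube_rep_translate[OF w] by blast
    then show ?case using elim by simp
  qed
qed

lemma AE_component_neq: "AE \<xi> in lebesgue. \<forall>i. \<xi> $ i \<noteq> (c :: real)" for c
proof -
  have "AE \<xi> in lebesgue. \<xi> $ i \<noteq> c" for i
  proof -
    have "negligible {\<xi>. \<xi> $ i = c}"
      unfolding cart_eq_inner_axis by (rule negligible_standard_hyperplane) simp
    then show ?thesis by (intro AE_I'[of "{\<xi>. \<xi> $ i = c}"]) (auto simp: negligible_iff_null_sets)
  qed
  then show ?thesis unfolding AE_all_countable by blast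
qed

lemma cube_measurable [measurable]: "cube w \<in> sets lebesgue"
proof -
  have "cube w = (\<Inter>i. {\<xi>::real^'n. - (pi / w) < \<xi> $ i} \<inter> {\<xi>. \<xi> $ i \<le> pi / w})"
    by (auto simp: cube_def)
  also have "\<dots> \<in> sets borel"
    by (intro sets.countable_INT'' sets.Int borel_open borel_closed open_Collect_less closed_Collect_le continuous_intros)
       auto
  finally show ?thesis by auto
qed

text \<open>The factor \<open>\<kappa>\<close> vanishes at the points of the torus where \<open>Arg\<close> jumps.\<close>

lemma continuous_on_cutoff_section:
  fixes g :: "real ^ 'n \<Rightarrow> complex" and w N M :: real
  assumes w: "w > 0" and N: "N > 0" and M: "M > 0" and g: "continuous_on UNIV g"
  defines "\<kappa> \<equiv> \<lambda>z :: complex ^ 'n. \<Prod>i\<in>UNIV. min 1 (max 0 (N * (1 + Re (z $ i))))"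
  shows "continuous_on (torus w) (\<lambda>z. complex_of_real (\<kappa> z) * clamp_norm M (g (torus_section w z)))"
  unfolding continuous_on_def
proof
  fix z :: "complex ^ 'n" assume z: "z \<in> torus w"
  let ?H = "\<lambda>z. complex_of_real (\<kappa> z) * clamp_norm M (g (torus_section w z))"
  have \<kappa>: "(\<kappa> \<longlongrightarrow> \<kappa> z) (at z within torus w)"
    unfolding \<kappa>_def by (intro tendsto_intros)
  show "(?H \<longlongrightarrow> ?H z) (at z within torus w)"
  proof (cases "\<exists>i. z $ i = -1")
    case True
    then obtain i where "z $ i = -1" by blast
    then have z0: "\<kappa> z = 0" unfolding \<kappa>_def by (intro prod_zero bexI[of _ i]) auto
    \<comment> \<open>The clamped factor is bounded by M, so the vanishing cutoff alone forces the
      limit 0, whatever \<open>Arg\<close> does nearby.\<close>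
    have "(?H \<longlongrightarrow> 0) (at z within torus w)"
    proof (rule Lim_null_comparison)
      show "\<forall>\<^sub>F y in at z within torus w. norm (?H y) \<le> \<bar>\<kappa> y\<bar> * M"
        by (intro always_eventually allI) (auto simp: norm_mult intro!: mult_left_mono clamp_norm_le M)
      have "((\<lambda>y. \<bar>\<kappa> y\<bar> * M) \<longlongrightarrow> \<bar>\<kappa> z\<bar> * M) (at z within torus w)" by (intro tendsto_intros \<kappa>)
      then show "((\<lambda>y. \<bar>\<kappa> y\<bar> * M) \<longlongrightarrow> 0) (at z within torus w)" by (simp add: z0)
    qed
    then show ?thesis by (simp add: z0)
  next
    case False
    \<comment> \<open>A number of modulus 1 on the nonpositive real axis is -1, so every coordinate
      avoids the branch cut of \<open>Arg\<close>.\<close>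
    have n: "z $ i \<notin> \<real>\<^sub>\<le>\<^sub>0" for i
    proof
      assume "z $ i \<in> \<real>\<^sub>\<le>\<^sub>0"
      then have r: "Im (z $ i) = 0" "Re (z $ i) \<le> 0" by (auto simp: complex_nonpos_Reals_iff)
      have "(cmod (z $ i))\<^sup>2 = 1" by (simp add: torus_component[OF z])
      then have "(Re (z $ i))\<^sup>2 = 1" using r by (simp add: cmod_power2)
      then have "Re (z $ i) = -1" using r by (auto simp: power2_eq_1_iff)
      then have "z $ i = -1" using r by (simp add: complex_eq_iff)
      then show False using False by blast
    qed
    have "((\<lambda>y. Arg (y $ i)) \<longlongrightarrow> Arg (z $ i)) (at z within torus w)" for i
      by (rule isCont_tendsto_compose[OF continuous_at_Arg[OF n]]) (intro tendsto_intros)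
    then have "((\<lambda>y. torus_section w y) \<longlongrightarrow> torus_section w z) (at z within torus w)"
      unfolding torus_section_def by (intro tendsto_vec_lambda tendsto_divide tendsto_const) (use w in auto)
    moreover have "isCont g (torus_section w z)" using g by (simp add: continuous_on_eq_continuous_at)
    ultimately have "((\<lambda>y. g (torus_section w y)) \<longlongrightarrow> g (torus_section w z)) (at z within torus w)"
      by (rule isCont_tendsto_compose[rotated])
    then show ?thesis by (intro tendsto_intros tendsto_clamp_norm \<kappa> M)
  qed
qed

text \<open>Completeness of \<open>lebesgue\<close> permits changing the pointwise limit on a null
  set.\<close>

lemma lebesgue_measurable_AE_limit:
  fixes f :: "real ^ 'n \<Rightarrow> complex"
  assumes [measurable]: "\<And>n. h n \<in> borel_measurable lebesgue" and lim: "AE x in lebesgue. (\<lambda>n. h n x) \<longlonglongrightarrow> f x"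
  shows "f \<in> borel_measurable lebesgue"
proof (rule borel_measurable_AE)
  show "(\<lambda>x. lim (\<lambda>n. h n x)) \<in> borel_measurable lebesgue" by measurable
  show "AE x in lebesgue. lim (\<lambda>n. h n x) = f x" using lim by eventually_elim (rule limI)
qed

text \<open>Continuous approximants of m are transported to the torus, clamped, and multiplied by
  cutoffs that eventually equal 1 unless a coordinate of the representative is pi/w, which happens
  only on a null set.\<close>

lemma continuous_approx_cube_rep:
  fixes m :: "real ^ 'n \<Rightarrow> complex"
  assumes w: "w > 0" and m: "m \<in> borel_measurable lebesgue" and M: "M > 0"
  obtains H where "\<And>n::nat. continuous_on (torus w) (H n)" "\<And>n z. z \<in> torus w \<Longrightarrow> cmod (H n z) \<le> M"
    "AE \<xi> in lebesgue. (\<lambda>n. H n (torus_map w \<xi>)) \<longlonglongrightarrow> clamp_norm M (m (cube_rep w \<xi>))"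
proof -
  obtain g where g: "\<And>n::nat. continuous_on UNIV (g n)" and gl: "AE x in lebesgue. (\<lambda>n. g n x) \<longlonglongrightarrow> m x"
    using lebesgue_measurable_continuous_approx[OF m] by blast
  define \<kappa> where "\<kappa> n z = (\<Prod>i\<in>UNIV. min 1 (max 0 (real (Suc n) * (1 + Re (z $ i)))))" for n and z :: "complex ^ 'n"
  define H where "H n z = complex_of_real (\<kappa> n z) * clamp_norm M (g n (torus_section w z))" for n z
  have "continuous_on (torus w) (H n)" for n
    unfolding H_def \<kappa>_def by (rule continuous_on_cutoff_section[OF w _ M g]) simp
  moreover have "cmod (H n z) \<le> M" for n z
  proof -
    have "0 \<le> \<kappa> n z" "\<kappa> n z \<le> 1" by (auto simp: \<kappa>_def intro!: prod_nonneg prod_le_1)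
    then have "cmod (H n z) \<le> 1 * M"
      unfolding H_def norm_mult by (intro mult_mono clamp_norm_le M) auto
    then show ?thesis by simp
  qed
  moreover have "AE \<xi> in lebesgue. (\<lambda>n. H n (torus_map w \<xi>)) \<longlonglongrightarrow> clamp_norm M (m (cube_rep w \<xi>))"
    using AE_cube_rep[OF w gl] AE_cube_rep[OF w AE_component_neq[of "pi / w"]]
  proof eventually_elim
    case (elim \<xi>)
    have k1: "(\<lambda>n. \<kappa> n (torus_map w \<xi>)) \<longlonglongrightarrow> (\<Prod>i\<in>(UNIV::'n set). 1)"
      unfolding \<kappa>_def
    proof (intro tendsto_prod)
      fix i
      have "cis (w * \<xi> $ i) \<noteq> - 1"
      proof
        assume "cis (w * \<xi> $ i) = - 1"
        moreover have "Arg (- 1) = pi" using Arg_cis[of pi] by (simp add: cis_pi)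
        ultimately have "cube_rep w \<xi> $ i = pi / w"
          by (simp add: cube_rep_def torus_section_def torus_map_def)
        with elim(2) show False by blast
      qed
      have "cos (w * \<xi> $ i) \<noteq> - 1"
      proof
        assume "cos (w * \<xi> $ i) = - 1"
        moreover from this have "sin (w * \<xi> $ i) = 0" using sin_cos_squared_add[of "w * \<xi> $ i"] by simp
        ultimately have "cis (w * \<xi> $ i) = - 1" by (simp add: complex_eq_iff)
        with \<open>cis (w * \<xi> $ i) \<noteq> - 1\<close> show False by blast
      qed
      then have c: "1 + cos (w * \<xi> $ i) > 0" using cos_ge_minus_one[of "w * \<xi> $ i"] by linarith
      obtain n0 :: nat where n0: "1 / (1 + cos (w * \<xi> $ i)) \<le> real n0" using real_arch_simple by blast
      have "min 1 (max 0 (real (Suc n) * (1 + Re (torus_map w \<xi> $ i)))) = 1" if "n \<ge> n0" for n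
      proof -
        have "1 / (1 + cos (w * \<xi> $ i)) \<le> real (Suc n)" using n0 that by linarith
        then have "1 \<le> real (Suc n) * (1 + cos (w * \<xi> $ i))" using c by (simp add: pos_divide_le_eq)
        then show ?thesis by (simp add: torus_map_def)
      qed
      then show "(\<lambda>n. min 1 (max 0 (real (Suc n) * (1 + Re (torus_map w \<xi> $ i))))) \<longlonglongrightarrow> 1"
        by (intro tendsto_eventually) (auto simp: eventually_sequentially)
    qed
    have "(\<lambda>n. H n (torus_map w \<xi>)) \<longlonglongrightarrow> complex_of_real (\<Prod>i\<in>(UNIV::'n set). 1) * clamp_norm M (m (cube_rep w \<xi>))"
      unfolding H_def cube_rep_def[symmetric] by (intro tendsto_intros tendsto_clamp_norm k1 M elim(1))
    then show ?case by simp
  qed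
  ultimately show ?thesis by (intro that)
qed

lemma clamp_norm_tendsto: "(\<lambda>n. clamp_norm (real (Suc n)) z) \<longlonglongrightarrow> z"
proof (rule tendsto_eventually)
  obtain n0 :: nat where "cmod z \<le> real n0" using real_arch_simple by blast
  then have "clamp_norm (real (Suc n)) z = z" if "n \<ge> n0" for n
    using that by (intro clamp_norm_id) auto
  then show "\<forall>\<^sub>F n in sequentially. clamp_norm (real (Suc n)) z = z" by (auto simp: eventually_sequentially)
qed

lemma clamp_norm_le_norm: "N > 0 \<Longrightarrow> cmod (clamp_norm N z) \<le> cmod z"
  by (auto simp: clamp_norm_def norm_mult norm_divide max_def mult_left_le_one_le divide_le_eq)

text \<open>Obtained from approximation by continuous functions: the clamped compositions are limits
  of continuous functions almost everywhere, and the clamps converge pointwise.\<close>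

lemma measurable_cube_rep:
  fixes m :: "real ^ 'n \<Rightarrow> complex"
  assumes w: "w > 0" and m: "m \<in> borel_measurable lebesgue"
  shows "(\<lambda>\<xi>. m (cube_rep w \<xi>)) \<in> borel_measurable lebesgue"
proof (rule lebesgue_measurable_AE_limit)
  show "(\<lambda>\<xi>. clamp_norm (real (Suc n)) (m (cube_rep w \<xi>))) \<in> borel_measurable lebesgue" for n
  proof -
    have p: "real (Suc n) > 0" by simp
    obtain H where H: "\<And>n::nat. continuous_on (torus w) (H n)"
      and "\<And>j z. z \<in> torus w \<Longrightarrow> cmod (H j z) \<le> real (Suc n)"
      and l: "AE \<xi> in lebesgue. (\<lambda>j. H j (torus_map w \<xi>)) \<longlonglongrightarrow> clamp_norm (real (Suc n)) (m (cube_rep w \<xi>))"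
      using continuous_approx_cube_rep[OF w m p] by blast
    show ?thesis by (rule lebesgue_measurable_AE_limit[OF continuous_torus_measurable[OF w H] l])
  qed
  show "AE \<xi> in lebesgue. (\<lambda>n. clamp_norm (real (Suc n)) (m (cube_rep w \<xi>))) \<longlonglongrightarrow> m (cube_rep w \<xi>)"
    by (intro AE_I2 clamp_norm_tendsto)
qed

text \<open>Two dominated limits: for clamped m the majorant is a multiple of |b|^2; removing the
  clamp costs at most a multiple of |m b|^2, integrable by assumption even when m is
  unbounded.\<close>

theorem trig_approximable_cube_rep:
  fixes m b :: "real ^ 'n \<Rightarrow> complex"
  assumes w: "w > 0" and b: "b \<in> L2" and m: "m \<in> borel_measurable lebesgue"
    and mb: "(\<lambda>\<xi>. m (cube_rep w \<xi>) * b \<xi>) \<in> L2"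
  shows "trig_approximable w b (\<lambda>\<xi>. m (cube_rep w \<xi>))"
proof -
  have [measurable]: "b \<in> borel_measurable lebesgue" using b by (simp add: L2_def)
  note mm[measurable] = measurable_cube_rep[OF w m]
  have clL: "(\<lambda>\<xi>. clamp_norm M (m (cube_rep w \<xi>)) * b \<xi>) \<in> L2" if M: "M > 0" for M
  proof (rule L2_dominated(1)[OF _ mb])
    have [measurable]: "(\<lambda>\<xi>. clamp_norm M (m (cube_rep w \<xi>))) \<in> borel_measurable lebesgue"
      by (rule measurable_compose[OF mm borel_measurable_continuous_onI]) (intro continuous_intros M)
    show "(\<lambda>\<xi>. clamp_norm M (m (cube_rep w \<xi>)) * b \<xi>) \<in> borel_measurable lebesgue" by measurable
  qed (auto simp: norm_mult intro!: mult_right_mono clamp_norm_le_norm M)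
  have bdd: "trig_approximable w b (\<lambda>\<xi>. clamp_norm M (m (cube_rep w \<xi>)))" if M: "M > 0" for M
  proof -
    obtain H where H: "\<And>n::nat. continuous_on (torus w) (H n)" and HM: "\<And>n z. z \<in> torus w \<Longrightarrow> cmod (H n z) \<le> M"
      and l: "AE \<xi> in lebesgue. (\<lambda>n. H n (torus_map w \<xi>)) \<longlonglongrightarrow> clamp_norm M (m (cube_rep w \<xi>))"
      using continuous_approx_cube_rep[OF w m M] by blast
    show ?thesis
    proof (rule trig_approximable_limit[OF b trig_approximable_continuous[OF w H b] clL[OF M] l])
      show "integrable lebesgue (\<lambda>\<xi>. (2 * M)\<^sup>2 * (cmod (b \<xi>))\<^sup>2)"
        using L2_integrable[OF b] by (rule integrable_mult_right)
      show "AE \<xi> in lebesgue. (cmod (H n (torus_map w \<xi>) * b \<xi> - clamp_norm M (m (cube_rep w \<xi>)) * b \<xi>))\<^sup>2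
          \<le> (2 * M)\<^sup>2 * (cmod (b \<xi>))\<^sup>2" for n
      proof (rule AE_I2)
        fix \<xi>
        have "cmod (H n (torus_map w \<xi>) - clamp_norm M (m (cube_rep w \<xi>))) \<le> 2 * M"
          using norm_triangle_ineq4[of "H n (torus_map w \<xi>)" "clamp_norm M (m (cube_rep w \<xi>))"]
            HM[OF torus_map_in_torus[OF w], of n \<xi>] clamp_norm_le[OF M, of "m (cube_rep w \<xi>)"] by linarith
        then show "(cmod (H n (torus_map w \<xi>) * b \<xi> - clamp_norm M (m (cube_rep w \<xi>)) * b \<xi>))\<^sup>2
          \<le> (2 * M)\<^sup>2 * (cmod (b \<xi>))\<^sup>2"
          unfolding left_diff_distrib[symmetric] norm_mult power_mult_distrib[symmetric]
          by (intro power_mono mult_right_mono) auto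
      qed
    qed
  qed
  show ?thesis
  proof (rule trig_approximable_limit[OF b _ mb])
    show "trig_approximable w b (\<lambda>\<xi>. clamp_norm (real (Suc n)) (m (cube_rep w \<xi>)))" for n
      by (rule bdd) simp
    show "AE \<xi> in lebesgue. (\<lambda>n. clamp_norm (real (Suc n)) (m (cube_rep w \<xi>))) \<longlonglongrightarrow> m (cube_rep w \<xi>)"
      by (intro AE_I2 clamp_norm_tendsto)
    show "integrable lebesgue (\<lambda>\<xi>. 2\<^sup>2 * (cmod (m (cube_rep w \<xi>) * b \<xi>))\<^sup>2)"
      using L2_integrable[OF mb] by (rule integrable_mult_right)
    show "AE \<xi> in lebesgue. (cmod (clamp_norm (real (Suc n)) (m (cube_rep w \<xi>)) * b \<xi> - m (cube_rep w \<xi>) * b \<xi>))\<^sup>2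
        \<le> 2\<^sup>2 * (cmod (m (cube_rep w \<xi>) * b \<xi>))\<^sup>2" for n
    proof (rule AE_I2)
      fix \<xi>
      let ?z = "m (cube_rep w \<xi>)"
      have "cmod (clamp_norm (real (Suc n)) ?z - ?z) \<le> 2 * cmod ?z"
        using norm_triangle_ineq4[of "clamp_norm (real (Suc n)) ?z" ?z] clamp_norm_le_norm[of "real (Suc n)" ?z] by simp
      then show "(cmod (clamp_norm (real (Suc n)) ?z * b \<xi> - ?z * b \<xi>))\<^sup>2 \<le> 2\<^sup>2 * (cmod (?z * b \<xi>))\<^sup>2"
        unfolding left_diff_distrib[symmetric] norm_mult power_mult_distrib[symmetric] mult.assoc[symmetric]
        by (intro power_mono mult_right_mono) auto
    qed
  qed
qed

section \<open>Periodization\<close>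

text \<open>An enumeration of the lattice turns lattice sums into series, for which integration term
  by term is available.\<close>

lemma bij_nat_int_vec: "\<exists>e :: nat \<Rightarrow> int ^ 'n. bij e"
proof -
  obtain i :: 'n where True by simp
  have "inj (\<lambda>m::int. axis i m)" by (auto simp: inj_def axis_eq_axis)
  then have "infinite (range (\<lambda>m::int. axis i m))" using infinite_UNIV_int by (simp add: finite_image_iff)
  then have "infinite (UNIV :: (int ^ 'n) set)" by (rule infinite_super[OF subset_UNIV])
  then show ?thesis using bij_betw_from_nat_into[of "UNIV :: (int ^ 'n) set"] by auto
qed

lemma lattice_vec_minus: "lattice_vec (- k) = - lattice_vec k"
  by (simp add: lattice_vec_def vec_eq_iff)

lemma nn_integral_periodize:
  fixes F :: "real ^ 'n \<Rightarrow> ennreal" and e :: "nat \<Rightarrow> int ^ 'n"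
  assumes w: "w > 0" and F[measurable]: "F \<in> borel_measurable lebesgue" and e: "bij e"
  shows "(\<integral>\<^sup>+\<xi>. F \<xi> \<partial>lebesgue)
    = (\<integral>\<^sup>+\<xi>. indicator (cube w) \<xi> * (\<Sum>n. F (\<xi> + (2 * pi / w) *\<^sub>R lattice_vec (e n))) \<partial>lebesgue)"
proof -
  define t where "t n = ((2 * pi / w) *\<^sub>R lattice_vec (e n) :: real ^ 'n)" for n
  have Ft[measurable]: "(\<lambda>\<xi>. F (\<xi> + t n)) \<in> borel_measurable lebesgue" for n
    using measurable_lebesgue_affine[of 1 F "t n"] by (simp add: add.commute)
  have [measurable]: "(\<lambda>\<xi>. indicator (cube w) (\<xi> - t n) :: ennreal) \<in> borel_measurable lebesgue" for n
    using measurable_lebesgue_affine[of 1 "indicator (cube w) :: real ^ 'n \<Rightarrow> ennreal" "- t n"]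
    by simp
  \<comment> \<open>Exactly one translated cube contains \<xi>, so the indicators form a partition
    of unity; integrating term by term and translating back gives the claim.\<close>
  have pt: "F \<xi> = (\<Sum>n. F \<xi> * indicator (cube w) (\<xi> - t n))" for \<xi>
  proof -
    obtain k where k: "\<xi> + (2 * pi / w) *\<^sub>R lattice_vec k \<in> cube w"
      and ku: "\<And>l. \<xi> + (2 * pi / w) *\<^sub>R lattice_vec l \<in> cube w \<Longrightarrow> l = k"
      using cube_translate_unique[OF w, of \<xi>] by (auto elim!: ex1E)
    obtain N where N: "e N = - k" using e by (metis bij_pointE)
    have iff: "\<xi> - t n \<in> cube w \<longleftrightarrow> n = N" for n
    proof
      assume "\<xi> - t n \<in> cube w"
      then have "\<xi> + (2 * pi / w) *\<^sub>R lattice_vec (- e n) \<in> cube w" by (simp add: t_def lattice_vec_minus)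
      then have "- e n = k" by (rule ku)
      then have "e n = e N" using N by (metis minus_minus)
      then show "n = N" using e by (simp add: bij_def inj_eq)
    next
      assume "n = N"
      then show "\<xi> - t n \<in> cube w" using k by (simp add: t_def N lattice_vec_minus)
    qed
    have "(\<Sum>n. F \<xi> * indicator (cube w) (\<xi> - t n)) = (\<Sum>n\<in>{N}. F \<xi> * indicator (cube w) (\<xi> - t n))"
      by (rule suminf_finite) (auto simp: iff)
    then show ?thesis by (simp add: iff)
  qed
  have "(\<integral>\<^sup>+\<xi>. F \<xi> \<partial>lebesgue) = (\<integral>\<^sup>+\<xi>. (\<Sum>n. F \<xi> * indicator (cube w) (\<xi> - t n)) \<partial>lebesgue)"
    using pt by (intro nn_integral_cong) simp
  also have "\<dots> = (\<Sum>n. \<integral>\<^sup>+\<xi>. F \<xi> * indicator (cube w) (\<xi> - t n) \<partial>lebesgue)"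
    by (rule nn_integral_suminf) measurable
  also have "\<dots> = (\<Sum>n. \<integral>\<^sup>+\<xi>. indicator (cube w) \<xi> * F (\<xi> + t n) \<partial>lebesgue)"
  proof (rule arg_cong[where f=suminf], rule ext)
    fix n
    have "(\<integral>\<^sup>+\<xi>. F \<xi> * indicator (cube w) (\<xi> - t n) \<partial>lebesgue)
      = ennreal (\<bar>1\<bar> ^ DIM(real ^ 'n)) * (\<integral>\<^sup>+\<xi>. F (t n + 1 *\<^sub>R \<xi>) * indicator (cube w) (t n + 1 *\<^sub>R \<xi> - t n) \<partial>lebesgue)"
      by (rule nn_integral_lebesgue_affine) auto
    then show "(\<integral>\<^sup>+\<xi>. F \<xi> * indicator (cube w) (\<xi> - t n) \<partial>lebesgue) = (\<integral>\<^sup>+\<xi>. indicator (cube w) \<xi> * F (\<xi> + t n) \<partial>lebesgue)"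
      by (simp add: ac_simps)
  qed
  also have "\<dots> = (\<integral>\<^sup>+\<xi>. (\<Sum>n. indicator (cube w) \<xi> * F (\<xi> + t n)) \<partial>lebesgue)"
    by (rule nn_integral_suminf[symmetric]) measurable
  finally show ?thesis by (simp add: t_def)
qed

text \<open>On the cube, \<open>m\<close> minimizes the periodized error pointwise: it is the coefficient of the
  orthogonal projection of the vector \<open>(h \<xi>, 0, 0, \<dots>)\<close> onto the line spanned by the values of
  \<open>b\<close> on the coset of \<open>\<xi>\<close>.\<close>

lemma cube_projection:
  fixes b h :: "real ^ 'n \<Rightarrow> complex"
  assumes w: "w > 0" and b: "b \<in> L2" and h: "h \<in> L2"
  defines "E \<equiv> \<lambda>\<xi>. (cmod (h \<xi>))\<^sup>2 *
         (1 - (cmod (b \<xi>))\<^sup>2 / (\<Sum>\<^sub>\<infinity>k. (cmod (b (\<xi> + (2 * pi / w) *\<^sub>R lattice_vec k)))\<^sup>2))"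
  obtains m where "m \<in> borel_measurable lebesgue" "(\<lambda>\<xi>. m (cube_rep w \<xi>) * b \<xi>) \<in> L2"
    "(L2_norm (\<lambda>\<xi>. indicator (cube w) \<xi> * h \<xi> - m (cube_rep w \<xi>) * b \<xi>))\<^sup>2
     = (LINT \<xi>|lebesgue. indicator (cube w) \<xi> * E \<xi>)"
    "(\<lambda>\<xi>. indicator (cube w) \<xi> * E \<xi>) \<in> borel_measurable lebesgue"
proof -
  obtain e :: "nat \<Rightarrow> int ^ 'n" where e: "bij e" using bij_nat_int_vec by blast
  define t where "t n = ((2 * pi / w) *\<^sub>R lattice_vec (e n) :: real ^ 'n)" for n
  have [measurable]: "b \<in> borel_measurable lebesgue" "h \<in> borel_measurable lebesgue"
    using b h by (auto simp: L2_def)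
  have bt[measurable]: "(\<lambda>\<xi>. b (\<xi> + t n)) \<in> borel_measurable lebesgue" for n
    using measurable_lebesgue_affine[of 1 b "t n"] by (simp add: add.commute)
  have cnj_meas: "(\<lambda>\<xi>. cnj (g \<xi>)) \<in> borel_measurable lebesgue" if "g \<in> borel_measurable lebesgue" for g :: "real^'n \<Rightarrow> complex"
    by (rule measurable_compose[OF that borel_measurable_continuous_onI]) (intro continuous_intros)
  define S where "S \<xi> = (\<Sum>n. (cmod (b (\<xi> + t n)))\<^sup>2)" for \<xi>
  have [measurable]: "S \<in> borel_measurable lebesgue" unfolding S_def[abs_def] by measurable
  \<comment> \<open>A divergent series has no meaningful \<open>suminf\<close>. Periodizing |b|^2,
    which has finite integral, shows that such points of the cube form a null set.\<close>
  define ok where "ok \<xi> \<longleftrightarrow> summable (\<lambda>n. (cmod (b (\<xi> + t n)))\<^sup>2)" for \<xi>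
  have ok_AE: "AE \<xi> in lebesgue. \<xi> \<in> cube w \<longrightarrow> ok \<xi>"
  proof -
    have "(\<integral>\<^sup>+\<xi>. indicator (cube w) \<xi> * (\<Sum>n. ennreal ((cmod (b (\<xi> + t n)))\<^sup>2)) \<partial>lebesgue)
      = (\<integral>\<^sup>+\<xi>. ennreal ((cmod (b \<xi>))\<^sup>2) \<partial>lebesgue)"
      unfolding t_def by (rule nn_integral_periodize[OF w _ e, symmetric]) measurable
    then have "(\<integral>\<^sup>+\<xi>. indicator (cube w) \<xi> * (\<Sum>n. ennreal ((cmod (b (\<xi> + t n)))\<^sup>2)) \<partial>lebesgue) \<noteq> \<infinity>"
      using b by (simp add: L2_iff_nn less_top)
    then have "AE \<xi> in lebesgue. indicator (cube w) \<xi> * (\<Sum>n. ennreal ((cmod (b (\<xi> + t n)))\<^sup>2)) \<noteq> \<infinity>"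
      by (intro nn_integral_PInf_AE) measurable
    then show ?thesis
    proof eventually_elim
      case (elim \<xi>)
      show ?case
      proof
        assume "\<xi> \<in> cube w"
        then have "(\<Sum>n. ennreal ((cmod (b (\<xi> + t n)))\<^sup>2)) \<noteq> top" using elim by simp
        then show "ok \<xi>" unfolding ok_def by (intro summable_suminf_not_top) auto
      qed
    qed
  qed
  have S0: "S \<xi> \<ge> 0" if "ok \<xi>" for \<xi>
    unfolding S_def using that by (intro suminf_nonneg) (auto simp: ok_def)
  have bS: "(cmod (b \<xi>))\<^sup>2 \<le> S \<xi>" if "ok \<xi>" for \<xi>
  proof -
    obtain N where "e N = 0" using e by (metis bij_pointE)
    then have "(cmod (b \<xi>))\<^sup>2 = (\<Sum>n\<in>{N}. (cmod (b (\<xi> + t n)))\<^sup>2)" by (simp add: t_def)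
    also have "\<dots> \<le> S \<xi>" unfolding S_def using that by (intro sum_le_suminf) (auto simp: ok_def)
    finally show ?thesis .
  qed
  have S_infsum: "(\<Sum>\<^sub>\<infinity>k. (cmod (b (\<xi> + (2 * pi / w) *\<^sub>R lattice_vec k)))\<^sup>2) = S \<xi>" if "ok \<xi>" for \<xi>
  proof -
    have "(\<Sum>\<^sub>\<infinity>k. (cmod (b (\<xi> + (2 * pi / w) *\<^sub>R lattice_vec k)))\<^sup>2) = (\<Sum>\<^sub>\<infinity>n. (cmod (b (\<xi> + t n)))\<^sup>2)"
      unfolding t_def by (rule infsum_reindex_bij_betw[OF e, symmetric])
    also have "\<dots> = S \<xi>"
      unfolding S_def using that by (intro infsumI norm_summable_imp_has_sum summable_sums) (auto simp: ok_def)
    finally show ?thesis .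
  qed
  \<comment> \<open>The projection coefficient: inner product with b over the squared norm of b on
    the coset. Where S = 0 and the series converges, b vanishes on the coset and the value 0 of the
    division is right.\<close>
  define m where "m \<xi> = h \<xi> * cnj (b \<xi>) / complex_of_real (S \<xi>)" for \<xi>
  have mm: "m \<in> borel_measurable lebesgue"
    unfolding m_def[abs_def] using cnj_meas[of b] by measurable
  define p where "p \<xi> = m (cube_rep w \<xi>) * b \<xi>" for \<xi>
  have pm[measurable]: "p \<in> borel_measurable lebesgue"
    unfolding p_def[abs_def] using measurable_cube_rep[OF w mm] by measurable
  \<comment> \<open>The squared norm of the projection on the coset of \<xi>, that is |m|^2
    S.\<close>
  define q where "q \<xi> = (cmod (h \<xi>))\<^sup>2 * (cmod (b \<xi>))\<^sup>2 / S \<xi>" for \<xi>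
  have [measurable]: "q \<in> borel_measurable lebesgue" unfolding q_def[abs_def] by measurable
  have q_bounds: "0 \<le> q \<xi> \<and> q \<xi> \<le> (cmod (h \<xi>))\<^sup>2" if "ok \<xi>" for \<xi>
  proof (cases "S \<xi> = 0")
    case False
    then have "S \<xi> > 0" using S0[OF that] by simp
    then show ?thesis unfolding q_def using bS[OF that] by (simp add: divide_le_eq mult_left_mono)
  qed (simp add: q_def)
  have "(\<integral>\<^sup>+\<xi>. ennreal ((cmod (p \<xi>))\<^sup>2) \<partial>lebesgue)
      = (\<integral>\<^sup>+\<xi>. indicator (cube w) \<xi> * (\<Sum>n. ennreal ((cmod (p (\<xi> + t n)))\<^sup>2)) \<partial>lebesgue)"
    unfolding t_def by (rule nn_integral_periodize[OF w _ e]) measurable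
  \<comment> \<open>On the coset of a point of the cube the multiplier is constant, so the squares
    of p sum to |m|^2 S.\<close>
  also have "\<dots> = (\<integral>\<^sup>+\<xi>. ennreal (indicator (cube w) \<xi> * q \<xi>) \<partial>lebesgue)"
  proof (rule nn_integral_cong_AE)
    show "AE \<xi> in lebesgue. indicator (cube w) \<xi> * (\<Sum>n. ennreal ((cmod (p (\<xi> + t n)))\<^sup>2)) = ennreal (indicator (cube w) \<xi> * q \<xi>)"
      using ok_AE
    proof eventually_elim
      case (elim \<xi>)
      show ?case
      proof (cases "\<xi> \<in> cube w")
        case True
        then have ok: "ok \<xi>" using elim by blast
        have pt: "(cmod (p (\<xi> + t n)))\<^sup>2 = (cmod (m \<xi>))\<^sup>2 * (cmod (b (\<xi> + t n)))\<^sup>2" for n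
          unfolding p_def t_def cube_rep_periodic[OF w] cube_rep_id[OF w True] by (simp add: norm_mult power_mult_distrib)
        have "(\<Sum>n. ennreal ((cmod (p (\<xi> + t n)))\<^sup>2)) = ennreal (\<Sum>n. (cmod (m \<xi>))\<^sup>2 * (cmod (b (\<xi> + t n)))\<^sup>2)"
          unfolding pt using ok by (intro suminf_ennreal2 summable_mult) (auto simp: ok_def)
        also have "(\<Sum>n. (cmod (m \<xi>))\<^sup>2 * (cmod (b (\<xi> + t n)))\<^sup>2) = (cmod (m \<xi>))\<^sup>2 * S \<xi>"
          unfolding S_def using ok by (intro suminf_mult) (auto simp: ok_def)
        also have "\<dots> = q \<xi>"
          by (simp add: m_def q_def norm_mult norm_divide power_mult_distrib power_divide power2_eq_square)
        finally show ?thesis using True by simp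
      qed simp
    qed
  qed
  finally have np: "(\<integral>\<^sup>+\<xi>. ennreal ((cmod (p \<xi>))\<^sup>2) \<partial>lebesgue) = (\<integral>\<^sup>+\<xi>. ennreal (indicator (cube w) \<xi> * q \<xi>) \<partial>lebesgue)" .
  have q_AE: "AE \<xi> in lebesgue. 0 \<le> indicator (cube w) \<xi> * q \<xi> \<and> indicator (cube w) \<xi> * q \<xi> \<le> (cmod (h \<xi>))\<^sup>2"
    using ok_AE by eventually_elim (use q_bounds in \<open>auto simp: indicator_def\<close>)
  have qi: "integrable lebesgue (\<lambda>\<xi>. indicator (cube w) \<xi> * q \<xi>)"
  proof (rule Bochner_Integration.integrable_bound[OF L2_integrable[OF h]])
    show "AE \<xi> in lebesgue. norm (indicator (cube w) \<xi> * q \<xi>) \<le> norm ((cmod (h \<xi>))\<^sup>2)"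
      using q_AE by eventually_elim simp
  qed measurable
  have np2: "(\<integral>\<^sup>+\<xi>. ennreal ((cmod (p \<xi>))\<^sup>2) \<partial>lebesgue) = ennreal (LINT \<xi>|lebesgue. indicator (cube w) \<xi> * q \<xi>)"
    unfolding np by (rule nn_integral_eq_integral[OF qi]) (use q_AE in auto)
  have pL: "p \<in> L2" unfolding L2_iff_nn np2 by simp
  have pn: "(L2_norm p)\<^sup>2 = (LINT \<xi>|lebesgue. indicator (cube w) \<xi> * q \<xi>)"
  proof -
    have "0 \<le> (LINT \<xi>|lebesgue. indicator (cube w) \<xi> * q \<xi>)"
      by (rule integral_nonneg_AE) (use q_AE in auto)
    then show ?thesis using L2_norm_sq_nn[OF pL] unfolding np2 by simp
  qed
  define G where "G \<xi> = indicator (cube w) \<xi> * h \<xi>" for \<xi>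
  have [measurable]: "G \<in> borel_measurable lebesgue" unfolding G_def[abs_def] by measurable
  have GL: "G \<in> L2"
    by (rule L2_dominated(1)[OF _ h]) (auto simp: G_def indicator_def)
  have Gn: "(L2_norm G)\<^sup>2 = (LINT \<xi>|lebesgue. indicator (cube w) \<xi> * (cmod (h \<xi>))\<^sup>2)"
    unfolding L2_norm_sq by (intro Bochner_Integration.integral_cong refl) (simp add: G_def indicator_def)
  have hi: "integrable lebesgue (\<lambda>\<xi>. indicator (cube w) \<xi> * (cmod (h \<xi>))\<^sup>2)"
    using L2_integrable[OF GL] by (rule Bochner_Integration.integrable_cong[THEN iffD1, rotated -1]) (auto simp: G_def indicator_def)
  \<comment> \<open>Since G vanishes off the cube, only one point of each coset enters, and the
    inner product has the same value as the squared norm of p.\<close>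
  have "L2_inner G p = (LINT \<xi>|lebesgue. complex_of_real (indicator (cube w) \<xi> * q \<xi>))"
    unfolding L2_inner_def
  proof (intro Bochner_Integration.integral_cong refl)
    fix \<xi>
    show "G \<xi> * cnj (p \<xi>) = complex_of_real (indicator (cube w) \<xi> * q \<xi>)"
    proof (cases "\<xi> \<in> cube w")
      case True
      then have "G \<xi> * cnj (p \<xi>) = (h \<xi> * cnj (h \<xi>)) * (b \<xi> * cnj (b \<xi>)) / complex_of_real (S \<xi>)"
        by (simp add: G_def p_def cube_rep_id[OF w True] m_def)
      also have "\<dots> = complex_of_real (q \<xi>)"
        unfolding complex_norm_square[symmetric] by (simp add: q_def)
      finally show ?thesis using True by simp
    qed (simp add: G_def)
  qed
  then have inner: "Re (L2_inner G p) = (LINT \<xi>|lebesgue. indicator (cube w) \<xi> * q \<xi>)"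
    unfolding integral_complex_of_real by simp
  let ?l = "\<lambda>\<xi>. indicator (cube w) \<xi> * (cmod (h \<xi>))\<^sup>2 - indicator (cube w) \<xi> * q \<xi>"
  have ae: "AE \<xi> in lebesgue. ?l \<xi> = indicator (cube w) \<xi> * E \<xi>"
    using ok_AE by eventually_elim (auto simp: E_def S_infsum q_def indicator_def right_diff_distrib)
  have l: "?l \<in> borel_measurable lebesgue" by measurable
  note Em = borel_measurable_AE[OF l ae]
  \<comment> \<open>Expanding the square gives the integral of q once from the norm and minus twice
    from the inner product.\<close>
  have "(L2_norm (\<lambda>\<xi>. G \<xi> - p \<xi>))\<^sup>2 = (LINT \<xi>|lebesgue. indicator (cube w) \<xi> * (cmod (h \<xi>))\<^sup>2 - indicator (cube w) \<xi> * q \<xi>)"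
    unfolding L2_norm_diff_sq[OF GL pL] Gn pn inner Bochner_Integration.integral_diff[OF hi qi] by simp
  also have "\<dots> = (LINT \<xi>|lebesgue. indicator (cube w) \<xi> * E \<xi>)"
    by (rule integral_cong_AE[OF l Em ae])
  finally show ?thesis using that[OF mm pL[unfolded p_def[abs_def]] _ Em] unfolding G_def p_def by blast
qed

section \<open>The high-frequency tail and the final estimate\<close>

lemma norm_ge_off_cube:
  assumes "w > 0" "\<xi> \<notin> cube w"
  shows "pi / w \<le> norm \<xi>"
proof -
  obtain i where "\<not> (- (pi / w) < \<xi> $ i \<and> \<xi> $ i \<le> pi / w)" using assms(2) by (auto simp: cube_def)
  then have "pi / w \<le> \<bar>\<xi> $ i\<bar>" by linarith
  then show ?thesis using component_le_norm_cart[of \<xi> i] by linarith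
qed

text \<open>Off the cube the Sobolev weight is at least (pi/w)^(2r), so after multiplication by
  (w/pi)^(2r) it is at least 1 and dominates the tail pointwise.\<close>

lemma sobolev_tail:
  fixes f :: "real ^ 'n \<Rightarrow> complex"
  assumes w: "w > 0" and r: "r \<ge> 0" and f: "f \<in> sobolev r"
  shows "L2_norm (\<lambda>\<xi>. fourier f \<xi> - indicator (cube w) \<xi> * fourier f \<xi>) \<le> sobolev_norm r f * (w / pi) powr r"
proof -
  let ?g = "\<lambda>\<xi>. fourier f \<xi> - indicator (cube w) \<xi> * fourier f \<xi>"
  let ?s = "\<lambda>\<xi>. (1 + (norm \<xi>)\<^sup>2) powr r * (cmod (fourier f \<xi>))\<^sup>2"
  have fL: "f \<in> L2" and si: "integrable lebesgue ?s" using f by (auto simp: sobolev_def)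
  have [measurable]: "fourier f \<in> borel_measurable lebesgue" by (rule L2_measurable[OF fourier_L2[OF fL]])
  have "(L2_norm ?g)\<^sup>2 \<le> (LINT \<xi>|lebesgue. ((w / pi) powr r)\<^sup>2 * ?s \<xi>)"
  proof (rule L2_bounded(2))
    show "integrable lebesgue (\<lambda>\<xi>. ((w / pi) powr r)\<^sup>2 * ?s \<xi>)" using si by (rule integrable_mult_right)
    show "AE \<xi> in lebesgue. (cmod (?g \<xi>))\<^sup>2 \<le> ((w / pi) powr r)\<^sup>2 * ?s \<xi>"
    proof (rule AE_I2)
      fix \<xi>
      show "(cmod (?g \<xi>))\<^sup>2 \<le> ((w / pi) powr r)\<^sup>2 * ?s \<xi>"
      proof (cases "\<xi> \<in> cube w")
        case False
        have "pi / w \<le> norm \<xi>" by (rule norm_ge_off_cube[OF w False])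
        then have "(pi / w)\<^sup>2 \<le> (norm \<xi>)\<^sup>2" using w by (intro power_mono) auto
        then have "(pi / w)\<^sup>2 \<le> 1 + (norm \<xi>)\<^sup>2" by simp
        then have "((pi / w)\<^sup>2) powr r \<le> (1 + (norm \<xi>)\<^sup>2) powr r" using r w by (intro powr_mono2) auto
        moreover have "((pi / w)\<^sup>2) powr r = ((pi / w) powr r)\<^sup>2"
          using w by (simp add: power2_eq_square powr_mult powr_divide)
        moreover have "((w / pi) powr r)\<^sup>2 * ((pi / w) powr r)\<^sup>2 = 1"
          using w by (simp add: power_mult_distrib[symmetric] powr_mult[symmetric])
        ultimately have "1 \<le> ((w / pi) powr r)\<^sup>2 * (1 + (norm \<xi>)\<^sup>2) powr r"
          by (metis mult_left_mono zero_le_power2)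
        then have "1 * (cmod (fourier f \<xi>))\<^sup>2 \<le> ((w / pi) powr r)\<^sup>2 * (1 + (norm \<xi>)\<^sup>2) powr r * (cmod (fourier f \<xi>))\<^sup>2"
          by (intro mult_right_mono) auto
        then show ?thesis using False by (simp add: mult.assoc)
      qed simp
    qed
  qed measurable
  also have "\<dots> = (sobolev_norm r f * (w / pi) powr r)\<^sup>2"
    by (simp add: sobolev_norm_def power_mult_distrib integral_nonneg_AE)
  finally show ?thesis by (rule power2_le_imp_le) (simp add: sobolev_norm_def)
qed

theorem theorem3p3:
  fixes \<phi> f :: "real ^ 'n \<Rightarrow> complex" and T s r :: real
  assumes "CARD('n) \<ge> 2"
    and "T > 0" and "s > 0"
    and "\<phi> \<in> L2"
    and "riesz_basis_shifts T s \<phi>"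
    and "r > real CARD('n) / 2"
    and "f \<in> sobolev r"
  shows "\<exists>R. L2_norm (\<lambda>x. shift_proj T s \<phi> f x - f x) =
           sqrt (LINT \<xi>:cbox (\<chi> i. - pi / (T * s)) (\<chi> i. pi / (T * s))|lebesgue.
                   (cmod (fourier f \<xi>))\<^sup>2 * error_kernel \<phi> s (T *\<^sub>R \<xi>)) + R \<and>
         R \<le> sobolev_norm r f * (T * s / pi) powr r *
             sqrt (\<Sum>\<^sub>\<infinity>n\<in>UNIV - {0}. 1 / norm (lattice_vec n :: real ^ 'n) powr (2 * r))"
proof -
  define w where "w = T * s"
  have w: "w > 0" using assms(2,3) by (simp add: w_def)
  have "0 \<le> real CARD('n) / 2" by simp
  then have r: "r \<ge> 0" using assms(6) by linarith
  have fL: "f \<in> L2" using assms(7) by (simp add: sobolev_def)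
  note T = \<open>T > 0\<close> and \<phi> = \<open>\<phi> \<in> L2\<close>
  define b where "b \<xi> = fourier \<phi> (T *\<^sub>R \<xi>)" for \<xi>
  have b: "b \<in> L2" unfolding b_def using L2_affine[OF _ fourier_L2[OF \<phi>], of T 0] T by simp
  note h = fourier_L2[OF fL]
  have [measurable]: "b \<in> borel_measurable lebesgue" "fourier f \<in> borel_measurable lebesgue"
    using b h by (auto intro: L2_measurable)
  define Ek where "Ek \<xi> = (cmod (fourier f \<xi>))\<^sup>2 *
         (1 - (cmod (b \<xi>))\<^sup>2 / (\<Sum>\<^sub>\<infinity>k. (cmod (b (\<xi> + (2 * pi / w) *\<^sub>R lattice_vec k)))\<^sup>2))" for \<xi>
  obtain m where m: "m \<in> borel_measurable lebesgue" and mb: "(\<lambda>\<xi>. m (cube_rep w \<xi>) * b \<xi>) \<in> L2"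
    and main: "(L2_norm (\<lambda>\<xi>. indicator (cube w) \<xi> * fourier f \<xi> - m (cube_rep w \<xi>) * b \<xi>))\<^sup>2
     = (LINT \<xi>|lebesgue. indicator (cube w) \<xi> * Ek \<xi>)"
    and Em: "(\<lambda>\<xi>. indicator (cube w) \<xi> * Ek \<xi>) \<in> borel_measurable lebesgue"
    using cube_projection[OF w b h] unfolding Ek_def by blast
  let ?I = "LINT \<xi>:cbox (\<chi> i. - pi / (T * s)) (\<chi> i. pi / (T * s))|lebesgue.
                   (cmod (fourier f \<xi>))\<^sup>2 * error_kernel \<phi> s (T *\<^sub>R \<xi>)"
  let ?X = "sobolev_norm r f * (T * s / pi) powr r *
             sqrt (\<Sum>\<^sub>\<infinity>n\<in>UNIV - {0}. 1 / norm (lattice_vec n :: real ^ 'n) powr (2 * r))"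
  \<comment> \<open>Dilation by T carries the lattice step 2 pi / w of the periodization to the step
    2 pi / s of the error kernel.\<close>
  have Ek: "(cmod (fourier f \<xi>))\<^sup>2 * error_kernel \<phi> s (T *\<^sub>R \<xi>) = Ek \<xi>" for \<xi>
  proof -
    have "T *\<^sub>R (\<xi> + (2 * pi / w) *\<^sub>R lattice_vec k) = T *\<^sub>R \<xi> + (2 * pi / s) *\<^sub>R lattice_vec k" for k
      using T \<open>s > 0\<close> by (simp add: scaleR_add_right w_def)
    then show ?thesis unfolding Ek_def error_kernel_def b_def by simp
  qed
  \<comment> \<open>The closed and the half-open cube differ only where some coordinate equals - pi
    / w.\<close>
  have ae: "AE \<xi> in lebesgue. indicator (cube w) \<xi> * Ek \<xi>
      = indicat_real (cbox (\<chi> i. - pi / (T * s)) (\<chi> i. pi / (T * s))) \<xi> *\<^sub>R Ek \<xi>"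
    using AE_component_neq[of "- (pi / w)"]
    by eventually_elim (auto simp: indicator_def cube_def mem_box_cart w_def less_le eq_commute[of "- _"])
  have "?I = (LINT \<xi>|lebesgue. indicator (cube w) \<xi> * Ek \<xi>)"
    unfolding set_lebesgue_integral_def Ek
    by (rule integral_cong_AE[OF Em borel_measurable_AE[OF Em ae] ae, symmetric])
  then have I: "L2_norm (\<lambda>\<xi>. indicator (cube w) \<xi> * fourier f \<xi> - m (cube_rep w \<xi>) * b \<xi>) = sqrt ?I"
    unfolding main[symmetric] by simp
  have X: "sobolev_norm r f * (w / pi) powr r \<le> ?X"
  proof -
    have "sobolev_norm r f * (w / pi) powr r * 1 \<le> ?X"
      unfolding w_def
      by (intro mult_left_mono) (use lattice_norm_powr_infsum_ge_1[OF assms(6)] in \<open>auto simp: sobolev_norm_def\<close>)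
    then show ?thesis by simp
  qed
  have GL: "(\<lambda>\<xi>. indicator (cube w) \<xi> * fourier f \<xi>) \<in> L2"
    by (rule L2_dominated(1)[OF _ h]) (auto simp: indicator_def)
  have "L2_norm (\<lambda>x. shift_proj T s \<phi> f x - f x) \<le> sqrt ?I + ?X"
  \<comment> \<open>The multiple m b is in general only a limit of functions p b with p a
    trigonometric polynomial, so the competitor exists up to e.\<close>
  proof (rule field_le_epsilon)
    fix e :: real assume "e > 0"
    then obtain p where p: "trig w p" and pe: "L2_norm (\<lambda>\<xi>. m (cube_rep w \<xi>) * b \<xi> - p \<xi> * b \<xi>) < e"
      using trig_approximable_cube_rep[OF w b m mb] unfolding trig_approximable_def by blast
    obtain K c where K: "finite K" and pc: "\<And>\<xi>. p \<xi> = (\<Sum>k\<in>K. c k * cis (- w * (\<xi> \<bullet> lattice_vec k)))"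
      using trig_finite_sum[OF p] by blast
    \<comment> \<open>The coefficients of p, rescaled so that the transform of this combination of
      shifts is exactly p b.\<close>
    let ?h = "\<lambda>x. \<Sum>k\<in>K. (complex_of_real (T powr (- real CARD('n) / 2)) * c k) * shifted T s \<phi> k x"
    have "?h \<in> shift_span T s \<phi>"
      unfolding shift_span_def using K
      by (intro CollectI exI[of _ K] exI[of _ "\<lambda>k. complex_of_real (T powr (- real CARD('n) / 2)) * c k"]) simp
    then have "L2_norm (\<lambda>x. shift_proj T s \<phi> f x - f x) \<le> L2_norm (\<lambda>x. f x - ?h x)"
      by (rule shift_proj_best_approx[OF T \<phi> fL])
    also have "\<dots> = L2_norm (\<lambda>\<xi>. fourier f \<xi> - p \<xi> * b \<xi>)"
      unfolding L2_norm_diff_shifts[OF T fL \<phi>] by (simp only: pc b_def w_def sum_distrib_right mult.assoc)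
    also have "\<dots> \<le> L2_norm (\<lambda>\<xi>. fourier f \<xi> - indicator (cube w) \<xi> * fourier f \<xi>)
        + L2_norm (\<lambda>\<xi>. indicator (cube w) \<xi> * fourier f \<xi> - p \<xi> * b \<xi>)"
      by (rule L2_norm_triangle_diff[OF h GL trig_mult_L2[OF p b]])
    also have "L2_norm (\<lambda>\<xi>. indicator (cube w) \<xi> * fourier f \<xi> - p \<xi> * b \<xi>)
        \<le> sqrt ?I + L2_norm (\<lambda>\<xi>. m (cube_rep w \<xi>) * b \<xi> - p \<xi> * b \<xi>)"
      unfolding I[symmetric] by (rule L2_norm_triangle_diff[OF GL mb trig_mult_L2[OF p b]])
    finally show "L2_norm (\<lambda>x. shift_proj T s \<phi> f x - f x) \<le> sqrt ?I + ?X + e"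
      using pe X sobolev_tail[OF w r assms(7)] by linarith
  qed
  then show ?thesis
    by (intro exI[of _ "L2_norm (\<lambda>x. shift_proj T s \<phi> f x - f x) - sqrt ?I"]) simp
qed

end
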